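(* Let $\mathcal{G}$ be a 2-group and let $\mathcal{V},\mathcal{W}\in 2\mathrm{Rep}(\mathcal{G})$. Then for every $g\in\mathcal{G}$: (1) $\chi_{\mathcal{V}\oplus\mathcal{W}}(g)\simeq\chi_{\mathcal{V}}(g)\oplus\chi_{\mathcal{W}}(g)$; (2) $\chi_{\mathcal{V}\boxtimes\mathcal{W}}(g)\simeq\chi_{\mathcal{V}}(g)\otimes\chi_{\mathcal{W}}(g)$; (3) $\chi_{\mathcal{V}^{\mathrm{op}}}(g)\simeq\chi_{\mathcal{V}}(g^* )$.
   Context: $k$ is an algebraically closed field of characteristic $0$ and $\mathrm{Vec}$ is the category of finite-dimensional $k$-vector spaces. A 2-group is a monoidal category in which every object is invertible and every morphism is an isomorphism; $g^*$ denotes a chosen (left, hence also right) dual of $g\in\mathcal{G}$. $2\mathrm{Rep}(\mathcal{G})$ is the 2-category $\mathrm{Fun}(\mathrm{B}\mathcal{G},2\mathrm{Vec})$ of finite semisimple 2-representations, where $\mathrm{B}\mathcal{G}$ is the one-object delooping of $\mathcal{G}$ and $2\mathrm{Vec}$ is the 2-category of finite semisimple $k$-linear categories; equivalently, an object is a finite semisimple $k$-linear category $\mathcal{V}$ with a left $\mathcal{G}$-module structure $\odot$ by $k$-linear functors. $\mathcal{V}\oplus\mathcal{W}$ is the direct sum with componentwise action, and $\mathcal{V}\boxtimes\mathcal{W}$ is the Deligne tensor product with the diagonal action $g\odot(v\boxtimes w)=(g\odot v)\boxtimes(g\odot w)$. The dual 2-representation $\mathcal{V}^{\mathrm{op}}$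 is the opposite category, where $g$ acts by the opposite of the functor $g\odot-$, and a morphism $a$ of $\mathcal{G}$ acts by the opposite of the natural transformation $a^{-1}\odot-$. The 2-character of $\mathcal{V}$ is the functor $\chi_{\mathcal{V}}\colon\mathcal{G}\to\mathrm{Vec}$, $\chi_{\mathcal{V}}(g):=\mathrm{Nat}(1_{\mathcal{V}},g\odot-)$ (natural transformations of endofunctors of $\mathcal{V}$), with morphisms of $\mathcal{G}$ acting by post-composition. Equivalently $\chi_{\mathcal{V}}(g)\simeq\bigoplus_{v\in\mathrm{Irr}(\mathcal{V})}\mathcal{V}(v,g\odot v)$, where $\mathrm{Irr}(\mathcal{V})$ is the set of isomorphism classes of simple objects. *)

theory Defs
  imports "HOL-Algebra.Algebra"
begin

section \<open>Vector spaces\<close>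

text \<open>
  A \<open>K\<close>-vector space is a \<^locale>\<open>module\<close> over a field \<open>K\<close>. The record type
  extends that of rings; the fields \<open>monoid.mult\<close> and \<open>one\<close> play no role for modules and are
  left \<open>undefined\<close> below.
\<close>

definition linear_map ::
    "('k, 'r) ring_scheme \<Rightarrow> ('k, 'a, 's) module_scheme \<Rightarrow> ('k, 'b, 't) module_scheme
      \<Rightarrow> ('a \<Rightarrow> 'b) \<Rightarrow> bool"
  where "linear_map K M N \<phi> \<longleftrightarrow>
    \<phi> \<in> carrier M \<rightarrow> carrier N \<and>
    (\<forall>x\<in>carrier M. \<forall>y\<in>carrier M. \<phi> (x \<oplus>\<^bsub>M\<^esub> y) = \<phi> x \<oplus>\<^bsub>N\<^esub> \<phi> y) \<and>
    (\<forall>c\<in>carrier K. \<forall>x\<in>carrier M. \<phi> (c \<odot>\<^bsub>M\<^esub> x) = c \<odot>\<^bsub>N\<^esub> \<phi> x)"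

definition linearly_isomorphic ::
    "('k, 'r) ring_scheme \<Rightarrow> ('k, 'a, 's) module_scheme \<Rightarrow> ('k, 'b, 't) module_scheme \<Rightarrow> bool"
  where "linearly_isomorphic K M N \<longleftrightarrow>
    (\<exists>\<phi>. linear_map K M N \<phi> \<and> bij_betw \<phi> (carrier M) (carrier N))"

definition finite_dim :: "('k, 'r) ring_scheme \<Rightarrow> ('k, 'a, 's) module_scheme \<Rightarrow> bool"
  where "finite_dim K M \<longleftrightarrow>
    (\<exists>B. finite B \<and> B \<subseteq> carrier M \<and>
      (\<forall>v\<in>carrier M. \<exists>c \<in> B \<rightarrow> carrier K. v = (\<Oplus>\<^bsub>M\<^esub>b\<in>B. c b \<odot>\<^bsub>M\<^esub> b)))"

definition module_sum ::
    "('k, 'a, 's) module_scheme \<Rightarrow> ('k, 'b, 't) module_scheme \<Rightarrow> ('k, 'a \<times> 'b) module"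
  where "module_sum M N =
    \<lparr>carrier = carrier M \<times> carrier N, monoid.mult = undefined, one = undefined,
     ring.zero = (\<zero>\<^bsub>M\<^esub>, \<zero>\<^bsub>N\<^esub>),
     ring.add = (\<lambda>(x, y) (x', y'). (x \<oplus>\<^bsub>M\<^esub> x', y \<oplus>\<^bsub>N\<^esub> y')),
     smult = (\<lambda>c (x, y). (c \<odot>\<^bsub>M\<^esub> x, c \<odot>\<^bsub>N\<^esub> y))\<rparr>"

text \<open>
  The tensor product is the free module on pairs of vectors modulo the bilinearity relations.
\<close>

definition free_module :: "('k, 'r) ring_scheme \<Rightarrow> 's set \<Rightarrow> ('k, 's \<Rightarrow> 'k) module"
  where "free_module K S =
    \<lparr>carrier = {u. (\<forall>s. u s \<in> carrier K) \<and> (\<forall>s. s \<notin> S \<longrightarrow> u s = \<zero>\<^bsub>K\<^esub>) \<and>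
        finite {s. u s \<noteq> \<zero>\<^bsub>K\<^esub>}},
     monoid.mult = undefined, one = undefined,
     ring.zero = (\<lambda>s. \<zero>\<^bsub>K\<^esub>),
     ring.add = (\<lambda>u v s. u s \<oplus>\<^bsub>K\<^esub> v s),
     smult = (\<lambda>c u s. c \<otimes>\<^bsub>K\<^esub> u s)\<rparr>"

definition free_gen :: "('k, 'r) ring_scheme \<Rightarrow> 's \<Rightarrow> 's \<Rightarrow> 'k"
  where "free_gen K s = (\<lambda>t. if t = s then \<one>\<^bsub>K\<^esub> else \<zero>\<^bsub>K\<^esub>)"

definition quotient_module ::
    "('k, 'a, 's) module_scheme \<Rightarrow> 'a set \<Rightarrow> ('k, 'a set) module"
  where "quotient_module M H =
    \<lparr>carrier = a_rcosets\<^bsub>M\<^esub> H, monoid.mult = undefined, one = undefined,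
     ring.zero = H,
     ring.add = (\<lambda>A B. A <+>\<^bsub>M\<^esub> B),
     smult = (\<lambda>c A. \<Union>x\<in>A. H +>\<^bsub>M\<^esub> (c \<odot>\<^bsub>M\<^esub> x))\<rparr>"

definition bilinearity_relations ::
    "('k, 'r) ring_scheme \<Rightarrow> ('k, 'a, 's) module_scheme \<Rightarrow> ('k, 'b, 't) module_scheme
      \<Rightarrow> ('a \<times> 'b \<Rightarrow> 'k) set"
  where "bilinearity_relations K M N =
    (let F = free_module K (carrier M \<times> carrier N); \<delta> = (\<lambda>x y. free_gen K (x, y)) in
      {\<delta> (x \<oplus>\<^bsub>M\<^esub> x') y \<ominus>\<^bsub>F\<^esub> (\<delta> x y \<oplus>\<^bsub>F\<^esub> \<delta> x' y) | x x' y.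
          x \<in> carrier M \<and> x' \<in> carrier M \<and> y \<in> carrier N} \<union>
      {\<delta> x (y \<oplus>\<^bsub>N\<^esub> y') \<ominus>\<^bsub>F\<^esub> (\<delta> x y \<oplus>\<^bsub>F\<^esub> \<delta> x y') | x y y'.
          x \<in> carrier M \<and> y \<in> carrier N \<and> y' \<in> carrier N} \<union>
      {\<delta> (c \<odot>\<^bsub>M\<^esub> x) y \<ominus>\<^bsub>F\<^esub> (c \<odot>\<^bsub>F\<^esub> \<delta> x y) | c x y.
          c \<in> carrier K \<and> x \<in> carrier M \<and> y \<in> carrier N} \<union>
      {\<delta> x (c \<odot>\<^bsub>N\<^esub> y) \<ominus>\<^bsub>F\<^esub> (c \<odot>\<^bsub>F\<^esub> \<delta> x y) | c x y.
          c \<in> carrier K \<and> x \<in> carrier M \<and> y \<in> carrier N})"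

definition bilinearity_submodule ::
    "('k, 'r) ring_scheme \<Rightarrow> ('k, 'a, 's) module_scheme \<Rightarrow> ('k, 'b, 't) module_scheme
      \<Rightarrow> ('a \<times> 'b \<Rightarrow> 'k) set"
  where "bilinearity_submodule K M N =
    \<Inter>{H. submodule H K (free_module K (carrier M \<times> carrier N)) \<and>
        bilinearity_relations K M N \<subseteq> H}"

definition module_tensor ::
    "('k, 'r) ring_scheme \<Rightarrow> ('k, 'a, 's) module_scheme \<Rightarrow> ('k, 'b, 't) module_scheme
      \<Rightarrow> ('k, ('a \<times> 'b \<Rightarrow> 'k) set) module"
  where "module_tensor K M N =
    quotient_module (free_module K (carrier M \<times> carrier N)) (bilinearity_submodule K M N)"

definition pure_tensor ::
    "('k, 'r) ring_scheme \<Rightarrow> ('k, 'a, 's) module_scheme \<Rightarrow> ('k, 'b, 't) module_scheme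
      \<Rightarrow> 'a \<Rightarrow> 'b \<Rightarrow> ('a \<times> 'b \<Rightarrow> 'k) set"
  where "pure_tensor K M N x y =
    bilinearity_submodule K M N +>\<^bsub>free_module K (carrier M \<times> carrier N)\<^esub> free_gen K (x, y)"

text \<open>
  The linear map out of a tensor product induced by a bilinear map \<open>h\<close>; extensionality makes it
  unique as a HOL function.
\<close>

definition tensor_lift ::
    "('k, 'r) ring_scheme \<Rightarrow> ('k, 'a, 's) module_scheme \<Rightarrow> ('k, 'b, 't) module_scheme
      \<Rightarrow> ('k, 'c, 'u) module_scheme \<Rightarrow> ('a \<Rightarrow> 'b \<Rightarrow> 'c) \<Rightarrow> ('a \<times> 'b \<Rightarrow> 'k) set \<Rightarrow> 'c"
  where "tensor_lift K M N P h =
    (THE \<phi>. \<phi> \<in> extensional (carrier (module_tensor K M N)) \<and>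
      linear_map K (module_tensor K M N) P \<phi> \<and>
      (\<forall>x\<in>carrier M. \<forall>y\<in>carrier N. \<phi> (pure_tensor K M N x y) = h x y))"


section \<open>Categories\<close>

record ('o, 'm) cat =
  Ob :: "'o set"
  Ar :: "'m set"
  Dom :: "'m \<Rightarrow> 'o"
  Cod :: "'m \<Rightarrow> 'o"
  Ident :: "'o \<Rightarrow> 'm"
  Comp :: "'m \<Rightarrow> 'm \<Rightarrow> 'm" (infixr \<open>\<bullet>\<index>\<close> 75)

definition Hom :: "('o, 'm, 'z) cat_scheme \<Rightarrow> 'o \<Rightarrow> 'o \<Rightarrow> 'm set"
  where "Hom C x y = {f \<in> Ar C. Dom C f = x \<and> Cod C f = y}"

locale category =
  fixes C :: "('o, 'm, 'z) cat_scheme" (structure)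
  assumes Dom_in_Ob: "f \<in> Ar C \<Longrightarrow> Dom C f \<in> Ob C"
    and Cod_in_Ob: "f \<in> Ar C \<Longrightarrow> Cod C f \<in> Ob C"
    and Ident_in_Hom: "x \<in> Ob C \<Longrightarrow> Ident C x \<in> Hom C x x"
    and Comp_in_Hom: "\<lbrakk>g \<in> Hom C y z; f \<in> Hom C x y\<rbrakk> \<Longrightarrow> g \<bullet> f \<in> Hom C x z"
    and Comp_Ident_left: "f \<in> Hom C x y \<Longrightarrow> Ident C y \<bullet> f = f"
    and Comp_Ident_right: "f \<in> Hom C x y \<Longrightarrow> f \<bullet> Ident C x = f"
    and Comp_assoc:
      "\<lbrakk>h \<in> Hom C y z; g \<in> Hom C x y; f \<in> Hom C w x\<rbrakk> \<Longrightarrow> (h \<bullet> g) \<bullet> f = h \<bullet> (g \<bullet> f)"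

definition inverse_arrows :: "('o, 'm, 'z) cat_scheme \<Rightarrow> 'm \<Rightarrow> 'm \<Rightarrow> bool"
  where "inverse_arrows C f g \<longleftrightarrow>
    f \<in> Ar C \<and> g \<in> Hom C (Cod C f) (Dom C f) \<and>
    g \<bullet>\<^bsub>C\<^esub> f = Ident C (Dom C f) \<and> f \<bullet>\<^bsub>C\<^esub> g = Ident C (Cod C f)"

definition is_iso :: "('o, 'm, 'z) cat_scheme \<Rightarrow> 'm \<Rightarrow> bool"
  where "is_iso C f \<longleftrightarrow> (\<exists>g. inverse_arrows C f g)"

definition inv_ar :: "('o, 'm, 'z) cat_scheme \<Rightarrow> 'm \<Rightarrow> 'm"
  where "inv_ar C f = (THE g. inverse_arrows C f g)"

definition isomorphic_objects :: "('o, 'm, 'z) cat_scheme \<Rightarrow> 'o \<Rightarrow> 'o \<Rightarrow> bool"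
  where "isomorphic_objects C x y \<longleftrightarrow> (\<exists>f \<in> Hom C x y. is_iso C f)"

definition is_mono :: "('o, 'm, 'z) cat_scheme \<Rightarrow> 'm \<Rightarrow> bool"
  where "is_mono C f \<longleftrightarrow> f \<in> Ar C \<and>
    (\<forall>x. \<forall>g \<in> Hom C x (Dom C f). \<forall>h \<in> Hom C x (Dom C f).
      f \<bullet>\<^bsub>C\<^esub> g = f \<bullet>\<^bsub>C\<^esub> h \<longrightarrow> g = h)"

definition is_epi :: "('o, 'm, 'z) cat_scheme \<Rightarrow> 'm \<Rightarrow> bool"
  where "is_epi C f \<longleftrightarrow> f \<in> Ar C \<and>
    (\<forall>x. \<forall>g \<in> Hom C (Cod C f) x. \<forall>h \<in> Hom C (Cod C f) x.
      g \<bullet>\<^bsub>C\<^esub> f = h \<bullet>\<^bsub>C\<^esub> f \<longrightarrow> g = h)"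


section \<open>2-groups\<close>

record ('g, 'a) moncat = "('g, 'a) cat" +
  tens_ob :: "'g \<Rightarrow> 'g \<Rightarrow> 'g"
  tens_ar :: "'a \<Rightarrow> 'a \<Rightarrow> 'a"
  unit_ob :: "'g"
  assoc_ar :: "'g \<Rightarrow> 'g \<Rightarrow> 'g \<Rightarrow> 'a"
  lunit_ar :: "'g \<Rightarrow> 'a"
  runit_ar :: "'g \<Rightarrow> 'a"

text \<open>
  The structure isomorphisms are \<open>(g h) k \<rightarrow> g (h k)\<close>, \<open>1 g \<rightarrow> g\<close> and \<open>g 1 \<rightarrow> g\<close>.
\<close>

locale monoidal_category = category G
  for G :: "('g, 'a, 'z) moncat_scheme" (structure) +
  assumes tens_ob_closed: "\<lbrakk>g \<in> Ob G; h \<in> Ob G\<rbrakk> \<Longrightarrow> tens_ob G g h \<in> Ob G"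
    and tens_ar_in_Hom: "\<lbrakk>a \<in> Hom G g g'; b \<in> Hom G h h'\<rbrakk>
      \<Longrightarrow> tens_ar G a b \<in> Hom G (tens_ob G g h) (tens_ob G g' h')"
    and tens_ar_Ident: "\<lbrakk>g \<in> Ob G; h \<in> Ob G\<rbrakk>
      \<Longrightarrow> tens_ar G (Ident G g) (Ident G h) = Ident G (tens_ob G g h)"
    and tens_ar_Comp: "\<lbrakk>a' \<in> Hom G g' g''; a \<in> Hom G g g'; b' \<in> Hom G h' h''; b \<in> Hom G h h'\<rbrakk>
      \<Longrightarrow> tens_ar G (a' \<bullet> a) (b' \<bullet> b) = tens_ar G a' b' \<bullet> tens_ar G a b"
    and unit_in_Ob: "unit_ob G \<in> Ob G"
    and assoc_in_Hom: "\<lbrakk>g \<in> Ob G; h \<in> Ob G; k \<in> Ob G\<rbrakk> \<Longrightarrow> assoc_ar G g h k \<in>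
      Hom G (tens_ob G (tens_ob G g h) k) (tens_ob G g (tens_ob G h k))"
    and assoc_iso: "\<lbrakk>g \<in> Ob G; h \<in> Ob G; k \<in> Ob G\<rbrakk> \<Longrightarrow> is_iso G (assoc_ar G g h k)"
    and assoc_natural: "\<lbrakk>a \<in> Hom G g g'; b \<in> Hom G h h'; c \<in> Hom G k k'\<rbrakk>
      \<Longrightarrow> assoc_ar G g' h' k' \<bullet> tens_ar G (tens_ar G a b) c =
          tens_ar G a (tens_ar G b c) \<bullet> assoc_ar G g h k"
    and lunit_in_Hom: "g \<in> Ob G \<Longrightarrow> lunit_ar G g \<in> Hom G (tens_ob G (unit_ob G) g) g"
    and lunit_iso: "g \<in> Ob G \<Longrightarrow> is_iso G (lunit_ar G g)"
    and lunit_natural: "a \<in> Hom G g g'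
      \<Longrightarrow> lunit_ar G g' \<bullet> tens_ar G (Ident G (unit_ob G)) a = a \<bullet> lunit_ar G g"
    and runit_in_Hom: "g \<in> Ob G \<Longrightarrow> runit_ar G g \<in> Hom G (tens_ob G g (unit_ob G)) g"
    and runit_iso: "g \<in> Ob G \<Longrightarrow> is_iso G (runit_ar G g)"
    and runit_natural: "a \<in> Hom G g g'
      \<Longrightarrow> runit_ar G g' \<bullet> tens_ar G a (Ident G (unit_ob G)) = a \<bullet> runit_ar G g"
    and pentagon: "\<lbrakk>g \<in> Ob G; h \<in> Ob G; k \<in> Ob G; l \<in> Ob G\<rbrakk>
      \<Longrightarrow> assoc_ar G g h (tens_ob G k l) \<bullet> assoc_ar G (tens_ob G g h) k l =
          tens_ar G (Ident G g) (assoc_ar G h k l) \<bullet>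
          assoc_ar G g (tens_ob G h k) l \<bullet> tens_ar G (assoc_ar G g h k) (Ident G l)"
    and triangle: "\<lbrakk>g \<in> Ob G; h \<in> Ob G\<rbrakk>
      \<Longrightarrow> tens_ar G (Ident G g) (lunit_ar G h) \<bullet> assoc_ar G g (unit_ob G) h =
          tens_ar G (runit_ar G g) (Ident G h)"

locale two_group = monoidal_category G
  for G :: "('g, 'a, 'z) moncat_scheme" (structure) +
  assumes all_iso: "a \<in> Ar G \<Longrightarrow> is_iso G a"
    and all_invertible: "g \<in> Ob G \<Longrightarrow> \<exists>h \<in> Ob G.
      isomorphic_objects G (tens_ob G g h) (unit_ob G) \<and>
      isomorphic_objects G (tens_ob G h g) (unit_ob G)"

text \<open>
  \<open>d\<close> is a left dual of \<open>g\<close>, with \<open>ev: d g \<rightarrow> 1\<close> and \<open>coev: 1 \<rightarrow> g d\<close>. The two triangle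
  identities are written as equations of arrows \<open>1 g \<rightarrow> g\<close> and \<open>d 1 \<rightarrow> d\<close>.
\<close>

definition is_left_dual :: "('g, 'a, 'z) moncat_scheme \<Rightarrow> 'g \<Rightarrow> 'g \<Rightarrow> bool"
  where "is_left_dual G g d \<longleftrightarrow> d \<in> Ob G \<and>
    (\<exists>ev \<in> Hom G (tens_ob G d g) (unit_ob G). \<exists>coev \<in> Hom G (unit_ob G) (tens_ob G g d).
      runit_ar G g \<bullet>\<^bsub>G\<^esub> tens_ar G (Ident G g) ev \<bullet>\<^bsub>G\<^esub> assoc_ar G g d g \<bullet>\<^bsub>G\<^esub>
        tens_ar G coev (Ident G g) = lunit_ar G g \<and>
      lunit_ar G d \<bullet>\<^bsub>G\<^esub> tens_ar G ev (Ident G d) \<bullet>\<^bsub>G\<^esub> inv_ar G (assoc_ar G d g d) \<bullet>\<^bsub>G\<^esub>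
        tens_ar G (Ident G d) coev = runit_ar G d)"


section \<open>Finite semisimple linear categories\<close>

record ('k, 'o, 'm) lincat = "('o, 'm) cat" +
  Zero_ar :: "'o \<Rightarrow> 'o \<Rightarrow> 'm"
  Add_ar :: "'m \<Rightarrow> 'm \<Rightarrow> 'm"
  Scale_ar :: "'k \<Rightarrow> 'm \<Rightarrow> 'm"

definition hom_module :: "('k, 'o, 'm, 'z) lincat_scheme \<Rightarrow> 'o \<Rightarrow> 'o \<Rightarrow> ('k, 'm) module"
  where "hom_module C x y =
    \<lparr>carrier = Hom C x y, monoid.mult = undefined, one = undefined,
     ring.zero = Zero_ar C x y, ring.add = Add_ar C, smult = Scale_ar C\<rparr>"

locale linear_category = category C
  for K :: "('k, 'r) ring_scheme" and C :: "('k, 'o, 'm, 'z) lincat_scheme" (structure) +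
  assumes hom_is_module: "\<lbrakk>x \<in> Ob C; y \<in> Ob C\<rbrakk> \<Longrightarrow> module K (hom_module C x y)"
    and Comp_linear_right: "\<lbrakk>x \<in> Ob C; g \<in> Hom C y z\<rbrakk>
      \<Longrightarrow> linear_map K (hom_module C x y) (hom_module C x z) (\<lambda>f. g \<bullet> f)"
    and Comp_linear_left: "\<lbrakk>z \<in> Ob C; f \<in> Hom C x y\<rbrakk>
      \<Longrightarrow> linear_map K (hom_module C y z) (hom_module C x z) (\<lambda>g. g \<bullet> f)"

definition is_kernel :: "('k, 'o, 'm, 'z) lincat_scheme \<Rightarrow> 'm \<Rightarrow> 'm \<Rightarrow> bool"
  where "is_kernel C k f \<longleftrightarrow>
    k \<in> Ar C \<and> f \<in> Ar C \<and> Cod C k = Dom C f \<and>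
    f \<bullet>\<^bsub>C\<^esub> k = Zero_ar C (Dom C k) (Cod C f) \<and>
    (\<forall>x. \<forall>h \<in> Hom C x (Dom C f). f \<bullet>\<^bsub>C\<^esub> h = Zero_ar C x (Cod C f) \<longrightarrow>
      (\<exists>!u. u \<in> Hom C x (Dom C k) \<and> k \<bullet>\<^bsub>C\<^esub> u = h))"

definition is_cokernel :: "('k, 'o, 'm, 'z) lincat_scheme \<Rightarrow> 'm \<Rightarrow> 'm \<Rightarrow> bool"
  where "is_cokernel C q f \<longleftrightarrow>
    q \<in> Ar C \<and> f \<in> Ar C \<and> Dom C q = Cod C f \<and>
    q \<bullet>\<^bsub>C\<^esub> f = Zero_ar C (Dom C f) (Cod C q) \<and>
    (\<forall>x. \<forall>h \<in> Hom C (Cod C f) x. h \<bullet>\<^bsub>C\<^esub> f = Zero_ar C (Dom C f) x \<longrightarrow>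
      (\<exists>!u. u \<in> Hom C (Cod C q) x \<and> u \<bullet>\<^bsub>C\<^esub> q = h))"

text \<open>
  \<open>x\<close> is a direct sum (biproduct) of the objects in the list \<open>ys\<close>; for the empty list this says
  that \<open>x\<close> is a zero object.
\<close>

definition is_direct_sum :: "('k, 'o, 'm, 'z) lincat_scheme \<Rightarrow> 'o \<Rightarrow> 'o list \<Rightarrow> bool"
  where "is_direct_sum C x ys \<longleftrightarrow>
    x \<in> Ob C \<and> set ys \<subseteq> Ob C \<and>
    (\<exists>i p. (\<forall>j<length ys. i j \<in> Hom C (ys ! j) x \<and> p j \<in> Hom C x (ys ! j)) \<and>
      (\<forall>j<length ys. \<forall>l<length ys.
        p j \<bullet>\<^bsub>C\<^esub> i l = (if j = l then Ident C (ys ! j) else Zero_ar C (ys ! l) (ys ! j))) \<and>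
      (\<Oplus>\<^bsub>hom_module C x x\<^esub>j\<in>{..<length ys}. i j \<bullet>\<^bsub>C\<^esub> p j) = Ident C x)"

locale abelian_linear_category = linear_category K C
  for K :: "('k, 'r) ring_scheme" and C :: "('k, 'o, 'm, 'z) lincat_scheme" (structure) +
  assumes has_direct_sums: "set ys \<subseteq> Ob C \<Longrightarrow> \<exists>x. is_direct_sum C x ys"
    and has_kernels: "f \<in> Ar C \<Longrightarrow> \<exists>k. is_kernel C k f"
    and has_cokernels: "f \<in> Ar C \<Longrightarrow> \<exists>q. is_cokernel C q f"
    and mono_is_kernel: "is_mono C k \<Longrightarrow> \<exists>f. is_kernel C k f"
    and epi_is_cokernel: "is_epi C q \<Longrightarrow> \<exists>f. is_cokernel C q f"

definition is_simple :: "('k, 'o, 'm, 'z) lincat_scheme \<Rightarrow> 'o \<Rightarrow> bool"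
  where "is_simple C x \<longleftrightarrow> x \<in> Ob C \<and> Ident C x \<noteq> Zero_ar C x x \<and>
    (\<forall>f. is_mono C f \<and> Cod C f = x \<longrightarrow> f = Zero_ar C (Dom C f) x \<or> is_iso C f)"

definition Irr :: "('k, 'o, 'm, 'z) lincat_scheme \<Rightarrow> 'o set set"
  where "Irr C = {x. is_simple C x} //
    {(x, y). is_simple C x \<and> is_simple C y \<and> isomorphic_objects C x y}"

locale finite_semisimple_category = abelian_linear_category K C
  for K :: "('k, 'r) ring_scheme" and C :: "('k, 'o, 'm, 'z) lincat_scheme" (structure) +
  assumes hom_finite_dim: "\<lbrakk>x \<in> Ob C; y \<in> Ob C\<rbrakk> \<Longrightarrow> finite_dim K (hom_module C x y)"
    and finite_Irr: "finite (Irr C)"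
    and semisimple: "x \<in> Ob C \<Longrightarrow> \<exists>ys. (\<forall>y\<in>set ys. is_simple C y) \<and> is_direct_sum C x ys"


section \<open>2-representations\<close>

text \<open>
  The action is a functor from the product of \<open>G\<close> and \<open>V\<close> to \<open>V\<close>, so \<open>act_ar V a f\<close> is
  \<open>a \<odot> f\<close>. In particular \<open>g \<odot> f\<close> is \<open>act_ar V (Ident G g) f\<close>, and the component at \<open>x\<close> of the
  natural transformation \<open>a \<odot> -\<close> is \<open>act_ar V a (Ident V x)\<close>. The coherence isomorphisms are
  \<open>act_assoc V g h x: (g h) \<odot> x \<rightarrow> g \<odot> (h \<odot> x)\<close> and \<open>act_unit V x: 1 \<odot> x \<rightarrow> x\<close>.
\<close>

record ('k, 'o, 'm, 'g, 'a) modcat = "('k, 'o, 'm) lincat" +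
  act_ob :: "'g \<Rightarrow> 'o \<Rightarrow> 'o"
  act_ar :: "'a \<Rightarrow> 'm \<Rightarrow> 'm"
  act_assoc :: "'g \<Rightarrow> 'g \<Rightarrow> 'o \<Rightarrow> 'm"
  act_unit :: "'o \<Rightarrow> 'm"

locale two_rep = G: two_group G + finite_semisimple_category K V
  for K :: "('k, 'r) ring_scheme"
    and G :: "('g, 'a, 'y) moncat_scheme"
    and V :: "('k, 'o, 'm, 'g, 'a, 'z) modcat_scheme" (structure) +
  assumes act_ob_closed: "\<lbrakk>g \<in> Ob G; x \<in> Ob V\<rbrakk> \<Longrightarrow> act_ob V g x \<in> Ob V"
    and act_ar_in_Hom: "\<lbrakk>a \<in> Hom G g h; f \<in> Hom V x y\<rbrakk>
      \<Longrightarrow> act_ar V a f \<in> Hom V (act_ob V g x) (act_ob V h y)"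
    and act_ar_Ident: "\<lbrakk>g \<in> Ob G; x \<in> Ob V\<rbrakk>
      \<Longrightarrow> act_ar V (Ident G g) (Ident V x) = Ident V (act_ob V g x)"
    and act_ar_Comp: "\<lbrakk>b \<in> Hom G h k; a \<in> Hom G g h; f' \<in> Hom V y z; f \<in> Hom V x y\<rbrakk>
      \<Longrightarrow> act_ar V (b \<bullet>\<^bsub>G\<^esub> a) (f' \<bullet> f) = act_ar V b f' \<bullet> act_ar V a f"
    and act_linear: "\<lbrakk>g \<in> Ob G; x \<in> Ob V; y \<in> Ob V\<rbrakk>
      \<Longrightarrow> linear_map K (hom_module V x y) (hom_module V (act_ob V g x) (act_ob V g y))
            (act_ar V (Ident G g))"
    and act_assoc_in_Hom: "\<lbrakk>g \<in> Ob G; h \<in> Ob G; x \<in> Ob V\<rbrakk> \<Longrightarrow> act_assoc V g h x \<in>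
      Hom V (act_ob V (tens_ob G g h) x) (act_ob V g (act_ob V h x))"
    and act_assoc_iso: "\<lbrakk>g \<in> Ob G; h \<in> Ob G; x \<in> Ob V\<rbrakk> \<Longrightarrow> is_iso V (act_assoc V g h x)"
    and act_assoc_natural: "\<lbrakk>a \<in> Hom G g g'; b \<in> Hom G h h'; f \<in> Hom V x y\<rbrakk>
      \<Longrightarrow> act_assoc V g' h' y \<bullet> act_ar V (tens_ar G a b) f =
          act_ar V a (act_ar V b f) \<bullet> act_assoc V g h x"
    and act_unit_in_Hom: "x \<in> Ob V \<Longrightarrow> act_unit V x \<in> Hom V (act_ob V (unit_ob G) x) x"
    and act_unit_iso: "x \<in> Ob V \<Longrightarrow> is_iso V (act_unit V x)"
    and act_unit_natural: "f \<in> Hom V x y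
      \<Longrightarrow> act_unit V y \<bullet> act_ar V (Ident G (unit_ob G)) f = f \<bullet> act_unit V x"
    and act_pentagon: "\<lbrakk>g \<in> Ob G; h \<in> Ob G; k \<in> Ob G; x \<in> Ob V\<rbrakk>
      \<Longrightarrow> act_assoc V g h (act_ob V k x) \<bullet> act_assoc V (tens_ob G g h) k x =
          act_ar V (Ident G g) (act_assoc V h k x) \<bullet>
          act_assoc V g (tens_ob G h k) x \<bullet> act_ar V (assoc_ar G g h k) (Ident V x)"
    and act_triangle: "\<lbrakk>g \<in> Ob G; x \<in> Ob V\<rbrakk>
      \<Longrightarrow> act_ar V (Ident G g) (act_unit V x) \<bullet> act_assoc V g (unit_ob G) x =
          act_ar V (runit_ar G g) (Ident V x)"


subsection \<open>Direct sum\<close>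

definition rep_sum ::
    "('k, 'o, 'm, 'g, 'a, 'y) modcat_scheme \<Rightarrow> ('k, 'p, 'n, 'g, 'a, 'z) modcat_scheme
      \<Rightarrow> ('k, 'o \<times> 'p, 'm \<times> 'n, 'g, 'a) modcat"
  where "rep_sum V W =
    \<lparr>Ob = Ob V \<times> Ob W,
     Ar = Ar V \<times> Ar W,
     Dom = map_prod (Dom V) (Dom W),
     Cod = map_prod (Cod V) (Cod W),
     Ident = map_prod (Ident V) (Ident W),
     Comp = (\<lambda>(f, g) (f', g'). (f \<bullet>\<^bsub>V\<^esub> f', g \<bullet>\<^bsub>W\<^esub> g')),
     Zero_ar = (\<lambda>(x, y) (x', y'). (Zero_ar V x x', Zero_ar W y y')),
     Add_ar = (\<lambda>(f, g) (f', g'). (Add_ar V f f', Add_ar W g g')),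
     Scale_ar = (\<lambda>c. map_prod (Scale_ar V c) (Scale_ar W c)),
     act_ob = (\<lambda>g. map_prod (act_ob V g) (act_ob W g)),
     act_ar = (\<lambda>a. map_prod (act_ar V a) (act_ar W a)),
     act_assoc = (\<lambda>g h. map_prod (act_assoc V g h) (act_assoc W g h)),
     act_unit = map_prod (act_unit V) (act_unit W)\<rparr>"


subsection \<open>Dual\<close>

text \<open>
  Arrows of the opposite category are the arrows of \<open>V\<close> with domain and codomain swapped, so the
  coherence isomorphisms have to be inverted.
\<close>

definition rep_op ::
    "('g, 'a, 'y) moncat_scheme \<Rightarrow> ('k, 'o, 'm, 'g, 'a, 'z) modcat_scheme
      \<Rightarrow> ('k, 'o, 'm, 'g, 'a) modcat"
  where "rep_op G V =
    \<lparr>Ob = Ob V,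
     Ar = Ar V,
     Dom = Cod V,
     Cod = Dom V,
     Ident = Ident V,
     Comp = (\<lambda>f g. g \<bullet>\<^bsub>V\<^esub> f),
     Zero_ar = (\<lambda>x y. Zero_ar V y x),
     Add_ar = Add_ar V,
     Scale_ar = Scale_ar V,
     act_ob = act_ob V,
     act_ar = (\<lambda>a. act_ar V (inv_ar G a)),
     act_assoc = (\<lambda>g h x. inv_ar V (act_assoc V g h x)),
     act_unit = (\<lambda>x. inv_ar V (act_unit V x))\<rparr>"


subsection \<open>Deligne tensor product\<close>

text \<open>
  The Deligne tensor product of finite semisimple categories over an algebraically closed field is
  realised as the additive completion of the naive tensor product, whose objects are pairs and
  whose hom-spaces are tensor products of hom-spaces. (Over such a field the completion is already
  idempotent complete and abelian.) An arrow of the naive tensor product is recorded together with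
  its domain and codomain.
\<close>

definition tensor_hom ::
    "('k, 'r) ring_scheme \<Rightarrow> ('k, 'o, 'm, 'y) lincat_scheme \<Rightarrow> ('k, 'p, 'n, 'z) lincat_scheme
      \<Rightarrow> 'o \<times> 'p \<Rightarrow> 'o \<times> 'p \<Rightarrow> ('k, ('m \<times> 'n \<Rightarrow> 'k) set) module"
  where "tensor_hom K V W v w =
    module_tensor K (hom_module V (fst v) (fst w)) (hom_module W (snd v) (snd w))"

definition pure_hom ::
    "('k, 'r) ring_scheme \<Rightarrow> ('k, 'o, 'm, 'y) lincat_scheme \<Rightarrow> ('k, 'p, 'n, 'z) lincat_scheme
      \<Rightarrow> 'o \<times> 'p \<Rightarrow> 'o \<times> 'p \<Rightarrow> 'm \<Rightarrow> 'n \<Rightarrow> ('m \<times> 'n \<Rightarrow> 'k) set"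
  where "pure_hom K V W v w f g =
    pure_tensor K (hom_module V (fst v) (fst w)) (hom_module W (snd v) (snd w)) f g"

definition lift_hom ::
    "('k, 'r) ring_scheme \<Rightarrow> ('k, 'o, 'm, 'y) lincat_scheme \<Rightarrow> ('k, 'p, 'n, 'z) lincat_scheme
      \<Rightarrow> 'o \<times> 'p \<Rightarrow> 'o \<times> 'p \<Rightarrow> ('k, 'c) module \<Rightarrow> ('m \<Rightarrow> 'n \<Rightarrow> 'c) \<Rightarrow> ('m \<times> 'n \<Rightarrow> 'k) set \<Rightarrow> 'c"
  where "lift_hom K V W v w P h =
    tensor_lift K (hom_module V (fst v) (fst w)) (hom_module W (snd v) (snd w)) P h"

definition naive_tensor ::
    "('k, 'r) ring_scheme \<Rightarrow> ('g, 'a, 'x) moncat_scheme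
      \<Rightarrow> ('k, 'o, 'm, 'g, 'a, 'y) modcat_scheme \<Rightarrow> ('k, 'p, 'n, 'g, 'a, 'z) modcat_scheme
      \<Rightarrow> ('k, 'o \<times> 'p, ('o \<times> 'p) \<times> ('o \<times> 'p) \<times> ('m \<times> 'n \<Rightarrow> 'k) set, 'g, 'a) modcat"
  where "naive_tensor K G V W =
    (let act = (\<lambda>g. map_prod (act_ob V g) (act_ob W g)) in
    \<lparr>Ob = Ob V \<times> Ob W,
     Ar = {(v, w, t). v \<in> Ob V \<times> Ob W \<and> w \<in> Ob V \<times> Ob W \<and> t \<in> carrier (tensor_hom K V W v w)},
     Dom = (\<lambda>(v, w, t). v),
     Cod = (\<lambda>(v, w, t). w),
     Ident = (\<lambda>v. (v, v, pure_hom K V W v v (Ident V (fst v)) (Ident W (snd v)))),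
     \<comment> \<open>the bilinear extension of composing pure tensors factorwise\<close>
     Comp = (\<lambda>(v, w, s) (u, v', t).
       (u, w,
        lift_hom K V W v w (tensor_hom K V W u w)
          (\<lambda>f g. lift_hom K V W u v (tensor_hom K V W u w)
             (\<lambda>f' g'. pure_hom K V W u w (f \<bullet>\<^bsub>V\<^esub> f') (g \<bullet>\<^bsub>W\<^esub> g')) t) s)),
     Zero_ar = (\<lambda>v w. (v, w, \<zero>\<^bsub>tensor_hom K V W v w\<^esub>)),
     Add_ar = (\<lambda>(v, w, s) (v', w', t). (v, w, s \<oplus>\<^bsub>tensor_hom K V W v w\<^esub> t)),
     Scale_ar = (\<lambda>c (v, w, t). (v, w, c \<odot>\<^bsub>tensor_hom K V W v w\<^esub> t)),
     act_ob = act,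
     act_ar = (\<lambda>a (v, w, t). let v' = act (Dom G a) v; w' = act (Cod G a) w in
       (v', w',
        lift_hom K V W v w (tensor_hom K V W v' w')
          (\<lambda>f g. pure_hom K V W v' w' (act_ar V a f) (act_ar W a g)) t)),
     act_assoc = (\<lambda>g h v.
       let u = map_prod (Dom V) (Dom W) (act_assoc V g h (fst v), act_assoc W g h (snd v));
           w = act g (act h v)
       in (u, w, pure_hom K V W u w (act_assoc V g h (fst v)) (act_assoc W g h (snd v)))),
     act_unit = (\<lambda>v.
       let u = map_prod (Dom V) (Dom W) (act_unit V (fst v), act_unit W (snd v))
       in (u, v, pure_hom K V W u v (act_unit V (fst v)) (act_unit W (snd v))))\<rparr>)"

text \<open>
  Objects of the additive completion are lists, viewed as formal direct sums. Arrows are matrices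
  together with their domain and codomain; the entry \<open>(i, j)\<close> of an arrow \<open>xs \<rightarrow> ys\<close> is an arrow
  \<open>xs ! j \<rightarrow> ys ! i\<close>.
\<close>

definition build_matrix ::
    "'o list \<Rightarrow> 'o list \<Rightarrow> (nat \<Rightarrow> nat \<Rightarrow> 'm) \<Rightarrow> 'o list \<times> 'o list \<times> (nat \<times> nat \<Rightarrow> 'm)"
  where "build_matrix xs ys A =
    (xs, ys, restrict (\<lambda>(i, j). A i j) ({..<length ys} \<times> {..<length xs}))"

definition diagonal_matrix ::
    "('k, 'o, 'm, 'z) lincat_scheme \<Rightarrow> 'o list \<Rightarrow> 'o list \<Rightarrow> (nat \<Rightarrow> 'm)
      \<Rightarrow> 'o list \<times> 'o list \<times> (nat \<times> nat \<Rightarrow> 'm)"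
  where "diagonal_matrix C xs ys d =
    build_matrix xs ys (\<lambda>i j. if i = j then d i else Zero_ar C (xs ! j) (ys ! i))"

definition additive_completion ::
    "('g, 'a, 'y) moncat_scheme \<Rightarrow> ('k, 'o, 'm, 'g, 'a, 'z) modcat_scheme
      \<Rightarrow> ('k, 'o list, 'o list \<times> 'o list \<times> (nat \<times> nat \<Rightarrow> 'm), 'g, 'a) modcat"
  where "additive_completion G C =
    \<lparr>Ob = lists (Ob C),
     Ar = {(xs, ys, A). xs \<in> lists (Ob C) \<and> ys \<in> lists (Ob C) \<and>
       A \<in> (\<Pi>\<^sub>E (i, j) \<in> {..<length ys} \<times> {..<length xs}. Hom C (xs ! j) (ys ! i))},
     Dom = (\<lambda>(xs, ys, A). xs),
     Cod = (\<lambda>(xs, ys, A). ys),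
     Ident = (\<lambda>xs. diagonal_matrix C xs xs (\<lambda>i. Ident C (xs ! i))),
     Comp = (\<lambda>(ys, zs, A) (xs, ys', B). build_matrix xs zs (\<lambda>i j.
       \<Oplus>\<^bsub>hom_module C (xs ! j) (zs ! i)\<^esub>l\<in>{..<length ys}. A (i, l) \<bullet>\<^bsub>C\<^esub> B (l, j))),
     Zero_ar = (\<lambda>xs ys. build_matrix xs ys (\<lambda>i j. Zero_ar C (xs ! j) (ys ! i))),
     Add_ar = (\<lambda>(xs, ys, A) (xs', ys', B).
       build_matrix xs ys (\<lambda>i j. Add_ar C (A (i, j)) (B (i, j)))),
     Scale_ar = (\<lambda>c (xs, ys, A). build_matrix xs ys (\<lambda>i j. Scale_ar C c (A (i, j)))),
     act_ob = (\<lambda>g. map (act_ob C g)),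
     act_ar = (\<lambda>a (xs, ys, A).
       build_matrix (map (act_ob C (Dom G a)) xs) (map (act_ob C (Cod G a)) ys)
         (\<lambda>i j. act_ar C a (A (i, j)))),
     act_assoc = (\<lambda>g h xs.
       diagonal_matrix C (map (act_ob C (tens_ob G g h)) xs) (map (act_ob C g \<circ> act_ob C h) xs)
         (\<lambda>i. act_assoc C g h (xs ! i))),
     act_unit = (\<lambda>xs.
       diagonal_matrix C (map (act_ob C (unit_ob G)) xs) xs (\<lambda>i. act_unit C (xs ! i)))\<rparr>"

definition rep_tensor ::
    "('k, 'r) ring_scheme \<Rightarrow> ('g, 'a, 'x) moncat_scheme
      \<Rightarrow> ('k, 'o, 'm, 'g, 'a, 'y) modcat_scheme \<Rightarrow> ('k, 'p, 'n, 'g, 'a, 'z) modcat_scheme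
      \<Rightarrow> ('k, ('o \<times> 'p) list,
            ('o \<times> 'p) list \<times> ('o \<times> 'p) list \<times>
              (nat \<times> nat \<Rightarrow> ('o \<times> 'p) \<times> ('o \<times> 'p) \<times> ('m \<times> 'n \<Rightarrow> 'k) set), 'g, 'a) modcat"
  where "rep_tensor K G V W = additive_completion G (naive_tensor K G V W)"


section \<open>2-characters\<close>

text \<open>
  A functor is given by its maps on objects and on arrows. The components of a natural
  transformation are made extensional outside the objects of the source category.
\<close>

definition nat_module ::
    "('o, 'm, 'y) cat_scheme \<Rightarrow> ('k, 'p, 'n, 'z) lincat_scheme
      \<Rightarrow> ('o \<Rightarrow> 'p) \<times> ('m \<Rightarrow> 'n) \<Rightarrow> ('o \<Rightarrow> 'p) \<times> ('m \<Rightarrow> 'n) \<Rightarrow> ('k, 'o \<Rightarrow> 'n) module"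
  where "nat_module C D F H =
    \<lparr>carrier = {\<eta> \<in> (\<Pi>\<^sub>E x \<in> Ob C. Hom D (fst F x) (fst H x)).
        \<forall>f \<in> Ar C. snd H f \<bullet>\<^bsub>D\<^esub> \<eta> (Dom C f) = \<eta> (Cod C f) \<bullet>\<^bsub>D\<^esub> snd F f},
     monoid.mult = undefined, one = undefined,
     ring.zero = (\<lambda>x\<in>Ob C. Zero_ar D (fst F x) (fst H x)),
     ring.add = (\<lambda>\<eta> \<theta>. \<lambda>x\<in>Ob C. Add_ar D (\<eta> x) (\<theta> x)),
     smult = (\<lambda>c \<eta>. \<lambda>x\<in>Ob C. Scale_ar D c (\<eta> x))\<rparr>"

definition act_functor ::
    "('g, 'a, 'y) moncat_scheme \<Rightarrow> ('k, 'o, 'm, 'g, 'a, 'z) modcat_scheme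
      \<Rightarrow> 'g \<Rightarrow> ('o \<Rightarrow> 'o) \<times> ('m \<Rightarrow> 'm)"
  where "act_functor G V g = (act_ob V g, act_ar V (Ident G g))"

definition two_character ::
    "('g, 'a, 'y) moncat_scheme \<Rightarrow> ('k, 'o, 'm, 'g, 'a, 'z) modcat_scheme
      \<Rightarrow> 'g \<Rightarrow> ('k, 'o \<Rightarrow> 'm) module"
  where "two_character G V g = nat_module V V (id, id) (act_functor G V g)"

text \<open>The arrow part of the 2-character functor: post-composition with \<open>a \<odot> -\<close>.\<close>

definition two_character_map ::
    "('k, 'o, 'm, 'g, 'a, 'z) modcat_scheme \<Rightarrow> 'a \<Rightarrow> ('o \<Rightarrow> 'm) \<Rightarrow> 'o \<Rightarrow> 'm"
  where "two_character_map V a \<eta> = (\<lambda>x\<in>Ob V. act_ar V a (Ident V x) \<bullet>\<^bsub>V\<^esub> \<eta> x)"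

end

theory Submission
  imports Defs
begin

text \<open>
  The sum is elementary: naturality with respect to the arrows \<open>(1, 0)\<close> and \<open>(0, 1)\<close> separates
  the two components of a transformation. For the dual, a transformation \<open>g \<odot> - \<rightarrow> 1\<close> is turned
  into \<open>1 \<rightarrow> d \<odot> -\<close> by precomposing with \<open>d \<odot> -\<close> and using \<open>1 \<simeq> g \<otimes> d\<close>.

  For the tensor product, let \<open>P\<close> be the direct sum of representatives of the simple objects of
  \<open>V\<close>. Every identity arrow is a sum of arrows factoring through \<open>P\<close>, so evaluation at \<open>P\<close>
  identifies \<open>Nat(1, F)\<close> with the elements of \<open>Hom(P, F P)\<close> commuting with \<open>End(P)\<close>; likewise for
  \<open>Q\<close> in \<open>W\<close> and for \<open>(P, Q)\<close> in the naive tensor product. Writing a tensor in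
  \<open>Hom(P, F P) \<otimes> Hom(Q, F Q)\<close> as a sum of pure tensors with linearly independent factors shows
  that it commutes with \<open>End(P) \<otimes> End(Q)\<close> iff the factors commute with \<open>End(P)\<close> and \<open>End(Q)\<close>.
\<close>


section \<open>Linear maps\<close>

text \<open>Working with components on simple objects would call for Schur's lemma and a count of
  multiplicities. Evaluation at one generator packs all components into a single vector subject to a
  commutation condition. The generator condition speaks of sums of arrows that factor through
  \<open>P\<close>, not of direct summands, because the naive tensor product need not have direct
  sums while the condition still passes to \<open>(P, Q)\<close>. A step beyond the overview is the
  additive completion. Its arrows are matrices and the functor acts entrywise, which forces a
  transformation to be diagonal, with entries given by a transformation of the naive tensor product.
  Completing therefore leaves the space of transformations unchanged. For the direct sum and the
  tensor product the comparison map runs from the known modules into the character of the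
  constructed representation, where only the operations have to be matched; it is inverted at the
  end. For the dual the map already has the required direction.\<close>

lemma linear_mapI:
  assumes "\<And>x. x \<in> carrier M \<Longrightarrow> \<phi> x \<in> carrier N"
    and "\<And>x y. \<lbrakk>x \<in> carrier M; y \<in> carrier M\<rbrakk> \<Longrightarrow> \<phi> (x \<oplus>\<^bsub>M\<^esub> y) = \<phi> x \<oplus>\<^bsub>N\<^esub> \<phi> y"
    and "\<And>c x. \<lbrakk>c \<in> carrier K; x \<in> carrier M\<rbrakk> \<Longrightarrow> \<phi> (c \<odot>\<^bsub>M\<^esub> x) = c \<odot>\<^bsub>N\<^esub> \<phi> x"
  shows "linear_map K M N \<phi>"
  using assms by (auto simp: linear_map_def)

lemma linear_mapD:
  assumes "linear_map K M N \<phi>"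
  shows "x \<in> carrier M \<Longrightarrow> \<phi> x \<in> carrier N"
    and "\<lbrakk>x \<in> carrier M; y \<in> carrier M\<rbrakk> \<Longrightarrow> \<phi> (x \<oplus>\<^bsub>M\<^esub> y) = \<phi> x \<oplus>\<^bsub>N\<^esub> \<phi> y"
    and "\<lbrakk>c \<in> carrier K; x \<in> carrier M\<rbrakk> \<Longrightarrow> \<phi> (c \<odot>\<^bsub>M\<^esub> x) = c \<odot>\<^bsub>N\<^esub> \<phi> x"
  using assms by (auto simp: linear_map_def)

lemma linear_map_cong:
  assumes "module K M" and "linear_map K M N \<phi>" and "\<And>x. x \<in> carrier M \<Longrightarrow> \<phi> x = \<psi> x"
  shows "linear_map K M N \<psi>"
proof -
  interpret module K M by fact
  show ?thesis using linear_mapD[OF assms(2)]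
    by (intro linear_mapI) (simp_all add: assms(3)[symmetric])
qed

lemma linear_map_comp:
  assumes "linear_map K M N \<phi>" and "linear_map K N P \<psi>"
  shows "linear_map K M P (\<lambda>x. \<psi> (\<phi> x))"
  using linear_mapD[OF assms(1)] linear_mapD[OF assms(2)] by (intro linear_mapI) auto

lemma linear_map_zero:
  fixes M (structure)
  assumes "module K M" and "module K N" and "linear_map K M N \<phi>"
  shows "\<phi> \<zero> = \<zero>\<^bsub>N\<^esub>"
proof -
  interpret M: module K M by fact
  interpret N: module K N by fact
  have "\<phi> \<zero> = \<phi> (\<zero>\<^bsub>K\<^esub> \<odot> \<zero>)" by simp
  also have "\<dots> = \<zero>\<^bsub>K\<^esub> \<odot>\<^bsub>N\<^esub> \<phi> \<zero>" by (rule linear_mapD(3)[OF assms(3)]) auto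
  also have "\<dots> = \<zero>\<^bsub>N\<^esub>" using linear_mapD(1)[OF assms(3)] by simp
  finally show ?thesis .
qed

lemma linear_map_minus:
  fixes M (structure)
  assumes "module K M" and "module K N" and "linear_map K M N \<phi>"
    and "x \<in> carrier M" and "y \<in> carrier M"
  shows "\<phi> (x \<ominus> y) = \<phi> x \<ominus>\<^bsub>N\<^esub> \<phi> y"
proof -
  interpret M: module K M by fact
  interpret N: module K N by fact
  note \<phi> = linear_mapD[OF assms(3)]
  have m: "\<phi> (x \<ominus> y) \<in> carrier N" "\<phi> x \<in> carrier N" "\<phi> y \<in> carrier N"
    using \<phi>(1) assms(4,5) by auto
  have "\<phi> (x \<ominus> y) \<oplus>\<^bsub>N\<^esub> \<phi> y = \<phi> ((x \<ominus> y) \<oplus> y)"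
    using \<phi>(2) assms(4,5) by simp
  also have "\<dots> = \<phi> x" using assms(4,5)
    by (simp add: M.M.minus_eq M.M.a_assoc M.M.l_neg)
  finally show ?thesis using m
    by (simp add: N.M.minus_eq N.M.add.inv_solve_right)
qed

lemma linear_map_finsum:
  fixes M (structure)
  assumes "module K M" and "module K N" and "linear_map K M N \<phi>"
    and "finite J" and "a \<in> J \<rightarrow> carrier M"
  shows "\<phi> (\<Oplus>j\<in>J. a j) = (\<Oplus>\<^bsub>N\<^esub>j\<in>J. \<phi> (a j))"
proof -
  interpret M: module K M by fact
  interpret N: module K N by fact
  note \<phi> = linear_mapD[OF assms(3)]
  show ?thesis using assms(4,5)
    by (induction J rule: finite_induct)
      (auto simp: linear_map_zero[OF assms(1-3)] \<phi> Pi_def)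
qed

lemma linear_map_add:
  assumes "module K N" and "linear_map K M N \<phi>" and "linear_map K M N \<psi>"
  shows "linear_map K M N (\<lambda>x. \<phi> x \<oplus>\<^bsub>N\<^esub> \<psi> x)"
proof -
  interpret N: module K N by fact
  show ?thesis using linear_mapD[OF assms(2)] linear_mapD[OF assms(3)]
    by (intro linear_mapI) (auto simp: N.M.add.m_ac N.smult_r_distr)
qed

text \<open>Comparison maps are easiest to build out of a module whose structure is known. Only the
  source is assumed to be a module here, so the character of a constructed representation can serve
  as \<open>N\<close> with nothing but its operations.\<close>

lemma linearly_isomorphic_inverse:
  fixes M (structure)
  assumes "module K M" and "linear_map K M N \<phi>" and "bij_betw \<phi> (carrier M) (carrier N)"
  shows "linearly_isomorphic K N M"
proof -
  interpret M: module K M by fact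
  note \<phi> = linear_mapD[OF assms(2)]
  let ?\<psi> = "inv_into (carrier M) \<phi>"
  have inj: "inj_on \<phi> (carrier M)" and img: "\<phi> ` carrier M = carrier N"
    using assms(3) by (auto simp: bij_betw_def)
  have \<psi>: "?\<psi> y \<in> carrier M" "\<phi> (?\<psi> y) = y" if "y \<in> carrier N" for y
    using that img by (auto simp: inv_into_into f_inv_into_f)
  have "linear_map K N M ?\<psi>"
  proof (rule linear_mapI)
    fix x y assume xy: "x \<in> carrier N" "y \<in> carrier N"
    have "\<phi> (?\<psi> x \<oplus> ?\<psi> y) = x \<oplus>\<^bsub>N\<^esub> y" using \<phi>(2) \<psi> xy by simp
    then show "?\<psi> (x \<oplus>\<^bsub>N\<^esub> y) = ?\<psi> x \<oplus> ?\<psi> y"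
      using \<psi>(1) xy by (intro inv_into_f_eq[OF inj]) auto
  next
    fix c x assume cx: "c \<in> carrier K" "x \<in> carrier N"
    have "\<phi> (c \<odot> ?\<psi> x) = c \<odot>\<^bsub>N\<^esub> x" using \<phi>(3) \<psi> cx by simp
    then show "?\<psi> (c \<odot>\<^bsub>N\<^esub> x) = c \<odot> ?\<psi> x"
      using \<psi>(1) cx by (intro inv_into_f_eq[OF inj]) auto
  qed (use \<psi> in auto)
  then show ?thesis
    using bij_betw_inv_into[OF assms(3)] by (auto simp: linearly_isomorphic_def)
qed

lemma linear_map_inj_onI:
  fixes M (structure)
  assumes "module K M" and "module K N" and "linear_map K M N \<phi>"
    and "\<And>x. \<lbrakk>x \<in> carrier M; \<phi> x = \<zero>\<^bsub>N\<^esub>\<rbrakk> \<Longrightarrow> x = \<zero>"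
  shows "inj_on \<phi> (carrier M)"
proof
  interpret M: module K M by fact
  interpret N: module K N by fact
  fix x y assume xy: "x \<in> carrier M" "y \<in> carrier M" "\<phi> x = \<phi> y"
  then have "\<phi> (x \<ominus> y) = \<zero>\<^bsub>N\<^esub>"
    using linear_map_minus[OF assms(1-3)] linear_mapD(1)[OF assms(3)]
    by (simp add: N.M.minus_eq N.M.r_neg)
  then have "x \<ominus> y = \<zero>" using assms(4) xy by simp
  then show "x = y" using xy M.M.add.inv_solve_right[of "\<zero>" x y] by (simp add: M.M.minus_eq)
qed

text \<open>A surjection that respects the operations transports every axiom, so nothing has to be
  rechecked in quotients or in tagged hom-sets. The condition on zero is separate because
  \<open>linear_map_zero\<close> needs the target to be a module already.\<close>

lemma module_linear_image:
  fixes M (structure)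
  assumes "module K M" and "linear_map K M N q" and "q ` carrier M = carrier N"
    and "q \<zero> = \<zero>\<^bsub>N\<^esub>"
  shows "module K N"
proof -
  interpret M: module K M by fact
  note q = linear_mapD[OF assms(2)]
  have ex: "\<exists>a\<in>carrier M. x = q a" if "x \<in> carrier N" for x
    using that assms(3) by auto
  have neg: "\<exists>y\<in>carrier N. y \<oplus>\<^bsub>N\<^esub> x = \<zero>\<^bsub>N\<^esub>" if x: "x \<in> carrier N" for x
  proof -
    obtain a where a: "a \<in> carrier M" "x = q a" using ex[OF x] by auto
    then have "q (\<ominus> a) \<oplus>\<^bsub>N\<^esub> x = \<zero>\<^bsub>N\<^esub>"
      using q(2)[of "\<ominus> a" a] assms(4) by (simp add: M.M.l_neg)
    then show ?thesis using q(1)[of "\<ominus> a"] a by auto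
  qed
  have "abelian_group N"
  proof (rule abelian_groupI)
    show "\<zero>\<^bsub>N\<^esub> \<in> carrier N" using q(1)[of "\<zero>"] assms(4) by simp
    show "\<zero>\<^bsub>N\<^esub> \<oplus>\<^bsub>N\<^esub> x = x" if "x \<in> carrier N" for x
      using ex[OF that] q(2)[of "\<zero>"] assms(4) by force
  qed (use neg in \<open>auto dest!: ex simp: q(1) q(2)[symmetric] M.M.a_ac\<close>)
  then show ?thesis
    by (intro moduleI)
      (auto dest!: ex simp: q(1) q(2,3)[symmetric] M.R.is_cring M.smult_l_distr M.smult_r_distr
        M.smult_assoc1)
qed


section \<open>Tensor products\<close>

lemma free_module_simps [simp]:
  "\<zero>\<^bsub>free_module K S\<^esub> = (\<lambda>s. \<zero>\<^bsub>K\<^esub>)"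
  "u \<oplus>\<^bsub>free_module K S\<^esub> v = (\<lambda>s. u s \<oplus>\<^bsub>K\<^esub> v s)"
  "c \<odot>\<^bsub>free_module K S\<^esub> u = (\<lambda>s. c \<otimes>\<^bsub>K\<^esub> u s)"
  by (simp_all add: free_module_def)

lemma in_free_module_iff:
  "u \<in> carrier (free_module K S) \<longleftrightarrow>
    (\<forall>s. u s \<in> carrier K) \<and> {s. u s \<noteq> \<zero>\<^bsub>K\<^esub>} \<subseteq> S \<and> finite {s. u s \<noteq> \<zero>\<^bsub>K\<^esub>}"
  by (auto simp: free_module_def)

lemma module_free_module:
  fixes K (structure)
  assumes "cring K"
  shows "module K (free_module K S)"
proof -
  interpret cring K by fact
  let ?F = "free_module K S"
  have add: "u \<oplus>\<^bsub>?F\<^esub> v \<in> carrier ?F" if "u \<in> carrier ?F" "v \<in> carrier ?F" for u v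
  proof -
    have "{s. u s \<oplus> v s \<noteq> \<zero>} \<subseteq> {s. u s \<noteq> \<zero>} \<union> {s. v s \<noteq> \<zero>}"
      by auto
    then show ?thesis using that unfolding in_free_module_iff
      by (auto intro: finite_subset)
  qed
  have smult: "c \<odot>\<^bsub>?F\<^esub> u \<in> carrier ?F" if "c \<in> carrier K" "u \<in> carrier ?F" for c u
  proof -
    have "{s. c \<otimes> u s \<noteq> \<zero>} \<subseteq> {s. u s \<noteq> \<zero>}"
      using that by auto
    then show ?thesis using that unfolding in_free_module_iff
      by (auto intro: finite_subset)
  qed
  have neg: "\<exists>v\<in>carrier ?F. v \<oplus>\<^bsub>?F\<^esub> u = \<zero>\<^bsub>?F\<^esub>" if "u \<in> carrier ?F" for u
    using smult[of "\<ominus> \<one>" u] that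
    by (intro bexI[of _ "(\<ominus> \<one>) \<odot>\<^bsub>?F\<^esub> u"])
      (auto simp: in_free_module_iff l_minus l_neg)
  show ?thesis
  proof (rule moduleI)
    show "abelian_group ?F"
      by (rule abelian_groupI)
        (use add neg in \<open>auto simp: in_free_module_iff a_ac\<close>)
  qed (use smult in \<open>auto simp: in_free_module_iff l_distr r_distr m_assoc assms\<close>)
qed

lemma free_gen_in_free_module:
  fixes K (structure)
  assumes "cring K" and "s \<in> S"
  shows "free_gen K s \<in> carrier (free_module K S)"
proof -
  interpret cring K by fact
  have "{t. free_gen K s t \<noteq> \<zero>} \<subseteq> {s}" by (auto simp: free_gen_def)
  then show ?thesis using assms(2) unfolding in_free_module_iff
    by (auto simp: free_gen_def intro: finite_subset)
qed

text \<open>Induction on the support: zeroing one coefficient removes one point from it, and the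
  removed part is a multiple of a generator.\<close>

lemma free_module_induct [consumes 2, case_names zero gen add]:
  assumes "cring K" and "u \<in> carrier (free_module K S)"
    and Q_zero: "Q \<zero>\<^bsub>free_module K S\<^esub>"
    and Q_gen: "\<And>c s. \<lbrakk>c \<in> carrier K; s \<in> S\<rbrakk> \<Longrightarrow> Q (c \<odot>\<^bsub>free_module K S\<^esub> free_gen K s)"
    and Q_add: "\<And>u v. \<lbrakk>u \<in> carrier (free_module K S); v \<in> carrier (free_module K S); Q u; Q v\<rbrakk>
      \<Longrightarrow> Q (u \<oplus>\<^bsub>free_module K S\<^esub> v)"
  shows "Q u"
proof -
  interpret cring K by fact
  interpret F: module K "free_module K S" by (rule module_free_module) fact
  have "finite A \<Longrightarrow> u \<in> carrier (free_module K S) \<Longrightarrow> {s. u s \<noteq> \<zero>\<^bsub>K\<^esub>} = A \<Longrightarrow> Q u" for u A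
  proof (induction A arbitrary: u rule: finite_induct)
    case empty
    then have "u = \<zero>\<^bsub>free_module K S\<^esub>" by auto
    then show ?case by (simp only: Q_zero)
  next
    case (insert s A)
    let ?v = "u(s := \<zero>\<^bsub>K\<^esub>)" and ?w = "u s \<odot>\<^bsub>free_module K S\<^esub> free_gen K s"
    have s: "s \<in> S" and us: "u s \<in> carrier K" using insert.prems by (auto simp: in_free_module_iff)
    have supp: "{t. ?v t \<noteq> \<zero>\<^bsub>K\<^esub>} = A" using insert.prems(2) insert.hyps(2) by auto
    have v: "?v \<in> carrier (free_module K S)"
      using insert.prems insert.hyps unfolding in_free_module_iff supp by auto
    have w: "?w \<in> carrier (free_module K S)"
      using free_gen_in_free_module[OF assms(1) s] us by (rule F.smult_closed[rotated])
    have "?v \<oplus>\<^bsub>free_module K S\<^esub> ?w = u"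
      using insert.prems(1) by (intro ext) (simp add: free_gen_def in_free_module_iff)
    then show ?case
      using Q_add[OF v w insert.IH[OF v supp] Q_gen[OF us s]] by (simp only:)
  qed
  then show ?thesis using assms(2) by (auto simp: in_free_module_iff)
qed

text \<open>The linear extension of \<open>h\<close> from the generators. Summing over the support
  keeps the sum finite for an infinite set of generators.\<close>

definition free_lift :: "('k, 'r) ring_scheme \<Rightarrow> ('k, 'c, 'u) module_scheme \<Rightarrow> ('s \<Rightarrow> 'c)
    \<Rightarrow> ('s \<Rightarrow> 'k) \<Rightarrow> 'c"
  where "free_lift K P h u = (\<Oplus>\<^bsub>P\<^esub>s\<in>{s. u s \<noteq> \<zero>\<^bsub>K\<^esub>}. u s \<odot>\<^bsub>P\<^esub> h s)"

text \<open>Vectors with different supports can be summed over one common finite index set, which is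
  what termwise addition in \<open>linear_map_free_lift\<close> relies on.\<close>

lemma free_lift_superset:
  fixes P (structure)
  assumes "module K P" and "h \<in> S \<rightarrow> carrier P" and "u \<in> carrier (free_module K S)"
    and "finite A" and "{s. u s \<noteq> \<zero>\<^bsub>K\<^esub>} \<subseteq> A" and "A \<subseteq> S"
  shows "free_lift K P h u = (\<Oplus>s\<in>A. u s \<odot> h s)"
proof -
  interpret P: module K P by fact
  show ?thesis unfolding free_lift_def
    using assms by (intro P.M.add.finprod_mono_neutral_cong_left)
      (auto simp: in_free_module_iff Pi_def subset_iff)
qed

lemma linear_map_free_lift:
  fixes P (structure)
  assumes "module K P" and h: "h \<in> S \<rightarrow> carrier P"
  shows "linear_map K (free_module K S) P (free_lift K P h)"
proof -
  interpret P: module K P by fact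
  interpret F: module K "free_module K S" by (rule module_free_module) (rule P.R.is_cring)
  let ?supp = "\<lambda>u. {s. u s \<noteq> \<zero>\<^bsub>K\<^esub>}"
  note sup = free_lift_superset[OF assms]
  show ?thesis
  proof (rule linear_mapI)
    fix u assume "u \<in> carrier (free_module K S)"
    then show "free_lift K P h u \<in> carrier P"
      using h unfolding free_lift_def
      by (intro P.M.finsum_closed) (auto simp: in_free_module_iff Pi_def subset_iff)
  next
    fix u v assume uv: "u \<in> carrier (free_module K S)" "v \<in> carrier (free_module K S)"
    let ?A = "?supp u \<union> ?supp v" and ?w = "u \<oplus>\<^bsub>free_module K S\<^esub> v"
    have A: "finite ?A" "?A \<subseteq> S" using uv by (auto simp: in_free_module_iff)
    have w: "?w \<in> carrier (free_module K S)" using uv by (rule F.M.a_closed)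
    have "free_lift K P h ?w = (\<Oplus>s\<in>?A. ?w s \<odot> h s)"
      using uv by (intro sup[OF w A(1) _ A(2)]) (auto simp: in_free_module_iff)
    also have "\<dots> = (\<Oplus>s\<in>?A. u s \<odot> h s \<oplus> v s \<odot> h s)"
      using uv h by (intro P.M.finsum_cong')
        (auto simp: in_free_module_iff Pi_def subset_iff P.smult_l_distr)
    also have "\<dots> = (\<Oplus>s\<in>?A. u s \<odot> h s) \<oplus> (\<Oplus>s\<in>?A. v s \<odot> h s)"
      using uv h A(2) by (intro P.M.finsum_addf) (auto simp: in_free_module_iff Pi_def subset_iff)
    also have "\<dots> = free_lift K P h u \<oplus> free_lift K P h v"
      using sup[OF uv(1) A(1) _ A(2)] sup[OF uv(2) A(1) _ A(2)] by simp
    finally show "free_lift K P h ?w = free_lift K P h u \<oplus> free_lift K P h v" .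
  next
    fix c u assume c: "c \<in> carrier K" and u: "u \<in> carrier (free_module K S)"
    let ?A = "?supp u" and ?w = "c \<odot>\<^bsub>free_module K S\<^esub> u"
    have A: "finite ?A" "?A \<subseteq> S" using u by (auto simp: in_free_module_iff)
    have w: "?w \<in> carrier (free_module K S)" using c u by (rule F.smult_closed)
    have "free_lift K P h ?w = (\<Oplus>s\<in>?A. ?w s \<odot> h s)"
      using c by (intro sup[OF w A(1) _ A(2)]) auto
    also have "\<dots> = (\<Oplus>s\<in>?A. c \<odot> (u s \<odot> h s))"
      using u c h by (intro P.M.finsum_cong')
        (auto simp: in_free_module_iff Pi_def subset_iff P.smult_assoc1)
    also have "\<dots> = c \<odot> free_lift K P h u"
      using u c h A unfolding free_lift_def by (subst P.finsum_smult_ldistr)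
        (auto simp: in_free_module_iff Pi_def subset_iff)
    finally show "free_lift K P h ?w = c \<odot> free_lift K P h u" .
  qed
qed

lemma free_lift_free_gen:
  fixes P (structure)
  assumes "module K P" and h: "h \<in> S \<rightarrow> carrier P" and "s \<in> S"
  shows "free_lift K P h (free_gen K s) = h s"
proof -
  interpret P: module K P by fact
  have "free_lift K P h (free_gen K s) = (\<Oplus>t\<in>{s}. free_gen K s t \<odot> h t)"
    using assms by (intro free_lift_superset[OF assms(1,2) free_gen_in_free_module])
      (auto simp: free_gen_def P.R.is_cring)
  also have "\<dots> = h s" using h assms(3) by (auto simp: free_gen_def Pi_def)
  finally show ?thesis .
qed

section \<open>Quotient modules\<close>

lemma quotient_module_simps [simp]:
  "carrier (quotient_module M H) = a_rcosets\<^bsub>M\<^esub> H"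
  "\<zero>\<^bsub>quotient_module M H\<^esub> = H"
  "A \<oplus>\<^bsub>quotient_module M H\<^esub> B = A <+>\<^bsub>M\<^esub> B"
  "c \<odot>\<^bsub>quotient_module M H\<^esub> A = (\<Union>x\<in>A. H +>\<^bsub>M\<^esub> (c \<odot>\<^bsub>M\<^esub> x))"
  by (simp_all add: quotient_module_def)

context
  fixes K :: "('k, 'r) ring_scheme" and M :: "('k, 'a, 's) module_scheme" (structure) and H
  assumes M: "module K M" and H: "submodule H K M"
begin

interpretation module K M by (rule M)

interpretation H: submodule H K M by (rule H)

interpretation H: abelian_subgroup H M
  by (rule abelian_subgroupI3[OF additive_subgroup.intro abelian_group_axioms])
    (rule H.subgroup_axioms)

lemma coset_eq_iff:
  assumes "x \<in> carrier M" and "y \<in> carrier M"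
  shows "H +> x = H +> y \<longleftrightarrow> x \<ominus> y \<in> H"
proof -
  have "H +> x = H +> y \<longleftrightarrow> x \<in> H +> y"
    using assms H.a_rcos_self H.a_repr_independence' by metis
  also have "\<dots> \<longleftrightarrow> x \<ominus> y \<in> H"
    using assms H.a_rcos_module[of y x] by (simp add: M.minus_eq)
  finally show ?thesis .
qed

lemma linear_map_coset: "linear_map K M (quotient_module M H) (\<lambda>x. H +> x)"
proof (rule linear_mapI)
  fix c x assume c: "c \<in> carrier K" and x: "x \<in> carrier M"
  \<comment> \<open>A scalar multiple of a coset is defined as a union over the members of the
    coset; it collapses because every member contributes the same coset.\<close>
  have "H +> (c \<odot> y) = H +> (c \<odot> x)" if y: "y \<in> H +> x" for y
  proof -
    have yM: "y \<in> carrier M" using y x H.a_subset a_r_coset_subset_G by blast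
    have "y \<ominus> x \<in> H" using y x yM coset_eq_iff H.a_rcos_self H.a_repr_independence' by metis
    then have "c \<odot> (y \<ominus> x) \<in> H" using c by simp
    moreover have "c \<odot> (y \<ominus> x) = c \<odot> y \<ominus> c \<odot> x"
      using c x yM by (simp add: M.minus_eq smult_r_distr smult_r_minus)
    ultimately show ?thesis using c x yM by (simp add: coset_eq_iff)
  qed
  moreover have "x \<in> H +> x" using x by (rule H.a_rcos_self)
  ultimately show "H +> (c \<odot> x) = c \<odot>\<^bsub>quotient_module M H\<^esub> (H +> x)" 
    unfolding quotient_module_simps by (metis (no_types, lifting) SUP_eq_const equals0D)
qed (simp_all add: a_rcosetsI H.a_subset H.a_rcos_sum)

lemma in_quotient_module_iff: "A \<in> carrier (quotient_module M H) \<longleftrightarrow> (\<exists>x\<in>carrier M. A = H +> x)"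
  by (auto simp: A_RCOSETS_def')

lemma module_quotient_module: "module K (quotient_module M H)"
proof (rule module_linear_image[OF M linear_map_coset])
  show "(\<lambda>x. H +> x) ` carrier M = carrier (quotient_module M H)"
    by (auto simp: A_RCOSETS_def')
  show "H +> \<zero> = \<zero>\<^bsub>quotient_module M H\<^esub>" using H.a_subset by simp
qed

lemma linear_map_descends:
  assumes P: "module K P" and \<phi>: "linear_map K M P \<phi>" and ker: "\<And>x. x \<in> H \<Longrightarrow> \<phi> x = \<zero>\<^bsub>P\<^esub>"
  obtains \<psi> where "linear_map K (quotient_module M H) P \<psi>"
    and "\<And>x. x \<in> carrier M \<Longrightarrow> \<psi> (H +> x) = \<phi> x"
proof -
  interpret P: module K P by fact
  note q = linear_mapD[OF linear_map_coset]
  \<comment> \<open>The value is taken at an arbitrary representative, and vanishing on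
    \<open>H\<close> makes the choice irrelevant.\<close>
  let ?\<psi> = "\<lambda>A. \<phi> (SOME x. x \<in> carrier M \<and> A = H +> x)"
  have \<psi>: "?\<psi> (H +> x) = \<phi> x" if x: "x \<in> carrier M" for x
  proof -
    let ?y = "SOME y. y \<in> carrier M \<and> H +> x = H +> y"
    have y: "?y \<in> carrier M \<and> H +> x = H +> ?y" by (rule someI[of _ x]) (use x in simp)
    then have "\<phi> (x \<ominus> ?y) = \<zero>\<^bsub>P\<^esub>" using ker coset_eq_iff[OF x] by blast
    then have "\<phi> x \<ominus>\<^bsub>P\<^esub> \<phi> ?y = \<zero>\<^bsub>P\<^esub>"
      using linear_map_minus[OF M P \<phi> x] y by simp
    then show ?thesis using x y linear_mapD(1)[OF \<phi>]
        P.M.add.inv_solve_right[of "\<zero>\<^bsub>P\<^esub>" "\<phi> x" "\<phi> ?y"] by (simp add: P.M.minus_eq)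
  qed
  have "linear_map K (quotient_module M H) P ?\<psi>"
  proof (rule linear_mapI)
    fix A B assume "A \<in> carrier (quotient_module M H)" "B \<in> carrier (quotient_module M H)"
    then obtain x y where xy: "x \<in> carrier M" "A = H +> x" "y \<in> carrier M" "B = H +> y"
      unfolding in_quotient_module_iff by blast
    show "?\<psi> A \<in> carrier P" using xy \<psi> linear_mapD(1)[OF \<phi>] by simp
    have "?\<psi> (A \<oplus>\<^bsub>quotient_module M H\<^esub> B) = ?\<psi> (H +> (x \<oplus> y))"
      using q(2)[OF xy(1,3)] xy by simp
    also have "\<dots> = ?\<psi> A \<oplus>\<^bsub>P\<^esub> ?\<psi> B"
      using xy \<psi> linear_mapD(2)[OF \<phi>] by simp
    finally show "?\<psi> (A \<oplus>\<^bsub>quotient_module M H\<^esub> B) = ?\<psi> A \<oplus>\<^bsub>P\<^esub> ?\<psi> B" .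
  next
    fix c A assume c: "c \<in> carrier K" and "A \<in> carrier (quotient_module M H)"
    then obtain x where x: "x \<in> carrier M" "A = H +> x"
      unfolding in_quotient_module_iff by blast
    have "?\<psi> (c \<odot>\<^bsub>quotient_module M H\<^esub> A) = ?\<psi> (H +> (c \<odot> x))"
      using q(3)[OF c x(1)] x by simp
    also have "\<dots> = c \<odot>\<^bsub>P\<^esub> ?\<psi> A"
      using x c \<psi> linear_mapD(3)[OF \<phi>] by simp
    finally show "?\<psi> (c \<odot>\<^bsub>quotient_module M H\<^esub> A) = c \<odot>\<^bsub>P\<^esub> ?\<psi> A" .
  qed
  then show ?thesis using \<psi> that by blast
qed

end

section \<open>Bilinear maps and the universal property of the tensor product\<close>

definition bilinear_map ::
    "('k, 'r) ring_scheme \<Rightarrow> ('k, 'a, 's) module_scheme \<Rightarrow> ('k, 'b, 't) module_scheme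
      \<Rightarrow> ('k, 'c, 'u) module_scheme \<Rightarrow> ('a \<Rightarrow> 'b \<Rightarrow> 'c) \<Rightarrow> bool"
  where "bilinear_map K M N P h \<longleftrightarrow>
    (\<forall>x\<in>carrier M. linear_map K N P (h x)) \<and> (\<forall>y\<in>carrier N. linear_map K M P (\<lambda>x. h x y))"

lemma bilinear_mapI:
  assumes "\<And>x. x \<in> carrier M \<Longrightarrow> linear_map K N P (h x)"
    and "\<And>y. y \<in> carrier N \<Longrightarrow> linear_map K M P (\<lambda>x. h x y)"
  shows "bilinear_map K M N P h"
  using assms by (simp add: bilinear_map_def)

lemma bilinear_mapD:
  assumes "bilinear_map K M N P h"
  shows "x \<in> carrier M \<Longrightarrow> linear_map K N P (h x)"
    and "y \<in> carrier N \<Longrightarrow> linear_map K M P (\<lambda>x. h x y)"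
  using assms by (simp_all add: bilinear_map_def)

locale tensor_product = M: module K M + N: module K N
  for K :: "('k, 'r) ring_scheme" and M :: "('k, 'a, 's) module_scheme"
    and N :: "('k, 'b, 't) module_scheme"
begin

abbreviation "F \<equiv> free_module K (carrier M \<times> carrier N)"

abbreviation "T \<equiv> module_tensor K M N"

abbreviation pt (infixl \<open>\<otimes>t\<close> 75) where "x \<otimes>t y \<equiv> pure_tensor K M N x y"

sublocale F: module K F
  by (rule module_free_module[OF M.R.is_cring])

lemma gen_closed: "\<lbrakk>x \<in> carrier M; y \<in> carrier N\<rbrakk> \<Longrightarrow> free_gen K (x, y) \<in> carrier F"
  by (rule free_gen_in_free_module) (auto simp: M.R.is_cring)

lemma relations_subset: "bilinearity_relations K M N \<subseteq> carrier F"
  unfolding bilinearity_relations_def Let_def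
  by (auto intro!: gen_closed simp del: free_module_simps)

lemma submodule_relations: "submodule (bilinearity_submodule K M N) K F"
proof -
  \<comment> \<open>The carrier itself belongs to the intersected family, which keeps the
    intersection from being the set of all functions.\<close>
  have "bilinearity_submodule K M N \<subseteq> carrier F"
    using F.carrier_is_submodule relations_subset unfolding bilinearity_submodule_def by blast
  then show ?thesis
    unfolding bilinearity_submodule_def
    by (intro F.submoduleI)
      (auto dest: F.submoduleE simp del: free_module_simps
        intro: subgroup.one_closed[OF submodule.axioms(1), of _ K F, simplified])
qed

sublocale T: module K T
  unfolding module_tensor_def by (rule module_quotient_module[OF F.module_axioms submodule_relations])

end

context tensor_product
begin

lemma free_to_T: "linear_map K F T (\<lambda>u. bilinearity_submodule K M N +>\<^bsub>F\<^esub> u)"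
  unfolding module_tensor_def by (rule linear_map_coset[OF F.module_axioms submodule_relations])

lemma pure_closed [simp, intro]: "\<lbrakk>x \<in> carrier M; y \<in> carrier N\<rbrakk> \<Longrightarrow> x \<otimes>t y \<in> carrier T"
  unfolding pure_tensor_def by (rule linear_mapD(1)[OF free_to_T gen_closed])

text \<open>Every defining relation is a difference of two vectors, so one comparison of cosets
  serves all four bilinearity rules below.\<close>

lemma free_to_T_eqI:
  assumes "u \<in> carrier F" and "v \<in> carrier F" and "u \<ominus>\<^bsub>F\<^esub> v \<in> bilinearity_relations K M N"
  shows "bilinearity_submodule K M N +>\<^bsub>F\<^esub> u = bilinearity_submodule K M N +>\<^bsub>F\<^esub> v"
  using assms by (subst coset_eq_iff[OF F.module_axioms submodule_relations])
    (auto simp: bilinearity_submodule_def)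

lemma pure_add_left:
  assumes "x \<in> carrier M" and "x' \<in> carrier M" and "y \<in> carrier N"
  shows "(x \<oplus>\<^bsub>M\<^esub> x') \<otimes>t y = x \<otimes>t y \<oplus>\<^bsub>T\<^esub> x' \<otimes>t y"
proof -
  have rel: "free_gen K (x \<oplus>\<^bsub>M\<^esub> x', y) \<ominus>\<^bsub>F\<^esub> (free_gen K (x, y) \<oplus>\<^bsub>F\<^esub> free_gen K (x', y))
      \<in> bilinearity_relations K M N"
    unfolding bilinearity_relations_def Let_def using assms by blast
  show ?thesis
    unfolding pure_tensor_def linear_mapD(2)[OF free_to_T gen_closed gen_closed, OF assms(1,3,2,3), symmetric]
    using assms by (intro free_to_T_eqI[OF _ _ rel] gen_closed F.M.a_closed M.M.a_closed)
qed

lemma pure_add_right: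
  assumes "x \<in> carrier M" and "y \<in> carrier N" and "y' \<in> carrier N"
  shows "x \<otimes>t (y \<oplus>\<^bsub>N\<^esub> y') = x \<otimes>t y \<oplus>\<^bsub>T\<^esub> x \<otimes>t y'"
proof -
  have rel: "free_gen K (x, y \<oplus>\<^bsub>N\<^esub> y') \<ominus>\<^bsub>F\<^esub> (free_gen K (x, y) \<oplus>\<^bsub>F\<^esub> free_gen K (x, y'))
      \<in> bilinearity_relations K M N"
    unfolding bilinearity_relations_def Let_def using assms by blast
  show ?thesis
    unfolding pure_tensor_def linear_mapD(2)[OF free_to_T gen_closed gen_closed, OF assms(1,2,1,3), symmetric]
    using assms by (intro free_to_T_eqI[OF _ _ rel] gen_closed F.M.a_closed N.M.a_closed)
qed

lemma pure_smult_left: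
  assumes "c \<in> carrier K" and "x \<in> carrier M" and "y \<in> carrier N"
  shows "(c \<odot>\<^bsub>M\<^esub> x) \<otimes>t y = c \<odot>\<^bsub>T\<^esub> x \<otimes>t y"
proof -
  have rel: "free_gen K (c \<odot>\<^bsub>M\<^esub> x, y) \<ominus>\<^bsub>F\<^esub> (c \<odot>\<^bsub>F\<^esub> free_gen K (x, y))
      \<in> bilinearity_relations K M N"
    unfolding bilinearity_relations_def Let_def using assms by blast
  show ?thesis
    unfolding pure_tensor_def linear_mapD(3)[OF free_to_T assms(1) gen_closed, OF assms(2,3), symmetric]
    using assms by (intro free_to_T_eqI[OF _ _ rel] gen_closed F.smult_closed M.smult_closed)
qed

lemma pure_smult_right:
  assumes "c \<in> carrier K" and "x \<in> carrier M" and "y \<in> carrier N"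
  shows "x \<otimes>t (c \<odot>\<^bsub>N\<^esub> y) = c \<odot>\<^bsub>T\<^esub> x \<otimes>t y"
proof -
  have rel: "free_gen K (x, c \<odot>\<^bsub>N\<^esub> y) \<ominus>\<^bsub>F\<^esub> (c \<odot>\<^bsub>F\<^esub> free_gen K (x, y))
      \<in> bilinearity_relations K M N"
    unfolding bilinearity_relations_def Let_def using assms by blast
  show ?thesis
    unfolding pure_tensor_def linear_mapD(3)[OF free_to_T assms(1) gen_closed, OF assms(2,3), symmetric]
    using assms by (intro free_to_T_eqI[OF _ _ rel] gen_closed F.smult_closed N.smult_closed)
qed

lemma bilinear_pure: "bilinear_map K M N T (\<otimes>t)"
  by (intro bilinear_mapI linear_mapI)
    (auto simp: pure_add_left pure_add_right pure_smult_left pure_smult_right)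

lemma pure_zero_left: "y \<in> carrier N \<Longrightarrow> \<zero>\<^bsub>M\<^esub> \<otimes>t y = \<zero>\<^bsub>T\<^esub>"
  by (rule linear_map_zero[OF M.module_axioms T.module_axioms bilinear_mapD(2)[OF bilinear_pure]])

lemma pure_zero_right: "x \<in> carrier M \<Longrightarrow> x \<otimes>t \<zero>\<^bsub>N\<^esub> = \<zero>\<^bsub>T\<^esub>"
  by (rule linear_map_zero[OF N.module_axioms T.module_axioms bilinear_mapD(1)[OF bilinear_pure]])

text \<open>Sums of pure tensors exhaust the tensor product without scalars: a scalar is absorbed
  into the left factor, and zero is the pure tensor of two zeros.\<close>

lemma tensor_induct [consumes 1, case_names pure add]:
  assumes t: "t \<in> carrier T"
    and Q_pure: "\<And>x y. \<lbrakk>x \<in> carrier M; y \<in> carrier N\<rbrakk> \<Longrightarrow> Q (x \<otimes>t y)"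
    and Q_add: "\<And>s t. \<lbrakk>s \<in> carrier T; t \<in> carrier T; Q s; Q t\<rbrakk> \<Longrightarrow> Q (s \<oplus>\<^bsub>T\<^esub> t)"
  shows "Q t"
proof -
  let ?q = "\<lambda>u. bilinearity_submodule K M N +>\<^bsub>F\<^esub> u"
  note q = linear_mapD[OF free_to_T]
  have "Q (?q u)" if "u \<in> carrier F" for u
    using M.R.is_cring that
  proof (induction rule: free_module_induct)
    case zero
    have "?q \<zero>\<^bsub>F\<^esub> = \<zero>\<^bsub>M\<^esub> \<otimes>t \<zero>\<^bsub>N\<^esub>"
      by (simp add: linear_map_zero[OF F.module_axioms T.module_axioms free_to_T] pure_zero_left
          del: free_module_simps)
    then show ?case using Q_pure[of "\<zero>\<^bsub>M\<^esub>" "\<zero>\<^bsub>N\<^esub>"] by simp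
  next
    case (gen c s)
    obtain x y where s: "s = (x, y)" "x \<in> carrier M" "y \<in> carrier N" using gen(2) by blast
    have "?q (c \<odot>\<^bsub>F\<^esub> free_gen K s) = (c \<odot>\<^bsub>M\<^esub> x) \<otimes>t y"
      unfolding s(1) q(3)[OF gen(1) gen_closed[OF s(2,3)]] pure_smult_left[OF gen(1) s(2,3)]
      by (simp add: pure_tensor_def)
    then show ?case using Q_pure[of "c \<odot>\<^bsub>M\<^esub> x" y] gen(1) s by (simp del: free_module_simps)
  next
    case (add u v)
    then show ?case using q(2)[OF add(1,2)] Q_add[OF q(1) q(1)] by (simp del: free_module_simps)
  qed
  moreover have "\<exists>u\<in>carrier F. t = ?q u"
    using t unfolding module_tensor_def in_quotient_module_iff[OF F.module_axioms submodule_relations] .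
  ultimately show ?thesis by blast
qed

lemma tensor_linear_eq:
  assumes "linear_map K T P \<phi>" and "linear_map K T P \<psi>"
    and "\<And>x y. \<lbrakk>x \<in> carrier M; y \<in> carrier N\<rbrakk> \<Longrightarrow> \<phi> (x \<otimes>t y) = \<psi> (x \<otimes>t y)"
    and "t \<in> carrier T"
  shows "\<phi> t = \<psi> t"
  using assms(4)
  by (induction rule: tensor_induct)
    (simp_all add: assms(3) linear_mapD(2)[OF assms(1)] linear_mapD(2)[OF assms(2)])

lemma tensor_lift_exists:
  assumes P: "module K P" and h: "bilinear_map K M N P h"
  obtains \<phi> where "linear_map K T P \<phi>"
    and "\<And>x y. \<lbrakk>x \<in> carrier M; y \<in> carrier N\<rbrakk> \<Longrightarrow> \<phi> (x \<otimes>t y) = h x y"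
proof -
  interpret P: module K P by fact
  note hl = linear_mapD[OF bilinear_mapD(2)[OF h]]
  note hr = linear_mapD[OF bilinear_mapD(1)[OF h]]
  let ?h = "\<lambda>(x, y). h x y"
  let ?\<phi> = "free_lift K P ?h"
  \<comment> \<open>The kernel of the linear extension is a submodule that contains the relations,
    hence it contains the smallest such submodule and the extension descends to the
    quotient.\<close>
  let ?ker = "{u \<in> carrier F. ?\<phi> u = \<zero>\<^bsub>P\<^esub>}"
  have h_in: "?h \<in> carrier M \<times> carrier N \<rightarrow> carrier P" using hr(1) by auto
  note lin = linear_map_free_lift[OF P h_in]
  note \<phi> = linear_mapD[OF lin]
  note \<phi>_minus = linear_map_minus[OF F.module_axioms P lin]
  have \<phi>_gen: "?\<phi> (free_gen K (x, y)) = h x y" if "x \<in> carrier M" "y \<in> carrier N" for x y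
    using free_lift_free_gen[OF P h_in, of "(x, y)"] that by simp
  have "submodule ?ker K F"
  proof (rule F.submoduleI)
    fix u assume u: "u \<in> ?ker"
    then have "?\<phi> (\<zero>\<^bsub>F\<^esub> \<ominus>\<^bsub>F\<^esub> u) = \<zero>\<^bsub>P\<^esub>"
      using \<phi>_minus[of "\<zero>\<^bsub>F\<^esub>" u] linear_map_zero[OF F.module_axioms P lin]
      by (simp add: P.M.minus_eq del: free_module_simps)
    then show "\<ominus>\<^bsub>F\<^esub> u \<in> ?ker" using u by (simp add: F.M.minus_eq del: free_module_simps)
  qed (auto simp: linear_map_zero[OF F.module_axioms P lin] \<phi> simp del: free_module_simps)
  moreover have "bilinearity_relations K M N \<subseteq> ?ker"
    unfolding bilinearity_relations_def Let_def
    by (auto simp: \<phi>_minus \<phi>_gen gen_closed \<phi> hl hr P.M.minus_eq P.M.r_neg simp del: free_module_simps)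
  ultimately have "bilinearity_submodule K M N \<subseteq> ?ker"
    unfolding bilinearity_submodule_def by blast
  then have "?\<phi> u = \<zero>\<^bsub>P\<^esub>" if "u \<in> bilinearity_submodule K M N" for u using that by blast
  then obtain \<psi> where "linear_map K T P \<psi>"
    and "\<And>u. u \<in> carrier F \<Longrightarrow> \<psi> (bilinearity_submodule K M N +>\<^bsub>F\<^esub> u) = ?\<phi> u"
    unfolding module_tensor_def
    using linear_map_descends[OF F.module_axioms submodule_relations P lin] by blast
  then show ?thesis
    using that[of \<psi>] by (simp add: pure_tensor_def gen_closed \<phi>_gen)
qed

text \<open>The definite description in \<open>tensor_lift\<close> denotes: a linear map is
  determined on the carrier by its values on pure tensors, and extensionality fixes it
  elsewhere.\<close>

lemma tensor_lift:
  assumes P: "module K P" and h: "bilinear_map K M N P h"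
  shows "linear_map K T P (tensor_lift K M N P h)"
    and "\<lbrakk>x \<in> carrier M; y \<in> carrier N\<rbrakk> \<Longrightarrow> tensor_lift K M N P h (x \<otimes>t y) = h x y"
proof -
  let ?Q = "\<lambda>\<phi>. \<phi> \<in> extensional (carrier T) \<and> linear_map K T P \<phi> \<and>
    (\<forall>x\<in>carrier M. \<forall>y\<in>carrier N. \<phi> (x \<otimes>t y) = h x y)"
  obtain \<phi> where \<phi>: "linear_map K T P \<phi>"
      "\<And>x y. \<lbrakk>x \<in> carrier M; y \<in> carrier N\<rbrakk> \<Longrightarrow> \<phi> (x \<otimes>t y) = h x y"
    using tensor_lift_exists[OF assms] by blast
  have lift: "?Q (restrict \<phi> (carrier T))"
    using \<phi> by (auto intro: linear_map_cong[OF T.module_axioms])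
  have unique: "\<phi>1 = \<phi>2" if "?Q \<phi>1" "?Q \<phi>2" for \<phi>1 \<phi>2
  proof (rule extensionalityI)
    fix t assume "t \<in> carrier T"
    then show "\<phi>1 t = \<phi>2 t" by (rule tensor_linear_eq[rotated -1, of _ P]) (use that in auto)+
  qed (use that in blast)+
  have "?Q (tensor_lift K M N P h)"
    unfolding tensor_lift_def by (rule theI[of ?Q, OF lift unique[OF _ lift]])
  then show "linear_map K T P (tensor_lift K M N P h)"
    and "\<lbrakk>x \<in> carrier M; y \<in> carrier N\<rbrakk> \<Longrightarrow> tensor_lift K M N P h (x \<otimes>t y) = h x y"
    by auto
qed

lemma tensor_sum_pure:
  assumes "t \<in> carrier T"
  shows "\<exists>J a b. finite (J :: nat set) \<and> a \<in> J \<rightarrow> carrier M \<and> b \<in> J \<rightarrow> carrier N \<and>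
    t = (\<Oplus>\<^bsub>T\<^esub>j\<in>J. a j \<otimes>t b j)"
  using assms
proof (induction rule: tensor_induct)
  case (pure x y)
  then show ?case
    by (intro exI[of _ "{0}"] exI[of _ "\<lambda>_. x"] exI[of _ "\<lambda>_. y"]) auto
next
  case (add s t)
  from add(3) obtain I a b where I: "finite (I :: nat set)" "a \<in> I \<rightarrow> carrier M" "b \<in> I \<rightarrow> carrier N"
      "s = (\<Oplus>\<^bsub>T\<^esub>j\<in>I. a j \<otimes>t b j)"
    by blast
  from add(4) obtain J c d where J: "finite (J :: nat set)" "c \<in> J \<rightarrow> carrier M" "d \<in> J \<rightarrow> carrier N"
      "t = (\<Oplus>\<^bsub>T\<^esub>j\<in>J. c j \<otimes>t d j)"
    by blast
  \<comment> \<open>Even indices carry the summands of \<open>s\<close> and odd ones those of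
    \<open>t\<close>, which makes the two index sets disjoint inside the natural numbers.\<close>
  let ?a = "\<lambda>j. if even j then a (j div 2) else c (j div 2)"
  let ?b = "\<lambda>j. if even j then b (j div 2) else d (j div 2)"
  let ?I = "(\<lambda>j. 2 * j) ` I" and ?J = "(\<lambda>j. Suc (2 * j)) ` J"
  have eq: "(\<Oplus>\<^bsub>T\<^esub>j\<in>?I. ?a j \<otimes>t ?b j) = s" "(\<Oplus>\<^bsub>T\<^esub>j\<in>?J. ?a j \<otimes>t ?b j) = t"
    using I J by (subst T.M.finsum_reindex; auto simp: inj_on_def Pi_def)+
  have "?I \<inter> ?J = {}" by (auto, presburger)
  then have "(\<Oplus>\<^bsub>T\<^esub>j\<in>?I \<union> ?J. ?a j \<otimes>t ?b j) = s \<oplus>\<^bsub>T\<^esub> t"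
    using I J by (subst T.M.finsum_Un_disjoint) (auto simp: Pi_def eq)
  then show ?case using I J
    by (intro exI[of _ "?I \<union> ?J"] exI[of _ ?a] exI[of _ ?b]) (auto simp: Pi_def)
qed

end


section \<open>Linear independence\<close>

text \<open>Independence is a property of a family, not of a set of vectors: a repeated vector
  counts as a dependency, and the two factors of a sum of pure tensors keep the same index
  set.\<close>

definition lin_indep :: "('k, 'r) ring_scheme \<Rightarrow> ('k, 'a, 's) module_scheme \<Rightarrow> 'i set \<Rightarrow> ('i \<Rightarrow> 'a) \<Rightarrow> bool"
  where "lin_indep K M J a \<longleftrightarrow>
    (\<forall>c \<in> J \<rightarrow> carrier K. (\<Oplus>\<^bsub>M\<^esub>j\<in>J. c j \<odot>\<^bsub>M\<^esub> a j) = \<zero>\<^bsub>M\<^esub> \<longrightarrow> (\<forall>j\<in>J. c j = \<zero>\<^bsub>K\<^esub>))"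

text \<open>Carries independence of transformations over to their values at a generator, where
  evaluation is injective.\<close>

lemma lin_indep_image:
  fixes M (structure)
  assumes "module K M" and "module K N" and \<phi>: "linear_map K M N \<phi>" and inj: "inj_on \<phi> (carrier M)"
    and J: "finite J" "a \<in> J \<rightarrow> carrier M" and "lin_indep K M J a"
  shows "lin_indep K N J (\<lambda>j. \<phi> (a j))"
  unfolding lin_indep_def
proof (intro ballI impI)
  interpret M: module K M by fact
  interpret N: module K N by fact
  fix c j assume c: "c \<in> J \<rightarrow> carrier K" "(\<Oplus>\<^bsub>N\<^esub>j\<in>J. c j \<odot>\<^bsub>N\<^esub> \<phi> (a j)) = \<zero>\<^bsub>N\<^esub>" and j: "j \<in> J"
  let ?s = "\<Oplus>j\<in>J. c j \<odot> a j"
  have "\<phi> ?s = (\<Oplus>\<^bsub>N\<^esub>j\<in>J. \<phi> (c j \<odot> a j))"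
    using J c by (intro linear_map_finsum[OF assms(1,2) \<phi>]) auto
  also have "\<dots> = (\<Oplus>\<^bsub>N\<^esub>j\<in>J. c j \<odot>\<^bsub>N\<^esub> \<phi> (a j))"
    using J c linear_mapD(1,3)[OF \<phi>] by (intro N.M.finsum_cong') (auto simp: Pi_def)
  also have "\<dots> = \<phi> \<zero>" using c linear_map_zero[OF assms(1,2) \<phi>] by simp
  finally have "?s = \<zero>"
    using inj J c by (auto dest!: inj_onD intro!: M.M.finsum_closed)
  then show "c j = \<zero>\<^bsub>K\<^esub>" using assms(7) c(1) j unfolding lin_indep_def by blast
qed

section \<open>Submodules and linear functionals\<close>

lemma submodule_zero:
  fixes M (structure)
  assumes "module K M" and "submodule H K M"
  shows "\<zero> \<in> H"
  using subgroup.one_closed[OF submodule.axioms(1)[OF assms(2)]] by simp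

text \<open>Applied to \<open>free_lift\<close>, this makes the span of a family a
  submodule.\<close>

lemma submodule_range:
  fixes M (structure)
  assumes "module K M'" and "module K M" and \<phi>: "linear_map K M' M \<phi>"
  shows "submodule (\<phi> ` carrier M') K M"
proof -
  interpret M': module K M' by fact
  interpret module K M by fact
  note \<phi>_zero = linear_map_zero[OF assms] and \<phi>_minus = linear_map_minus[OF assms]
  show ?thesis
  proof (rule submoduleI)
    show "\<zero> \<in> \<phi> ` carrier M'" using \<phi>_zero by (intro image_eqI[of _ _ "\<zero>\<^bsub>M'\<^esub>"]) simp_all
    show "\<ominus> u \<in> \<phi> ` carrier M'" if u: "u \<in> \<phi> ` carrier M'" for u
    proof -
      obtain x where x: "x \<in> carrier M'" "u = \<phi> x" using u by blast
      have "\<phi> (\<zero>\<^bsub>M'\<^esub> \<ominus>\<^bsub>M'\<^esub> x) = \<ominus> u"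
        using \<phi>_minus[OF M'.M.zero_closed x(1)] linear_mapD(1)[OF \<phi> x(1)] x(2) \<phi>_zero
        by (simp add: M.minus_eq)
      then show ?thesis using x(1) by (intro image_eqI[of _ _ "\<zero>\<^bsub>M'\<^esub> \<ominus>\<^bsub>M'\<^esub> x"]) simp_all
    qed
    show "u \<oplus> v \<in> \<phi> ` carrier M'" if uv: "u \<in> \<phi> ` carrier M'" "v \<in> \<phi> ` carrier M'" for u v
    proof -
      obtain x y where xy: "x \<in> carrier M'" "u = \<phi> x" "y \<in> carrier M'" "v = \<phi> y" using uv by blast
      then have "u \<oplus> v = \<phi> (x \<oplus>\<^bsub>M'\<^esub> y)" using linear_mapD(2)[OF \<phi>] by simp
      then show ?thesis using xy by blast
    qed
    show "k \<odot> u \<in> \<phi> ` carrier M'" if k: "k \<in> carrier K" and u: "u \<in> \<phi> ` carrier M'" for k u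
    proof -
      obtain x where x: "x \<in> carrier M'" "u = \<phi> x" using u by blast
      then have "k \<odot> u = \<phi> (k \<odot>\<^bsub>M'\<^esub> x)" using linear_mapD(3)[OF \<phi>] k by simp
      then show ?thesis using x k by blast
    qed
  qed (use linear_mapD(1)[OF \<phi>] in blast)
qed

lemma submodule_minus:
  fixes M (structure)
  assumes "module K M" and "submodule H K M" and "x \<in> H" and "y \<in> H"
  shows "x \<ominus> y \<in> H"
proof -
  interpret module K M by fact
  show ?thesis using submoduleE[OF assms(2)] assms(3,4) by (simp add: M.minus_eq)
qed

lemma submodule_Union_chain:
  fixes M (structure)
  assumes "module K M" and ne: "C \<noteq> {}" and chain: "subset.chain A C"
    and sub: "\<And>H. H \<in> C \<Longrightarrow> submodule H K M"
  shows "submodule (\<Union>C) K M"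
proof -
  interpret module K M by fact
  note subE = submoduleE[OF sub]
  show ?thesis
  proof (rule submoduleI)
    show "\<zero> \<in> \<Union>C" using ne submodule_zero[OF assms(1) sub] by blast
  next
    fix x y assume "x \<in> \<Union>C" "y \<in> \<Union>C"
    then obtain H H' where H: "H \<in> C" "x \<in> H" "H' \<in> C" "y \<in> H'" by blast
    then have "H \<subseteq> H' \<or> H' \<subseteq> H" using chain by (auto simp: subset.chain_def)
    then show "x \<oplus> y \<in> \<Union>C" using H subE(5) by blast
  qed (use subE in blast)+
qed

text \<open>The enlargement by one vector against which maximality is tested in
  \<open>separating_functional\<close>.\<close>

lemma submodule_extend:
  fixes M (structure)
  assumes "module K M" and H: "submodule H K M" and y: "y \<in> carrier M"
  shows "submodule {h \<oplus> d \<odot> y | h d. h \<in> H \<and> d \<in> carrier K} K M" (is "submodule ?H' K M")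
proof -
  interpret module K M by fact
  note HE = submoduleE[OF H]
  note zero = submodule_zero[OF assms(1) H]
  have HM: "h \<in> carrier M" if "h \<in> H" for h using that HE(1) by blast
  show ?thesis
  proof (rule submoduleI)
    have "\<zero> = \<zero> \<oplus> \<zero>\<^bsub>K\<^esub> \<odot> y" using y by simp
    then show "\<zero> \<in> ?H'" using zero by blast
  next
    fix u assume "u \<in> ?H'"
    then obtain h d where u: "h \<in> H" "d \<in> carrier K" "u = h \<oplus> d \<odot> y" by blast
    then have "\<ominus> u = \<ominus> h \<oplus> (\<ominus>\<^bsub>K\<^esub> d) \<odot> y"
      using y HM by (simp add: smult_l_minus M.minus_add M.a_comm)
    then show "\<ominus> u \<in> ?H'" using u HE(3) by blast
  next
    fix u v assume "u \<in> ?H'" "v \<in> ?H'"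
    then obtain h d h' d' where u: "h \<in> H" "d \<in> carrier K" "u = h \<oplus> d \<odot> y"
      and v: "h' \<in> H" "d' \<in> carrier K" "v = h' \<oplus> d' \<odot> y" by blast
    then have "u \<oplus> v = (h \<oplus> h') \<oplus> (d \<oplus>\<^bsub>K\<^esub> d') \<odot> y"
      using y HM by (simp add: smult_l_distr M.a_ac)
    then show "u \<oplus> v \<in> ?H'" using u v HE(5) by blast
  next
    fix c u assume c: "c \<in> carrier K" and "u \<in> ?H'"
    then obtain h d where u: "h \<in> H" "d \<in> carrier K" "u = h \<oplus> d \<odot> y" by blast
    then have "c \<odot> u = c \<odot> h \<oplus> (c \<otimes>\<^bsub>K\<^esub> d) \<odot> y"
      using y c HM by (simp add: smult_r_distr smult_assoc1)
    then show "c \<odot> u \<in> ?H'" using u c HE(4) by blast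
  qed (use HM y in auto)
qed

text \<open>The target is the field itself, a ring record without scalar multiplication, so
  \<open>linear_map\<close> does not apply and ring multiplication takes the place of
  \<open>smult\<close>.\<close>

definition functional ::
    "('k, 'r) ring_scheme \<Rightarrow> ('k, 'a, 's) module_scheme \<Rightarrow> ('a \<Rightarrow> 'k) \<Rightarrow> bool"
  where "functional K M \<phi> \<longleftrightarrow> \<phi> \<in> carrier M \<rightarrow> carrier K \<and>
    (\<forall>y\<in>carrier M. \<forall>z\<in>carrier M. \<phi> (y \<oplus>\<^bsub>M\<^esub> z) = \<phi> y \<oplus>\<^bsub>K\<^esub> \<phi> z) \<and>
    (\<forall>c\<in>carrier K. \<forall>y\<in>carrier M. \<phi> (c \<odot>\<^bsub>M\<^esub> y) = c \<otimes>\<^bsub>K\<^esub> \<phi> y)"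

text \<open>A submodule \<open>H\<close> maximal among those that contain \<open>N\<close> and miss
  \<open>x\<close> is a complement of the line through \<open>x\<close>. The functional is the
  coordinate along that line. Zorn's lemma supplies \<open>H\<close>, so the argument covers spaces
  of any dimension.\<close>

lemma separating_functional:
  fixes M (structure)
  assumes "field K" and M: "module K M" and N: "submodule N K M" and x: "x \<in> carrier M" "x \<notin> N"
  obtains \<phi> where "functional K M \<phi>"
    and "\<phi> x = \<one>\<^bsub>K\<^esub>" and "\<And>y. y \<in> N \<Longrightarrow> \<phi> y = \<zero>\<^bsub>K\<^esub>"
proof -
  interpret K: field K by fact
  interpret module K M by fact
  let ?A = "{H. submodule H K M \<and> N \<subseteq> H \<and> x \<notin> H}"
  have "\<exists>H\<in>?A. \<forall>H'\<in>?A. H \<subseteq> H' \<longrightarrow> H' = H"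
  proof (rule subset_Zorn_nonempty)
    fix C assume C: "C \<noteq> {}" "subset.chain ?A C"
    then have "C \<subseteq> ?A" by (simp add: subset.chain_def)
    then show "\<Union>C \<in> ?A" using submodule_Union_chain[OF M C] C(1) by blast
  qed (use N x in blast)
  then obtain H where H: "submodule H K M" "N \<subseteq> H" "x \<notin> H"
    and max: "\<And>H'. \<lbrakk>submodule H' K M; N \<subseteq> H'; x \<notin> H'; H \<subseteq> H'\<rbrakk> \<Longrightarrow> H' = H"
    by auto
  note HE = submoduleE[OF H(1)]
  have HM: "h \<in> carrier M" if "h \<in> H" for h using that HE(1) by blast
  note zero = submodule_zero[OF M H(1)]
  have ex: "\<exists>c\<in>carrier K. y \<ominus> c \<odot> x \<in> H" if y: "y \<in> carrier M" for y
  proof (cases "y \<in> H")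
    case True
    then show ?thesis using x y by (intro bexI[of _ "\<zero>\<^bsub>K\<^esub>"]) (auto simp: a_minus_def a_inv_def)
  next
    case False
    let ?H' = "{h \<oplus> d \<odot> y | h d. h \<in> H \<and> d \<in> carrier K}"
    have in_H': "h \<oplus> d \<odot> y \<in> ?H'" if "h \<in> H" "d \<in> carrier K" for h d using that by blast
    have "H \<subseteq> ?H'"
    proof
      fix h assume "h \<in> H"
      then show "h \<in> ?H'" using in_H'[of h "\<zero>\<^bsub>K\<^esub>"] y HM by simp
    qed
    moreover have "y \<in> ?H'" using in_H'[OF zero, of "\<one>\<^bsub>K\<^esub>"] y by simp
    \<comment> \<open>Adjoining a vector outside \<open>H\<close> has to capture \<open>x\<close>,
      by maximality. The equation for \<open>x\<close> can then be solved for \<open>y\<close>,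
      because a zero coefficient at \<open>y\<close> would put \<open>x\<close> into
      \<open>H\<close>.\<close>
    ultimately have "x \<in> ?H'"
      using max[OF submodule_extend[OF M H(1) y]] H(2) False by blast
    then obtain h d where hd: "h \<in> H" "d \<in> carrier K" "x = h \<oplus> d \<odot> y" by blast
    have "d \<noteq> \<zero>\<^bsub>K\<^esub>"
    proof
      assume "d = \<zero>\<^bsub>K\<^esub>"
      then show False using hd y HM H(3) by auto
    qed
    then have inv: "inv\<^bsub>K\<^esub> d \<in> carrier K" "inv\<^bsub>K\<^esub> d \<otimes>\<^bsub>K\<^esub> d = \<one>\<^bsub>K\<^esub>"
      using hd(2) by (auto simp: K.field_Units)
    have "inv\<^bsub>K\<^esub> d \<odot> x = inv\<^bsub>K\<^esub> d \<odot> h \<oplus> y"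
      using hd inv y HM by (simp add: smult_r_distr smult_assoc1[symmetric])
    moreover have "y \<ominus> (u \<oplus> y) = \<ominus> u" if u: "u \<in> carrier M" for u
      using u y M.a_comm[of "\<ominus> u" "\<ominus> y"] by (simp add: M.minus_eq M.minus_add M.a_assoc[symmetric] M.r_neg)
    ultimately have "y \<ominus> inv\<^bsub>K\<^esub> d \<odot> x = \<ominus> (inv\<^bsub>K\<^esub> d \<odot> h)"
      using hd(1) inv(1) HM by simp
    moreover have "\<ominus> (inv\<^bsub>K\<^esub> d \<odot> h) \<in> H" using HE(3,4) inv hd by blast
    ultimately show ?thesis using inv(1) by (intro bexI[of _ "inv\<^bsub>K\<^esub> d"]) simp_all
  qed
  \<comment> \<open>Two different coordinates would put a nonzero multiple of \<open>x\<close>, and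
    hence \<open>x\<close> itself, into \<open>H\<close>.\<close>
  have unique: "c = c'" if c: "c \<in> carrier K" "c' \<in> carrier K"
      "y \<ominus> c \<odot> x \<in> H" "y \<ominus> c' \<odot> x \<in> H" and y: "y \<in> carrier M" for y c c'
  proof (rule ccontr)
    assume "c \<noteq> c'"
    let ?e = "c' \<ominus>\<^bsub>K\<^esub> c"
    have e: "?e \<in> carrier K" "?e \<noteq> \<zero>\<^bsub>K\<^esub>" using c \<open>c \<noteq> c'\<close> by auto
    have cancel: "y \<oplus> (\<ominus> y \<oplus> w) = w" if "w \<in> carrier M" for w
      using that y M.a_assoc[of y "\<ominus> y" w] by (simp add: M.r_neg)
    have "(y \<ominus> c \<odot> x) \<ominus> (y \<ominus> c' \<odot> x) = ?e \<odot> x"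
      using c x y by (simp add: M.minus_eq K.minus_eq smult_l_distr smult_l_minus M.minus_add M.a_ac cancel)
    then have eH: "?e \<odot> x \<in> H" using submodule_minus[OF M H(1) c(3,4)] by simp
    have inv: "inv\<^bsub>K\<^esub> ?e \<in> carrier K" "inv\<^bsub>K\<^esub> ?e \<otimes>\<^bsub>K\<^esub> ?e = \<one>\<^bsub>K\<^esub>"
      using e by (auto simp: K.field_Units)
    show False using HE(4)[OF inv(1) eH] smult_assoc1[OF inv(1) e(1) x(1)] inv(2) x(1) H(3) by simp
  qed
  define \<phi> where "\<phi> y = (THE c. c \<in> carrier K \<and> y \<ominus> c \<odot> x \<in> H)" for y
  have \<phi>_eq: "\<phi> y = c" if "y \<in> carrier M" "c \<in> carrier K" "y \<ominus> c \<odot> x \<in> H" for y c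
    unfolding \<phi>_def using that unique by (intro the_equality) blast+
  have \<phi>: "\<phi> y \<in> carrier K" "y \<ominus> \<phi> y \<odot> x \<in> H" if y: "y \<in> carrier M" for y
    using ex[OF y] \<phi>_eq[OF y] by auto
  have "\<phi> (y \<oplus> z) = \<phi> y \<oplus>\<^bsub>K\<^esub> \<phi> z" if yz: "y \<in> carrier M" "z \<in> carrier M" for y z
  proof -
    have "(y \<oplus> z) \<ominus> (\<phi> y \<oplus>\<^bsub>K\<^esub> \<phi> z) \<odot> x = (y \<ominus> \<phi> y \<odot> x) \<oplus> (z \<ominus> \<phi> z \<odot> x)"
      using yz x \<phi>(1) by (simp add: M.minus_eq smult_l_distr M.minus_add M.a_ac)
    then show ?thesis using yz \<phi> HE(5) by (intro \<phi>_eq) auto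
  qed
  moreover have "\<phi> (c \<odot> y) = c \<otimes>\<^bsub>K\<^esub> \<phi> y" if cy: "c \<in> carrier K" "y \<in> carrier M" for c y
  proof -
    have "c \<odot> y \<ominus> (c \<otimes>\<^bsub>K\<^esub> \<phi> y) \<odot> x = c \<odot> (y \<ominus> \<phi> y \<odot> x)"
      using cy x \<phi>(1) by (simp add: M.minus_eq smult_r_distr smult_r_minus smult_assoc1)
    then show ?thesis using cy \<phi> HE(4) by (intro \<phi>_eq) auto
  qed
  ultimately have "functional K M \<phi>" using \<phi>(1) by (simp add: functional_def)
  moreover have "\<phi> x = \<one>\<^bsub>K\<^esub>" using x zero by (intro \<phi>_eq) (auto simp: M.minus_eq M.r_neg)
  moreover have "\<phi> y = \<zero>\<^bsub>K\<^esub>" if "y \<in> N" for y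
    using that x H(2) HM by (intro \<phi>_eq) (auto simp: a_minus_def a_inv_def)
  ultimately show thesis by (rule that)
qed

text \<open>Independence keeps \<open>a i\<close> out of the span of the other vectors, so the two
  can be separated.\<close>

lemma dual_functional:
  fixes M (structure)
  assumes "field K" and M: "module K M" and J: "finite J" "a \<in> J \<rightarrow> carrier M"
    and indep: "lin_indep K M J a" and i: "i \<in> J"
  obtains \<phi> where "functional K M \<phi>"
    and "\<And>j. j \<in> J \<Longrightarrow> \<phi> (a j) = (if j = i then \<one>\<^bsub>K\<^esub> else \<zero>\<^bsub>K\<^esub>)"
proof -
  interpret K: field K by fact
  interpret module K M by fact
  let ?I = "J - {i}"
  let ?s = "\<lambda>c. \<Oplus>j\<in>?I. c j \<odot> a j"
  let ?L = "free_lift K M a" and ?F = "free_module K ?I"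
  let ?N = "?L ` carrier ?F"
  have a_I: "a \<in> ?I \<rightarrow> carrier M" using J by blast
  have sub: "submodule ?N K M"
    by (rule submodule_range[OF module_free_module[OF K.is_cring] M linear_map_free_lift[OF M a_I]])
  have L_eq: "?L c = ?s c" if "c \<in> carrier ?F" for c
    using that J(1) by (intro free_lift_superset[OF M a_I that]) (auto simp: in_free_module_iff)
  have aM: "a j \<in> carrier M" if "j \<in> J" for j using that J by blast
  have "a i \<notin> ?N"
  proof
    assume "a i \<in> ?N"
    then obtain c where "c \<in> carrier ?F" and "a i = ?L c" by blast
    then have c: "c \<in> ?I \<rightarrow> carrier K" "a i = ?s c" using L_eq by (auto simp: in_free_module_iff)
    \<comment> \<open>Moving \<open>a i\<close> to the other side gives a relation among all the
      vectors whose coefficient at \<open>i\<close> is \<open>-1\<close>.\<close>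
    let ?c = "c(i := \<ominus>\<^bsub>K\<^esub> \<one>\<^bsub>K\<^esub>)"
    have "(\<Oplus>j\<in>J. ?c j \<odot> a j) = (\<Oplus>j\<in>insert i ?I. ?c j \<odot> a j)"
      using i by (simp add: insert_absorb)
    also have "\<dots> = ?c i \<odot> a i \<oplus> (\<Oplus>j\<in>?I. ?c j \<odot> a j)"
      using J(1) c(1) aM i by (intro M.finsum_insert) (auto simp: Pi_iff)
    also have "(\<Oplus>j\<in>?I. ?c j \<odot> a j) = ?s c"
      using c(1) a_I by (intro M.finsum_cong') (auto simp: Pi_iff)
    also have "?c i \<odot> a i \<oplus> ?s c = \<zero>"
      unfolding c(2)[symmetric] using aM[OF i] by (simp add: smult_l_minus M.l_neg)
    finally have "?c i = \<zero>\<^bsub>K\<^esub>"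
      using indep c(1) i unfolding lin_indep_def by (auto dest!: bspec[of _ _ ?c])
    then show False by simp
  qed
  then obtain \<phi> where \<phi>: "functional K M \<phi>"
    "\<phi> (a i) = \<one>\<^bsub>K\<^esub>" "\<And>y. y \<in> ?N \<Longrightarrow> \<phi> y = \<zero>\<^bsub>K\<^esub>"
    using separating_functional[OF assms(1) M sub aM[OF i]] by blast
  have "a j \<in> ?N" if j: "j \<in> J" "j \<noteq> i" for j
    using j free_lift_free_gen[OF M a_I, of j] free_gen_in_free_module[OF K.is_cring, of j ?I]
    by (auto intro: image_eqI[OF sym])
  then show thesis using that[of \<phi>] \<phi> by auto
qed

section \<open>Sums of values of a bilinear map\<close>

text \<open>A dependency eliminates one \<open>a i\<close>: its contribution is moved onto the
  second factors of the other summands. The correction changes the total by a multiple of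
  \<open>h\<close> applied to the vanishing combination of the \<open>a j\<close>, that is, by zero.
  An arbitrary bilinear \<open>h\<close> lets the same lemma shrink either side of a tensor.\<close>

lemma bilinear_sum_shrink:
  fixes P (structure)
  assumes "field K" and M: "module K M" and N: "module K N" and P: "module K P"
    and h: "bilinear_map K M N P h" and J: "finite J" "a \<in> J \<rightarrow> carrier M" "b \<in> J \<rightarrow> carrier N"
    and dep: "\<not> lin_indep K M J a"
  obtains i b' where "i \<in> J" and "b' \<in> J \<rightarrow> carrier N"
    and "(\<Oplus>j\<in>J. h (a j) (b j)) = (\<Oplus>j\<in>J - {i}. h (a j) (b' j))"
proof -
  interpret K: field K by fact
  interpret M: module K M by fact
  interpret N: module K N by fact
  interpret P: module K P by fact
  note hl = linear_mapD[OF bilinear_mapD(2)[OF h]] and hr = linear_mapD[OF bilinear_mapD(1)[OF h]]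
  obtain c i where c: "c \<in> J \<rightarrow> carrier K" "(\<Oplus>\<^bsub>M\<^esub>j\<in>J. c j \<odot>\<^bsub>M\<^esub> a j) = \<zero>\<^bsub>M\<^esub>"
    and i: "i \<in> J" "c i \<noteq> \<zero>\<^bsub>K\<^esub>"
    using dep unfolding lin_indep_def by blast
  have ci: "inv\<^bsub>K\<^esub> c i \<in> carrier K" "inv\<^bsub>K\<^esub> c i \<otimes>\<^bsub>K\<^esub> c i = \<one>\<^bsub>K\<^esub>"
    using i c(1) by (auto simp: K.field_Units Pi_iff)
  \<comment> \<open>Chosen so that the corrected factor at \<open>i\<close> is
    \<open>b i - b i\<close>, which makes the summand at \<open>i\<close> vanish.\<close>
  define d where "d = \<ominus>\<^bsub>K\<^esub> (inv\<^bsub>K\<^esub> c i)"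
  have d: "d \<in> carrier K" "d \<otimes>\<^bsub>K\<^esub> c i = \<ominus>\<^bsub>K\<^esub> \<one>\<^bsub>K\<^esub>"
    using ci i c(1) by (auto simp: d_def K.l_minus Pi_iff)
  let ?b' = "\<lambda>j. b j \<oplus>\<^bsub>N\<^esub> (d \<otimes>\<^bsub>K\<^esub> c j) \<odot>\<^bsub>N\<^esub> b i"
  have aM: "a j \<in> carrier M" and bN: "b j \<in> carrier N" and cK: "c j \<in> carrier K" if "j \<in> J" for j
    using that J c(1) by auto
  have b': "?b' j \<in> carrier N" if "j \<in> J" for j using that i d(1) bN cK by simp
  have "?b' i = \<zero>\<^bsub>N\<^esub>" using d i bN[OF i(1)] by (simp add: N.smult_l_minus N.M.r_neg)
  then have zero: "h (a i) (?b' i) = \<zero>"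
    using linear_map_zero[OF N P bilinear_mapD(1)[OF h]] aM[OF i(1)] by simp
  have "(\<Oplus>j\<in>J. h (c j \<odot>\<^bsub>M\<^esub> a j) (b i)) = h (\<Oplus>\<^bsub>M\<^esub>j\<in>J. c j \<odot>\<^bsub>M\<^esub> a j) (b i)"
    using J(1) aM cK bN[OF i(1)] by (intro linear_map_finsum[OF M P bilinear_mapD(2)[OF h], symmetric]) auto
  also have "\<dots> = \<zero>"
    unfolding c(2) by (rule linear_map_zero[OF M P bilinear_mapD(2)[OF h bN[OF i(1)]]])
  finally have dep_sum: "(\<Oplus>j\<in>J. h (c j \<odot>\<^bsub>M\<^esub> a j) (b i)) = \<zero>" .
  have "(\<Oplus>j\<in>J. h (a j) (?b' j)) =
      (\<Oplus>j\<in>J. h (a j) (b j) \<oplus> d \<odot> h (c j \<odot>\<^bsub>M\<^esub> a j) (b i))"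
    using aM bN cK d(1) i(1)
    by (intro P.M.finsum_cong') (auto simp: hl hr P.smult_assoc1)
  also have "\<dots> = (\<Oplus>j\<in>J. h (a j) (b j)) \<oplus> (\<Oplus>j\<in>J. d \<odot> h (c j \<odot>\<^bsub>M\<^esub> a j) (b i))"
    using aM bN cK d(1) i(1) by (intro P.M.finsum_addf) (auto simp: hr)
  also have "(\<Oplus>j\<in>J. d \<odot> h (c j \<odot>\<^bsub>M\<^esub> a j) (b i))
      = d \<odot> (\<Oplus>j\<in>J. h (c j \<odot>\<^bsub>M\<^esub> a j) (b i))"
    using J(1) aM bN cK d(1) i(1) by (intro P.finsum_smult_ldistr[symmetric]) (auto simp: hr)
  also have "(\<Oplus>j\<in>J. h (a j) (b j)) \<oplus> \<dots> = (\<Oplus>j\<in>J. h (a j) (b j))"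
    using aM bN d(1) by (simp add: dep_sum hr Pi_iff)
  finally have "(\<Oplus>j\<in>J. h (a j) (b j)) = (\<Oplus>j\<in>J. h (a j) (?b' j))" ..
  also have "\<dots> = (\<Oplus>j\<in>J - {i}. h (a j) (?b' j))"
    using J(1) aM b' zero by (intro P.M.add.finprod_mono_neutral_cong_right) (auto simp: hr)
  finally show thesis using that[of i ?b'] i(1) b' by blast
qed

text \<open>The bilinear map \<open>\<phi> x \<odot> y\<close>, with \<open>\<phi>\<close> dual to
  \<open>a i\<close>, collapses the sum to \<open>b i\<close>. Quantifying over bilinear maps keeps
  the statement free of tensors, so it applies to both factors.\<close>

lemma indep_bilinear_sum_zero:
  fixes N (structure)
  assumes "field K" and M: "module K M" and N: "module K N"
    and J: "finite J" "a \<in> J \<rightarrow> carrier M" "b \<in> J \<rightarrow> carrier N"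
    and indep: "lin_indep K M J a" and i: "i \<in> J"
    and zero: "\<And>h. bilinear_map K M N N h \<Longrightarrow> (\<Oplus>j\<in>J. h (a j) (b j)) = \<zero>"
  shows "b i = \<zero>"
proof -
  interpret M: module K M by fact
  interpret N: module K N by fact
  obtain \<phi> where \<phi>: "functional K M \<phi>"
    "\<And>j. j \<in> J \<Longrightarrow> \<phi> (a j) = (if j = i then \<one>\<^bsub>K\<^esub> else \<zero>\<^bsub>K\<^esub>)"
    using dual_functional[OF assms(1) M J(1,2) indep i] by blast
  have "bilinear_map K M N N (\<lambda>x y. \<phi> x \<odot> y)"
    using \<phi>(1) by (intro bilinear_mapI linear_mapI)
      (auto simp: functional_def Pi_iff N.smult_r_distr N.smult_l_distr N.smult_assoc1[symmetric] M.R.m_comm)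
  then have "\<zero> = (\<Oplus>j\<in>J. \<phi> (a j) \<odot> b j)" by (rule zero[symmetric])
  also have "\<dots> = (\<Oplus>j\<in>J. if i = j then b j else \<zero>)"
    using J by (intro N.M.finsum_cong') (auto simp: \<phi>(2) Pi_iff)
  also have "\<dots> = b i" using J i by (intro N.M.finsum_singleton) auto
  finally show ?thesis by simp
qed

lemma module_eq_iff_minus:
  fixes M (structure)
  assumes "module K M" and "x \<in> carrier M" and "y \<in> carrier M"
  shows "x = y \<longleftrightarrow> x \<ominus> y = \<zero>"
proof -
  interpret module K M by fact
  show ?thesis
    using assms(2,3) M.add.inv_solve_right[of "\<zero>" x y] by (auto simp: M.minus_eq)
qed

lemma bilinear_sum_minus:
  fixes P (structure)
  assumes M: "module K M" and P: "module K P" and h: "bilinear_map K M N P h"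
    and J: "finite J" "a \<in> J \<rightarrow> carrier M" "a' \<in> J \<rightarrow> carrier M" "b \<in> J \<rightarrow> carrier N"
    and eq: "(\<Oplus>j\<in>J. h (a j) (b j)) = (\<Oplus>j\<in>J. h (a' j) (b j))"
  shows "(\<Oplus>j\<in>J. h (a j \<ominus>\<^bsub>M\<^esub> a' j) (b j)) = \<zero>"
proof -
  interpret M: module K M by fact
  interpret P: module K P by fact
  note hl = linear_mapD(1)[OF bilinear_mapD(2)[OF h]] linear_map_minus[OF M P bilinear_mapD(2)[OF h]]
  let ?d = "\<lambda>j. h (a j \<ominus>\<^bsub>M\<^esub> a' j) (b j)"
  have d: "?d \<in> J \<rightarrow> carrier P" and h_in: "(\<lambda>j. h (a j) (b j)) \<in> J \<rightarrow> carrier P"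
    "(\<lambda>j. h (a' j) (b j)) \<in> J \<rightarrow> carrier P" using J hl(1) by (auto simp: Pi_iff)
  have "(\<Oplus>j\<in>J. ?d j) \<oplus> (\<Oplus>j\<in>J. h (a' j) (b j)) = (\<Oplus>j\<in>J. ?d j \<oplus> h (a' j) (b j))"
    by (rule P.M.finsum_addf[OF d h_in(2), symmetric])
  also have "\<dots> = (\<Oplus>j\<in>J. h (a j) (b j))"
    using J h_in by (intro P.M.finsum_cong')
      (auto simp: Pi_iff hl(2) P.M.minus_eq P.M.a_assoc P.M.l_neg)
  finally show ?thesis
    unfolding eq using P.M.finsum_closed[OF d] P.M.finsum_closed[OF h_in(2)] by simp
qed

section \<open>Tensors with independent factors\<close>

context tensor_product
begin

text \<open>Every bilinear map factors linearly through the tensor product, so a relation among pure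
  tensors may be tested on any of them.\<close>

lemma tensor_sum_zero_bilinear:
  assumes "module K P" and h: "bilinear_map K M N P h"
    and J: "finite J" "a \<in> J \<rightarrow> carrier M" "b \<in> J \<rightarrow> carrier N"
    and sum: "(\<Oplus>\<^bsub>T\<^esub>j\<in>J. a j \<otimes>t b j) = \<zero>\<^bsub>T\<^esub>"
  shows "(\<Oplus>\<^bsub>P\<^esub>j\<in>J. h (a j) (b j)) = \<zero>\<^bsub>P\<^esub>"
proof -
  interpret P: module K P by fact
  obtain \<psi> where \<psi>: "linear_map K T P \<psi>"
    "\<And>x y. \<lbrakk>x \<in> carrier M; y \<in> carrier N\<rbrakk> \<Longrightarrow> \<psi> (x \<otimes>t y) = h x y"
    using tensor_lift_exists[OF assms(1) h] by blast
  have "\<zero>\<^bsub>P\<^esub> = \<psi> (\<Oplus>\<^bsub>T\<^esub>j\<in>J. a j \<otimes>t b j)"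
    unfolding sum by (rule linear_map_zero[OF T.module_axioms assms(1) \<psi>(1), symmetric])
  also have "\<dots> = (\<Oplus>\<^bsub>P\<^esub>j\<in>J. \<psi> (a j \<otimes>t b j))"
    using J by (intro linear_map_finsum[OF T.module_axioms assms(1) \<psi>(1)]) auto
  also have "\<dots> = (\<Oplus>\<^bsub>P\<^esub>j\<in>J. h (a j) (b j))"
    using J linear_mapD(1)[OF bilinear_mapD(1)[OF h]] by (intro P.M.finsum_cong') (auto simp: \<psi>(2) Pi_iff)
  finally show ?thesis ..
qed

lemma indep_tensor_sum_zero_left:
  assumes "field K" and J: "finite J" "a \<in> J \<rightarrow> carrier M" "b \<in> J \<rightarrow> carrier N"
    and "lin_indep K M J a" and "(\<Oplus>\<^bsub>T\<^esub>j\<in>J. a j \<otimes>t b j) = \<zero>\<^bsub>T\<^esub>" and "i \<in> J"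
  shows "b i = \<zero>\<^bsub>N\<^esub>"
  using tensor_sum_zero_bilinear[OF N.module_axioms _ J assms(6)]
  by (intro indep_bilinear_sum_zero[OF assms(1) M.module_axioms N.module_axioms J assms(5,7)])

lemma indep_tensor_sum_zero_right:
  assumes "field K" and J: "finite J" "a \<in> J \<rightarrow> carrier M" "b \<in> J \<rightarrow> carrier N"
    and "lin_indep K N J b" and "(\<Oplus>\<^bsub>T\<^esub>j\<in>J. a j \<otimes>t b j) = \<zero>\<^bsub>T\<^esub>" and "i \<in> J"
  shows "a i = \<zero>\<^bsub>M\<^esub>"
proof (rule indep_bilinear_sum_zero[OF assms(1) N.module_axioms M.module_axioms J(1,3,2) assms(5,7)])
  fix h assume "bilinear_map K N M M h"
  then have "bilinear_map K M N M (\<lambda>x y. h y x)" unfolding bilinear_map_def by blast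
  from tensor_sum_zero_bilinear[OF M.module_axioms this J assms(6)]
  show "(\<Oplus>\<^bsub>M\<^esub>j\<in>J. h (b j) (a j)) = \<zero>\<^bsub>M\<^esub>" .
qed

text \<open>Comparison of coefficients: the form in which a commutation property of a tensor
  descends to its factors.\<close>

lemma indep_tensor_sum_eq_left:
  assumes "field K" and J: "finite J" "a \<in> J \<rightarrow> carrier M" "a' \<in> J \<rightarrow> carrier M" "b \<in> J \<rightarrow> carrier N"
    and indep: "lin_indep K N J b"
    and eq: "(\<Oplus>\<^bsub>T\<^esub>j\<in>J. a j \<otimes>t b j) = (\<Oplus>\<^bsub>T\<^esub>j\<in>J. a' j \<otimes>t b j)" and i: "i \<in> J"
  shows "a i = a' i"
proof -
  have "a i \<ominus>\<^bsub>M\<^esub> a' i = \<zero>\<^bsub>M\<^esub>"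
    using bilinear_sum_minus[OF M.module_axioms T.module_axioms bilinear_pure J eq] J
    by (intro indep_tensor_sum_zero_right[OF assms(1) J(1) _ J(4) indep _ i, of "\<lambda>j. a j \<ominus>\<^bsub>M\<^esub> a' j"]) auto
  then show ?thesis using module_eq_iff_minus[OF M.module_axioms] J i by blast
qed

lemma indep_tensor_sum_eq_right:
  assumes "field K" and J: "finite J" "a \<in> J \<rightarrow> carrier M" "b \<in> J \<rightarrow> carrier N" "b' \<in> J \<rightarrow> carrier N"
    and indep: "lin_indep K M J a"
    and eq: "(\<Oplus>\<^bsub>T\<^esub>j\<in>J. a j \<otimes>t b j) = (\<Oplus>\<^bsub>T\<^esub>j\<in>J. a j \<otimes>t b' j)" and i: "i \<in> J"
  shows "b i = b' i"
proof -
  have "bilinear_map K N M T (\<lambda>y x. x \<otimes>t y)"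
    using bilinear_pure unfolding bilinear_map_def by blast
  from bilinear_sum_minus[OF N.module_axioms T.module_axioms this J(1,3,4,2) eq]
  have "b i \<ominus>\<^bsub>N\<^esub> b' i = \<zero>\<^bsub>N\<^esub>"
    using J by (intro indep_tensor_sum_zero_left[OF assms(1) J(1,2) _ indep _ i, of "\<lambda>j. b j \<ominus>\<^bsub>N\<^esub> b' j"]) auto
  then show ?thesis using module_eq_iff_minus[OF N.module_axioms] J i by blast
qed

text \<open>A representation with the fewest summands has both families of factors independent.\<close>

lemma tensor_indep_sum:
  assumes "field K" and t: "t \<in> carrier T"
  obtains J :: "nat set" and a b where "finite J" and "a \<in> J \<rightarrow> carrier M" and "b \<in> J \<rightarrow> carrier N"
    and "t = (\<Oplus>\<^bsub>T\<^esub>j\<in>J. a j \<otimes>t b j)" and "lin_indep K M J a" and "lin_indep K N J b"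
proof -
  let ?Q = "\<lambda>n. \<exists>J a b. finite (J :: nat set) \<and> card J = n \<and> a \<in> J \<rightarrow> carrier M \<and>
    b \<in> J \<rightarrow> carrier N \<and> t = (\<Oplus>\<^bsub>T\<^esub>j\<in>J. a j \<otimes>t b j)"
  define n where "n = (LEAST n. ?Q n)"
  have "\<exists>n. ?Q n" using tensor_sum_pure[OF t] by blast
  then have "?Q n" unfolding n_def by (rule LeastI_ex)
  then obtain J a b where J: "finite (J :: nat set)" "a \<in> J \<rightarrow> carrier M" "b \<in> J \<rightarrow> carrier N"
    and card: "card J = n" and t_eq: "t = (\<Oplus>\<^bsub>T\<^esub>j\<in>J. a j \<otimes>t b j)" by blast
  have min: "\<not> ?Q m" if "m < n" for m using that not_less_Least unfolding n_def by blast
  have less: "card (J - {i}) < n" if "i \<in> J" for i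
    using that J(1) card by (metis card_Diff1_less)
  have "lin_indep K M J a"
  proof (rule ccontr)
    assume "\<not> lin_indep K M J a"
    from bilinear_sum_shrink[OF assms(1) M.module_axioms N.module_axioms T.module_axioms bilinear_pure J this]
    obtain i b' where i: "i \<in> J" and b': "b' \<in> J \<rightarrow> carrier N"
      and eq: "t = (\<Oplus>\<^bsub>T\<^esub>j\<in>J - {i}. a j \<otimes>t b' j)"
      unfolding t_eq by blast
    have "a \<in> J - {i} \<rightarrow> carrier M" "b' \<in> J - {i} \<rightarrow> carrier N" using J b' by auto
    then show False using min[OF less[OF i]] J(1) eq by blast
  qed
  moreover have "lin_indep K N J b"
  proof (rule ccontr)
    assume dep: "\<not> lin_indep K N J b"
    have "bilinear_map K N M T (\<lambda>y x. x \<otimes>t y)"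
      using bilinear_pure unfolding bilinear_map_def by blast
    from bilinear_sum_shrink[OF assms(1) N.module_axioms M.module_axioms T.module_axioms this J(1,3,2) dep]
    obtain i a' where i: "i \<in> J" and a': "a' \<in> J \<rightarrow> carrier M"
      and eq: "t = (\<Oplus>\<^bsub>T\<^esub>j\<in>J - {i}. a' j \<otimes>t b j)"
      unfolding t_eq by blast
    have "a' \<in> J - {i} \<rightarrow> carrier M" "b \<in> J - {i} \<rightarrow> carrier N" using J a' by auto
    then show False using min[OF less[OF i]] J(1) eq by blast
  qed
  ultimately show thesis using that J t_eq by blast
qed

end


section \<open>Linear categories and functors\<close>

lemma hom_module_simps [simp]:
  "carrier (hom_module C x y) = Hom C x y"
  "\<zero>\<^bsub>hom_module C x y\<^esub> = Zero_ar C x y"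
  "f \<oplus>\<^bsub>hom_module C x y\<^esub> g = Add_ar C f g"
  "c \<odot>\<^bsub>hom_module C x y\<^esub> f = Scale_ar C c f"
  by (simp_all add: hom_module_def)

text \<open>The arrows from \<open>x\<close> to \<open>y\<close> in the two-sided ideal generated by
  the identity of \<open>P\<close>. Scalars and the zero arrow are already produced by composites
  through \<open>P\<close>.\<close>

inductive_set through ::
    "('k, 'o, 'm, 'z) lincat_scheme \<Rightarrow> 'o \<Rightarrow> 'o \<Rightarrow> 'o \<Rightarrow> 'm set"
  for C P x y
  where
    Comp: "\<lbrakk>f \<in> Hom C P y; g \<in> Hom C x P\<rbrakk> \<Longrightarrow> f \<bullet>\<^bsub>C\<^esub> g \<in> through C P x y"
  | Add: "\<lbrakk>f \<in> through C P x y; g \<in> through C P x y\<rbrakk> \<Longrightarrow> Add_ar C f g \<in> through C P x y"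

text \<open>In the presence of direct sums this says that every object is a retract of a finite sum
  of copies of \<open>P\<close>. The ideal formulation makes sense without such sums.\<close>

definition is_generator :: "('k, 'o, 'm, 'z) lincat_scheme \<Rightarrow> 'o \<Rightarrow> bool"
  where "is_generator C P \<longleftrightarrow> P \<in> Ob C \<and> (\<forall>x\<in>Ob C. Ident C x \<in> through C P x x)"

lemma (in category) Hom_Ob: "f \<in> Hom C x y \<Longrightarrow> x \<in> Ob C" "f \<in> Hom C x y \<Longrightarrow> y \<in> Ob C"
  using Dom_in_Ob Cod_in_Ob by (auto simp: Hom_def)

context linear_category
begin

lemma hom_module: "f \<in> Hom C x y \<Longrightarrow> module K (hom_module C x y)"
  by (intro hom_is_module) (simp_all add: Hom_Ob)

lemma Zero_in_Hom: "\<lbrakk>x \<in> Ob C; y \<in> Ob C\<rbrakk> \<Longrightarrow> Zero_ar C x y \<in> Hom C x y"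
  using abelian_monoid.zero_closed[OF abelian_group.axioms(1)[OF module.axioms(2)[OF hom_is_module]]]
  by simp

lemma Add_in_Hom: "\<lbrakk>f \<in> Hom C x y; g \<in> Hom C x y\<rbrakk> \<Longrightarrow> Add_ar C f g \<in> Hom C x y"
  using abelian_monoid.a_closed[OF abelian_group.axioms(1)[OF module.axioms(2)[OF hom_module]], of f x y f g]
  by simp

lemma Scale_in_Hom: "\<lbrakk>c \<in> carrier K; f \<in> Hom C x y\<rbrakk> \<Longrightarrow> Scale_ar C c f \<in> Hom C x y"
  using module.smult_closed[OF hom_module, of f x y c f] by simp

lemma Comp_Add_right:
  "\<lbrakk>g \<in> Hom C y z; f \<in> Hom C x y; f' \<in> Hom C x y\<rbrakk> \<Longrightarrow> g \<bullet> Add_ar C f f' = Add_ar C (g \<bullet> f) (g \<bullet> f')"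
  using linear_mapD(2)[OF Comp_linear_right, of x g y z f f'] by (simp add: Hom_Ob)

lemma Comp_Add_left:
  "\<lbrakk>g \<in> Hom C y z; g' \<in> Hom C y z; f \<in> Hom C x y\<rbrakk> \<Longrightarrow> Add_ar C g g' \<bullet> f = Add_ar C (g \<bullet> f) (g' \<bullet> f)"
  using linear_mapD(2)[OF Comp_linear_left, of z f x y g g'] by (simp add: Hom_Ob)

lemma Comp_Scale_right:
  "\<lbrakk>c \<in> carrier K; g \<in> Hom C y z; f \<in> Hom C x y\<rbrakk> \<Longrightarrow> g \<bullet> Scale_ar C c f = Scale_ar C c (g \<bullet> f)"
  using linear_mapD(3)[OF Comp_linear_right, of x g y z c f] by (simp add: Hom_Ob)

lemma Comp_Scale_left:
  "\<lbrakk>c \<in> carrier K; g \<in> Hom C y z; f \<in> Hom C x y\<rbrakk> \<Longrightarrow> Scale_ar C c g \<bullet> f = Scale_ar C c (g \<bullet> f)"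
  using linear_mapD(3)[OF Comp_linear_left, of z f x y c g] by (simp add: Hom_Ob)

lemma Comp_Zero_right: "\<lbrakk>x \<in> Ob C; g \<in> Hom C y z\<rbrakk> \<Longrightarrow> g \<bullet> Zero_ar C x y = Zero_ar C x z"
  using linear_map_zero[OF hom_is_module hom_is_module Comp_linear_right, of x y z g] by (simp add: Hom_Ob)

lemma Comp_Zero_left: "\<lbrakk>z \<in> Ob C; f \<in> Hom C x y\<rbrakk> \<Longrightarrow> Zero_ar C y z \<bullet> f = Zero_ar C x z"
  using linear_map_zero[OF hom_is_module hom_is_module Comp_linear_left, of y z x f] by (simp add: Hom_Ob)

lemma through_in_Hom: "h \<in> through C P x y \<Longrightarrow> h \<in> Hom C x y"
  by (induction rule: through.induct) (auto intro: Comp_in_Hom Add_in_Hom)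

lemma through_finsum:
  assumes "P \<in> Ob C" and "x \<in> Ob C" and "y \<in> Ob C" and "finite J"
    and "\<And>j. j \<in> J \<Longrightarrow> e j \<in> through C P x y"
  shows "(\<Oplus>\<^bsub>hom_module C x y\<^esub>j\<in>J. e j) \<in> through C P x y"
proof -
  interpret H: module K "hom_module C x y" by (rule hom_is_module) fact+
  show ?thesis using assms(4,5)
  proof (induction J rule: finite_induct)
    case empty
    \<comment> \<open>The clauses of \<open>through\<close> do not mention zero, so the empty sum is
      exhibited as a composite of two zero arrows through \<open>P\<close>.\<close>
    have "Zero_ar C P y \<bullet> Zero_ar C x P \<in> through C P x y"
      using assms by (intro through.Comp Zero_in_Hom)
    then show ?case using assms by (simp add: Comp_Zero_left[OF assms(3) Zero_in_Hom[OF assms(2,1)]])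
  next
    case (insert j J)
    have "e \<in> J \<rightarrow> Hom C x y" "e j \<in> Hom C x y" using insert.prems[THEN through_in_Hom] by auto
    then have "(\<Oplus>\<^bsub>hom_module C x y\<^esub>j\<in>insert j J. e j) =
        Add_ar C (e j) (\<Oplus>\<^bsub>hom_module C x y\<^esub>j\<in>J. e j)"
      using insert.hyps H.M.finsum_insert[of J j e] by simp
    then show ?case using insert by (auto intro: through.Add)
  qed
qed

text \<open>Composition is additive, so agreement on arrows out of \<open>P\<close> gives agreement
  after composing with any sum of arrows through \<open>P\<close>, and the identity of
  \<open>x\<close> is such a sum.\<close>

lemma generator_separates:
  assumes P: "is_generator C P" and h: "h \<in> Hom C x y" "h' \<in> Hom C x y"
    and eq: "\<And>i. i \<in> Hom C P x \<Longrightarrow> h \<bullet> i = h' \<bullet> i"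
  shows "h = h'"
proof -
  have "h \<bullet> e = h' \<bullet> e" if "e \<in> through C P x x" for e
    using that
  proof (induction rule: through.induct)
    case (Comp f g)
    then show ?case using h eq by (simp flip: Comp_assoc)
  next
    case (Add f g)
    note fg = through_in_Hom[OF Add(1)] through_in_Hom[OF Add(2)]
    show ?case using Add.IH by (simp add: Comp_Add_right[OF h(1) fg] Comp_Add_right[OF h(2) fg])
  qed
  moreover have "Ident C x \<in> through C P x x"
    using P h(1) Hom_Ob unfolding is_generator_def by blast
  ultimately show ?thesis using h Comp_Ident_right by metis
qed

end

section \<open>Natural transformations from the identity to a linear endofunctor\<close>

locale linear_endofunctor = linear_category K C
  for K :: "('k, 'r) ring_scheme" and C :: "('k, 'o, 'm, 'z) lincat_scheme" (structure) +
  fixes Fo :: "'o \<Rightarrow> 'o" and Fa :: "'m \<Rightarrow> 'm"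
  assumes F_Ob: "x \<in> Ob C \<Longrightarrow> Fo x \<in> Ob C"
    and F_Hom: "f \<in> Hom C x y \<Longrightarrow> Fa f \<in> Hom C (Fo x) (Fo y)"
    and F_Ident: "x \<in> Ob C \<Longrightarrow> Fa (Ident C x) = Ident C (Fo x)"
    and F_Comp: "\<lbrakk>g \<in> Hom C y z; f \<in> Hom C x y\<rbrakk> \<Longrightarrow> Fa (g \<bullet> f) = Fa g \<bullet> Fa f"
    and F_linear: "\<lbrakk>x \<in> Ob C; y \<in> Ob C\<rbrakk> \<Longrightarrow>
      linear_map K (hom_module C x y) (hom_module C (Fo x) (Fo y)) Fa"
begin

lemma F_Add: "\<lbrakk>f \<in> Hom C x y; g \<in> Hom C x y\<rbrakk> \<Longrightarrow> Fa (Add_ar C f g) = Add_ar C (Fa f) (Fa g)"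
  using linear_mapD(2)[OF F_linear, of x y f g] by (simp add: Hom_Ob)

lemma F_Zero: "\<lbrakk>x \<in> Ob C; y \<in> Ob C\<rbrakk> \<Longrightarrow> Fa (Zero_ar C x y) = Zero_ar C (Fo x) (Fo y)"
  using linear_map_zero[OF hom_is_module hom_is_module F_linear, of x y] by (simp add: F_Ob)

text \<open>For the action of \<open>g\<close> this is \<open>two_character\<close>. The general
  form also covers the naive tensor product, for which only a linear category and an endofunctor are
  established.\<close>

abbreviation nt :: "('k, 'o \<Rightarrow> 'm) module"
  where "nt \<equiv> nat_module C C (id, id) (Fo, Fa)"

lemma nt_simps:
  "\<zero>\<^bsub>nt\<^esub> = (\<lambda>x\<in>Ob C. Zero_ar C x (Fo x))"
  "\<eta> \<oplus>\<^bsub>nt\<^esub> \<theta> = (\<lambda>x\<in>Ob C. Add_ar C (\<eta> x) (\<theta> x))"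
  "c \<odot>\<^bsub>nt\<^esub> \<eta> = (\<lambda>x\<in>Ob C. Scale_ar C c (\<eta> x))"
  by (simp_all add: nat_module_def)

lemma in_nt_iff:
  "\<eta> \<in> carrier nt \<longleftrightarrow> \<eta> \<in> extensional (Ob C) \<and> (\<forall>x\<in>Ob C. \<eta> x \<in> Hom C x (Fo x)) \<and>
    (\<forall>x y. \<forall>f\<in>Hom C x y. Fa f \<bullet> \<eta> x = \<eta> y \<bullet> f)"
  by (auto simp: nat_module_def PiE_iff Hom_def)

lemma ntI:
  assumes "\<eta> \<in> extensional (Ob C)" and "\<And>x. x \<in> Ob C \<Longrightarrow> \<eta> x \<in> Hom C x (Fo x)"
    and "\<And>x y f. f \<in> Hom C x y \<Longrightarrow> Fa f \<bullet> \<eta> x = \<eta> y \<bullet> f"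
  shows "\<eta> \<in> carrier nt"
  using assms by (simp add: in_nt_iff)

lemma ntD:
  assumes "\<eta> \<in> carrier nt"
  shows "\<eta> \<in> extensional (Ob C)" and "x \<in> Ob C \<Longrightarrow> \<eta> x \<in> Hom C x (Fo x)"
    and "f \<in> Hom C x y \<Longrightarrow> Fa f \<bullet> \<eta> x = \<eta> y \<bullet> f"
  using assms by (simp_all add: in_nt_iff)

lemma nt_eqI:
  assumes "\<eta> \<in> carrier nt" and "\<theta> \<in> carrier nt" and "\<And>x. x \<in> Ob C \<Longrightarrow> \<eta> x = \<theta> x"
  shows "\<eta> = \<theta>"
  using assms ntD(1) by (intro extensionalityI[of _ "Ob C"]) auto

lemma nt_add_closed:
  assumes "\<eta> \<in> carrier nt" and "\<theta> \<in> carrier nt"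
  shows "\<eta> \<oplus>\<^bsub>nt\<^esub> \<theta> \<in> carrier nt"
proof (rule ntI)
  fix x y f assume f: "f \<in> Hom C x y"
  then have xy: "x \<in> Ob C" "y \<in> Ob C" by (auto dest: Hom_Ob)
  then show "Fa f \<bullet> (\<eta> \<oplus>\<^bsub>nt\<^esub> \<theta>) x = (\<eta> \<oplus>\<^bsub>nt\<^esub> \<theta>) y \<bullet> f"
    by (simp add: nt_simps Comp_Add_right[OF F_Hom[OF f] ntD(2)[OF assms(1)] ntD(2)[OF assms(2)]]
        Comp_Add_left[OF ntD(2)[OF assms(1)] ntD(2)[OF assms(2)] f]
        ntD(3)[OF assms(1) f] ntD(3)[OF assms(2) f])
qed (auto simp: nt_simps ntD(2)[OF assms(1)] ntD(2)[OF assms(2)] intro!: Add_in_Hom)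

lemma nt_smult_closed:
  assumes "c \<in> carrier K" and "\<eta> \<in> carrier nt"
  shows "c \<odot>\<^bsub>nt\<^esub> \<eta> \<in> carrier nt"
proof (rule ntI)
  fix x y f assume f: "f \<in> Hom C x y"
  then have xy: "x \<in> Ob C" "y \<in> Ob C" by (auto dest: Hom_Ob)
  then show "Fa f \<bullet> (c \<odot>\<^bsub>nt\<^esub> \<eta>) x = (c \<odot>\<^bsub>nt\<^esub> \<eta>) y \<bullet> f"
    by (simp add: nt_simps Comp_Scale_right[OF assms(1) F_Hom[OF f] ntD(2)[OF assms(2)]]
        Comp_Scale_left[OF assms(1) ntD(2)[OF assms(2)] f] ntD(3)[OF assms(2) f])
qed (auto simp: nt_simps ntD(2)[OF assms(2)] intro!: Scale_in_Hom assms(1))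

lemma nt_zero_closed: "\<zero>\<^bsub>nt\<^esub> \<in> carrier nt"
proof (rule ntI)
  fix x y f assume f: "f \<in> Hom C x y"
  then have xy: "x \<in> Ob C" "y \<in> Ob C" by (auto dest: Hom_Ob)
  then show "Fa f \<bullet> \<zero>\<^bsub>nt\<^esub> x = \<zero>\<^bsub>nt\<^esub> y \<bullet> f"
    by (simp add: nt_simps Comp_Zero_right[OF _ F_Hom[OF f]] Comp_Zero_left[OF _ f] F_Ob)
qed (auto simp: nt_simps intro!: Zero_in_Hom F_Ob)

lemma module_nt:
  assumes "cring K"
  shows "module K nt"
proof -
  interpret K: cring K by fact
  have H: "module K (hom_module C x (Fo x))" if "x \<in> Ob C" for x
    using that F_Ob by (intro hom_is_module)
  have A: "abelian_group (hom_module C x (Fo x))" if "x \<in> Ob C" for x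
    using module.axioms(2)[OF H[OF that]] .
  note m = abelian_monoid.a_assoc[OF abelian_group.axioms(1)[OF A], simplified]
    abelian_monoid.a_comm[OF abelian_group.axioms(1)[OF A], simplified]
    abelian_monoid.l_zero[OF abelian_group.axioms(1)[OF A], simplified]
    module.smult_l_distr[OF H, simplified] module.smult_r_distr[OF H, simplified]
    module.smult_assoc1[OF H, simplified] module.smult_one[OF H, simplified]
    module.smult_l_null[OF H, simplified]
  have neg: "\<exists>\<theta>\<in>carrier nt. \<theta> \<oplus>\<^bsub>nt\<^esub> \<eta> = \<zero>\<^bsub>nt\<^esub>" if \<eta>: "\<eta> \<in> carrier nt" for \<eta>
  proof
    let ?\<theta> = "(\<ominus>\<^bsub>K\<^esub> \<one>\<^bsub>K\<^esub>) \<odot>\<^bsub>nt\<^esub> \<eta>"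
    show \<theta>: "?\<theta> \<in> carrier nt" by (rule nt_smult_closed[OF _ \<eta>]) simp
    show "?\<theta> \<oplus>\<^bsub>nt\<^esub> \<eta> = \<zero>\<^bsub>nt\<^esub>"
    proof (rule nt_eqI[OF nt_add_closed[OF \<theta> \<eta>] nt_zero_closed])
      fix x assume x: "x \<in> Ob C"
      have "Add_ar C (Scale_ar C (\<ominus>\<^bsub>K\<^esub> \<one>\<^bsub>K\<^esub>) (\<eta> x)) (\<eta> x)
          = Scale_ar C (\<ominus>\<^bsub>K\<^esub> \<one>\<^bsub>K\<^esub> \<oplus>\<^bsub>K\<^esub> \<one>\<^bsub>K\<^esub>) (\<eta> x)"
        using x ntD(2)[OF \<eta> x] m(4)[OF x, of "\<ominus>\<^bsub>K\<^esub> \<one>\<^bsub>K\<^esub>" "\<one>\<^bsub>K\<^esub>"] m(7)[OF x] by simp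
      then show "(?\<theta> \<oplus>\<^bsub>nt\<^esub> \<eta>) x = \<zero>\<^bsub>nt\<^esub> x"
        using x ntD(2)[OF \<eta> x] m(8)[OF x] by (simp add: nt_simps K.l_neg)
    qed
  qed
  show ?thesis
  proof (rule moduleI)
    show "abelian_group nt"
    proof (rule abelian_groupI)
      fix \<eta> \<theta> \<zeta> assume "\<eta> \<in> carrier nt" "\<theta> \<in> carrier nt" "\<zeta> \<in> carrier nt"
      then show "\<eta> \<oplus>\<^bsub>nt\<^esub> \<theta> \<oplus>\<^bsub>nt\<^esub> \<zeta> = \<eta> \<oplus>\<^bsub>nt\<^esub> (\<theta> \<oplus>\<^bsub>nt\<^esub> \<zeta>)"
        unfolding nt_simps by (intro restrict_ext) (simp add: ntD(2) m(1))
    next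
      fix \<eta> \<theta> assume \<eta>: "\<eta> \<in> carrier nt" and \<theta>: "\<theta> \<in> carrier nt"
      show "\<eta> \<oplus>\<^bsub>nt\<^esub> \<theta> = \<theta> \<oplus>\<^bsub>nt\<^esub> \<eta>"
        unfolding nt_simps by (rule restrict_ext, rule m(2)[OF _ ntD(2)[OF \<eta>] ntD(2)[OF \<theta>]])
    next
      fix \<eta> assume "\<eta> \<in> carrier nt"
      then show "\<zero>\<^bsub>nt\<^esub> \<oplus>\<^bsub>nt\<^esub> \<eta> = \<eta>"
        by (intro nt_eqI nt_add_closed nt_zero_closed) (auto simp: nt_simps ntD(2) m(3))
    qed (fact nt_add_closed nt_zero_closed neg)+
  next
    fix a b \<eta> assume "a \<in> carrier K" "b \<in> carrier K" "\<eta> \<in> carrier nt"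
    then show "(a \<oplus>\<^bsub>K\<^esub> b) \<odot>\<^bsub>nt\<^esub> \<eta> = a \<odot>\<^bsub>nt\<^esub> \<eta> \<oplus>\<^bsub>nt\<^esub> b \<odot>\<^bsub>nt\<^esub> \<eta>"
      and "(a \<otimes>\<^bsub>K\<^esub> b) \<odot>\<^bsub>nt\<^esub> \<eta> = a \<odot>\<^bsub>nt\<^esub> (b \<odot>\<^bsub>nt\<^esub> \<eta>)"
      unfolding nt_simps by (auto intro!: restrict_ext simp: ntD(2) m(4,6))
  next
    fix a \<eta> \<theta> assume "a \<in> carrier K" "\<eta> \<in> carrier nt" "\<theta> \<in> carrier nt"
    then show "a \<odot>\<^bsub>nt\<^esub> (\<eta> \<oplus>\<^bsub>nt\<^esub> \<theta>) = a \<odot>\<^bsub>nt\<^esub> \<eta> \<oplus>\<^bsub>nt\<^esub> a \<odot>\<^bsub>nt\<^esub> \<theta>"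
      unfolding nt_simps by (intro restrict_ext) (simp add: ntD(2) m(5))
  next
    fix \<eta> assume \<eta>: "\<eta> \<in> carrier nt"
    then show "\<one>\<^bsub>K\<^esub> \<odot>\<^bsub>nt\<^esub> \<eta> = \<eta>"
      by (intro nt_eqI nt_smult_closed) (auto simp: nt_simps ntD(2) m(7))
  qed (fact assms nt_smult_closed)+
qed

lemma ev_linear: "x \<in> Ob C \<Longrightarrow> linear_map K nt (hom_module C x (Fo x)) (\<lambda>\<eta>. \<eta> x)"
  by (intro linear_mapI) (auto simp: nt_simps ntD(2))

text \<open>By naturality the composite of \<open>\<eta> x\<close> with an arrow out of
  \<open>P\<close> depends only on \<open>\<eta> P\<close>, and such arrows separate.\<close>

lemma ev_generator_inj:
  assumes P: "is_generator C P" and \<eta>: "\<eta> \<in> carrier nt" and \<theta>: "\<theta> \<in> carrier nt" and eq: "\<eta> P = \<theta> P"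
  shows "\<eta> = \<theta>"
proof (rule nt_eqI[OF \<eta> \<theta>])
  fix x assume x: "x \<in> Ob C"
  show "\<eta> x = \<theta> x"
    by (rule generator_separates[OF P ntD(2)[OF \<eta> x] ntD(2)[OF \<theta> x]])
      (metis eq ntD(3)[OF \<eta>] ntD(3)[OF \<theta>])
qed

text \<open>
  The extension is determined on the arrows out of the generator by naturality; it exists because
  the identity of every object is a sum of arrows factoring through the generator.
\<close>

lemma ev_generator_surj:
  assumes P: "is_generator C P" and z: "z \<in> Hom C P (Fo P)"
    and comm: "\<And>f. f \<in> Hom C P P \<Longrightarrow> Fa f \<bullet> z = z \<bullet> f"
  obtains \<eta> where "\<eta> \<in> carrier nt" and "\<eta> P = z"
proof -
  have P_Ob: "P \<in> Ob C" using P by (simp add: is_generator_def)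
  \<comment> \<open>The induction runs over all \<open>h\<close> in \<open>through\<close> and not
    just the identity: \<open>e\<close> plays the role of the unknown component at \<open>x\<close>
    composed with \<open>h\<close>. For \<open>h = f \<bullet> g\<close> it is \<open>z\<close>
    carried along the factorization; for sums the witnesses add up.\<close>
  have "\<exists>e\<in>Hom C x (Fo x). \<forall>i\<in>Hom C P x. e \<bullet> i = Fa (h \<bullet> i) \<bullet> z" if "h \<in> through C P x x" for h x
    using that
  proof (induction rule: through.induct)
    case (Comp f g)
    have "(Fa f \<bullet> z \<bullet> g) \<bullet> i = Fa ((f \<bullet> g) \<bullet> i) \<bullet> z" if i: "i \<in> Hom C P x" for i
    proof -
      have gi: "g \<bullet> i \<in> Hom C P P" using Comp(2) i by (rule Comp_in_Hom)
      have zg: "z \<bullet> g \<in> Hom C x (Fo P)" using z Comp(2) by (rule Comp_in_Hom)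
      have "(Fa f \<bullet> z \<bullet> g) \<bullet> i = Fa f \<bullet> z \<bullet> (g \<bullet> i)"
        using Comp_assoc[OF F_Hom[OF Comp(1)] zg i] Comp_assoc[OF z Comp(2) i] by simp
      also have "\<dots> = Fa f \<bullet> Fa (g \<bullet> i) \<bullet> z" using comm[OF gi] by simp
      also have "\<dots> = Fa (f \<bullet> g \<bullet> i) \<bullet> z"
        using Comp_assoc[OF F_Hom[OF Comp(1)] F_Hom[OF gi] z] F_Comp[OF Comp(1) gi] by simp
      finally show ?thesis using Comp_assoc[OF Comp(1,2) i] by simp
    qed
    moreover have "Fa f \<bullet> z \<bullet> g \<in> Hom C x (Fo x)"
      using Comp z by (blast intro: Comp_in_Hom F_Hom)
    ultimately show ?case by blast
  next
    case (Add f g)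
    then obtain d e where d: "d \<in> Hom C x (Fo x)" "\<forall>i\<in>Hom C P x. d \<bullet> i = Fa (f \<bullet> i) \<bullet> z"
      and e: "e \<in> Hom C x (Fo x)" "\<forall>i\<in>Hom C P x. e \<bullet> i = Fa (g \<bullet> i) \<bullet> z" by blast
    have "Add_ar C d e \<bullet> i = Fa (Add_ar C f g \<bullet> i) \<bullet> z" if i: "i \<in> Hom C P x" for i
    proof -
      note fg = through_in_Hom[OF Add(1)] through_in_Hom[OF Add(2)]
      note fgi = Comp_in_Hom[OF fg(1) i] Comp_in_Hom[OF fg(2) i]
      show ?thesis
        using d(2) e(2) i
        by (simp add: Comp_Add_left[OF d(1) e(1) i] Comp_Add_left[OF fg i] F_Add[OF fgi]
            Comp_Add_left[OF F_Hom[OF fgi(1)] F_Hom[OF fgi(2)] z])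
    qed
    then show ?case using d(1) e(1) Add_in_Hom by blast
  qed
  then have "\<exists>e\<in>Hom C x (Fo x). \<forall>i\<in>Hom C P x. e \<bullet> i = Fa (Ident C x \<bullet> i) \<bullet> z" if "x \<in> Ob C" for x
    using P that unfolding is_generator_def by blast
  then have "\<forall>x\<in>Ob C. \<exists>e. e \<in> Hom C x (Fo x) \<and> (\<forall>i\<in>Hom C P x. e \<bullet> i = Fa i \<bullet> z)"
    using Comp_Ident_left by metis
  then obtain e where e: "\<And>x. x \<in> Ob C \<Longrightarrow> e x \<in> Hom C x (Fo x)"
    and e_Comp: "\<And>x i. \<lbrakk>x \<in> Ob C; i \<in> Hom C P x\<rbrakk> \<Longrightarrow> e x \<bullet> i = Fa i \<bullet> z"
    by metis
  let ?\<eta> = "restrict e (Ob C)"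
  have "?\<eta> \<in> carrier nt"
  proof (rule ntI)
    fix x y f assume f: "f \<in> Hom C x y"
    then have xy: "x \<in> Ob C" "y \<in> Ob C" by (auto dest: Hom_Ob)
    have "Fa f \<bullet> e x = e y \<bullet> f"
    proof (rule generator_separates[OF P])
      show "Fa f \<bullet> e x \<in> Hom C x (Fo y)" "e y \<bullet> f \<in> Hom C x (Fo y)"
        using f e xy by (blast intro: Comp_in_Hom F_Hom)+
      fix i assume i: "i \<in> Hom C P x"
      have "(Fa f \<bullet> e x) \<bullet> i = Fa f \<bullet> Fa i \<bullet> z"
        using Comp_assoc[OF F_Hom[OF f] e[OF xy(1)] i] e_Comp[OF xy(1) i] by simp
      also have "\<dots> = Fa (f \<bullet> i) \<bullet> z"
        using Comp_assoc[OF F_Hom[OF f] F_Hom[OF i] z] F_Comp[OF f i] by simp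
      also have "\<dots> = (e y \<bullet> f) \<bullet> i"
        using e_Comp[OF xy(2) Comp_in_Hom[OF f i]] Comp_assoc[OF e[OF xy(2)] f i] by simp
      finally show "(Fa f \<bullet> e x) \<bullet> i = (e y \<bullet> f) \<bullet> i" .
    qed
    then show "Fa f \<bullet> ?\<eta> x = ?\<eta> y \<bullet> f" using xy by simp
  qed (use e in auto)
  moreover have "?\<eta> P = z"
  proof -
    have "e P = e P \<bullet> Ident C P" using Comp_Ident_right[OF e[OF P_Ob]] by simp
    also have "\<dots> = Ident C (Fo P) \<bullet> z"
      using e_Comp[OF P_Ob Ident_in_Hom[OF P_Ob]] F_Ident[OF P_Ob] by simp
    also have "\<dots> = z" by (rule Comp_Ident_left[OF z])
    finally show ?thesis using P_Ob by simp
  qed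
  ultimately show thesis by (rule that)
qed

end

lemma (in finite_semisimple_category) generator_exists:
  obtains P where "is_generator C P"
proof -
  let ?r = "{(x, y). is_simple C x \<and> is_simple C y \<and> isomorphic_objects C x y}"
  define rep where "rep c = (SOME y. y \<in> c)" for c :: "'o set"
  have rep: "\<exists>c\<in>Irr C. is_simple C (rep c) \<and> isomorphic_objects C x (rep c)" if x: "is_simple C x" for x
  proof
    show "?r `` {x} \<in> Irr C" unfolding Irr_def using x by (intro quotientI) simp
    have "x \<in> Ob C" using x by (simp add: is_simple_def)
    then have "inverse_arrows C (Ident C x) (Ident C x)"
      using Ident_in_Hom[of x] Comp_Ident_left[of "Ident C x" x x] by (auto simp: inverse_arrows_def Hom_def)
    then have "x \<in> ?r `` {x}"
      using x Ident_in_Hom[OF \<open>x \<in> Ob C\<close>] by (auto simp: isomorphic_objects_def is_iso_def)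
    then have "rep (?r `` {x}) \<in> ?r `` {x}" unfolding rep_def by (rule someI)
    then have "(x, rep (?r `` {x})) \<in> ?r" by (simp only: Image_singleton_iff)
    then show "is_simple C (rep (?r `` {x})) \<and> isomorphic_objects C x (rep (?r `` {x}))" by blast
  qed
  \<comment> \<open>The filter gives the simplicity of the listed representatives at once, and the
    fact \<open>rep\<close> shows that every simple object is still isomorphic to a listed
    one.\<close>
  obtain cs where cs: "set cs = {c \<in> Irr C. is_simple C (rep c)}"
    using finite_list[of "{c \<in> Irr C. is_simple C (rep c)}"] finite_Irr by auto
  let ?rs = "map rep cs"
  have "set ?rs \<subseteq> Ob C" using cs by (auto simp: is_simple_def)
  then obtain P where P: "is_direct_sum C P ?rs" using has_direct_sums by blast
  then have P_Ob: "P \<in> Ob C" by (simp add: is_direct_sum_def)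
  have P_retract: "\<exists>q\<in>Hom C y P. \<exists>p\<in>Hom C P y. p \<bullet> q = Ident C y" if "y \<in> set ?rs" for y
    using P that unfolding is_direct_sum_def in_set_conv_nth by metis
  have "Ident C x \<in> through C P x x" if x: "x \<in> Ob C" for x
  proof -
    obtain ys where ys: "\<forall>y\<in>set ys. is_simple C y" "is_direct_sum C x ys" using semisimple[OF x] by blast
    from ys(2) obtain i p where
      ip: "\<And>j. j < length ys \<Longrightarrow> i j \<in> Hom C (ys ! j) x" "\<And>j. j < length ys \<Longrightarrow> p j \<in> Hom C x (ys ! j)"
      and sum: "(\<Oplus>\<^bsub>hom_module C x x\<^esub>j\<in>{..<length ys}. i j \<bullet> p j) = Ident C x"
      unfolding is_direct_sum_def by blast
    have "i j \<bullet> p j \<in> through C P x x" if j: "j < length ys" for j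
    proof -
      obtain c where c: "c \<in> Irr C" "is_simple C (rep c)" "isomorphic_objects C (ys ! j) (rep c)"
        using rep ys(1) j by (metis nth_mem)
      then obtain a b where ab: "a \<in> Hom C (ys ! j) (rep c)" "b \<in> Hom C (rep c) (ys ! j)"
          "b \<bullet> a = Ident C (ys ! j)"
        by (auto simp: isomorphic_objects_def is_iso_def inverse_arrows_def Hom_def)
      have "rep c \<in> set ?rs" using c cs by simp
      then obtain q r where qr: "q \<in> Hom C (rep c) P" "r \<in> Hom C P (rep c)" "r \<bullet> q = Ident C (rep c)"
        using P_retract by blast
      note ap = Comp_in_Hom[OF ab(1) ip(2)[OF j]]
      note qap = Comp_in_Hom[OF qr(1) ap] and br = Comp_in_Hom[OF ab(2) qr(2)]
      \<comment> \<open>The summand is routed as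
        \<open>x \<rightarrow> ys ! j \<rightarrow> rep c \<rightarrow> P\<close> and back. The two
        middle pairs cancel, since \<open>r\<close> retracts \<open>q\<close> and \<open>b\<close>
        inverts \<open>a\<close>.\<close>
      have "(i j \<bullet> b \<bullet> r) \<bullet> (q \<bullet> a \<bullet> p j) = i j \<bullet> b \<bullet> (r \<bullet> q) \<bullet> a \<bullet> p j"
        using Comp_assoc[OF ip(1)[OF j] br qap] Comp_assoc[OF ab(2) qr(2) qap]
          Comp_assoc[OF qr(2,1) ap] by simp
      also have "\<dots> = i j \<bullet> (b \<bullet> a) \<bullet> p j"
        using Comp_Ident_left[OF ap] Comp_assoc[OF ab(2,1) ip(2)[OF j]] qr(3) by simp
      also have "\<dots> = i j \<bullet> p j" using Comp_Ident_left[OF ip(2)[OF j]] ab(3) by simp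
      finally show ?thesis using through.Comp[OF Comp_in_Hom[OF ip(1)[OF j] br] qap] by simp
    qed
    then show ?thesis using through_finsum[OF P_Ob x x, of "{..<length ys}" "\<lambda>j. i j \<bullet> p j"] sum by simp
  qed
  then show thesis using that P_Ob unfolding is_generator_def by blast
qed


section \<open>The naive tensor product\<close>

lemma bilinear_map_comp:
  assumes "bilinear_map K M' N' P h" and "linear_map K M M' \<alpha>" and "linear_map K N N' \<beta>"
  shows "bilinear_map K M N P (\<lambda>x y. h (\<alpha> x) (\<beta> y))"
proof (rule bilinear_mapI)
  show "linear_map K N P (\<lambda>y. h (\<alpha> x) (\<beta> y))" if "x \<in> carrier M" for x
    using linear_map_comp[OF assms(3) bilinear_mapD(1)[OF assms(1)]] linear_mapD(1)[OF assms(2) that] .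
  show "linear_map K M P (\<lambda>x. h (\<alpha> x) (\<beta> y))" if "y \<in> carrier N" for y
    using linear_map_comp[OF assms(2) bilinear_mapD(2)[OF assms(1)]] linear_mapD(1)[OF assms(3) that] .
qed

locale naive_tensor_product = V: linear_category K V + W: linear_category K W
  for K :: "('k, 'r) ring_scheme" and G :: "('g, 'a, 'x) moncat_scheme"
    and V :: "('k, 'o, 'm, 'g, 'a, 'y) modcat_scheme"
    and W :: "('k, 'p, 'n, 'g, 'a, 'z) modcat_scheme"
begin

abbreviation "A v w \<equiv> hom_module V (fst v) (fst w)"
abbreviation "B v w \<equiv> hom_module W (snd v) (snd w)"
abbreviation "TH v w \<equiv> tensor_hom K V W v w"
abbreviation "PT v w \<equiv> pure_hom K V W v w"
abbreviation "lift v w \<equiv> lift_hom K V W v w"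
abbreviation "N \<equiv> naive_tensor K G V W"

abbreviation inner where
  "inner u v w f g \<equiv> lift u v (TH u w) (\<lambda>f' g'. PT u w (f \<bullet>\<^bsub>V\<^esub> f') (g \<bullet>\<^bsub>W\<^esub> g'))"

text \<open>Composition in \<open>naive_tensor\<close> stripped of the domain and codomain tags,
  which makes it a map between tensor modules. The inner lift treats a pure left argument, the outer
  one extends this to all left arguments.\<close>

definition cmp where "cmp u v w s t = lift v w (TH u w) (\<lambda>f g. inner u v w f g t) s"

lemma Ob_N: "v \<in> Ob N \<longleftrightarrow> fst v \<in> Ob V \<and> snd v \<in> Ob W"
  by (cases v) (simp add: naive_tensor_def Let_def)

lemma tensor_product_hom: "\<lbrakk>v \<in> Ob N; w \<in> Ob N\<rbrakk> \<Longrightarrow> tensor_product K (A v w) (B v w)"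
  by (intro tensor_product.intro V.hom_is_module W.hom_is_module) (auto simp: naive_tensor_def Let_def)

lemma module_TH: "\<lbrakk>v \<in> Ob N; w \<in> Ob N\<rbrakk> \<Longrightarrow> module K (TH v w)"
  unfolding tensor_hom_def using tensor_product.submodule_relations[OF tensor_product_hom]
  by (simp add: module_tensor_def module_quotient_module module_free_module
      module.axioms(1)[OF tensor_product.axioms(1)[OF tensor_product_hom]])

lemma bilinear_PT: "\<lbrakk>v \<in> Ob N; w \<in> Ob N\<rbrakk> \<Longrightarrow> bilinear_map K (A v w) (B v w) (TH v w) (PT v w)"
  unfolding tensor_hom_def pure_hom_def using tensor_product.bilinear_pure[OF tensor_product_hom] .

lemma TH_induct [consumes 3, case_names pure add]:
  assumes "t \<in> carrier (TH v w)" and "v \<in> Ob N" and "w \<in> Ob N"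
    and "\<And>f g. \<lbrakk>f \<in> Hom V (fst v) (fst w); g \<in> Hom W (snd v) (snd w)\<rbrakk> \<Longrightarrow> Q (PT v w f g)"
    and "\<And>s t. \<lbrakk>s \<in> carrier (TH v w); t \<in> carrier (TH v w); Q s; Q t\<rbrakk> \<Longrightarrow> Q (s \<oplus>\<^bsub>TH v w\<^esub> t)"
  shows "Q t"
  using assms tensor_product.tensor_induct[OF tensor_product_hom, of v w t Q]
  unfolding tensor_hom_def pure_hom_def by simp

lemma PT_closed:
  "\<lbrakk>v \<in> Ob N; w \<in> Ob N; f \<in> Hom V (fst v) (fst w); g \<in> Hom W (snd v) (snd w)\<rbrakk>
    \<Longrightarrow> PT v w f g \<in> carrier (TH v w)"
  using linear_mapD(1)[OF bilinear_mapD(1)[OF bilinear_PT, of v w f], of g] by simp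

lemma lift_linear:
  "\<lbrakk>v \<in> Ob N; w \<in> Ob N; module K P; bilinear_map K (A v w) (B v w) P h\<rbrakk>
    \<Longrightarrow> linear_map K (TH v w) P (lift v w P h)"
  unfolding tensor_hom_def lift_hom_def using tensor_product.tensor_lift(1)[OF tensor_product_hom] .

lemma lift_PT:
  "\<lbrakk>v \<in> Ob N; w \<in> Ob N; module K P; bilinear_map K (A v w) (B v w) P h;
    f \<in> Hom V (fst v) (fst w); g \<in> Hom W (snd v) (snd w)\<rbrakk> \<Longrightarrow> lift v w P h (PT v w f g) = h f g"
  unfolding pure_hom_def lift_hom_def using tensor_product.tensor_lift(2)[OF tensor_product_hom] by simp

context
  fixes u v w
  assumes u: "u \<in> Ob N" and v: "v \<in> Ob N" and w: "w \<in> Ob N"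
begin

lemma Ob_components:
  "fst u \<in> Ob V" "fst v \<in> Ob V" "fst w \<in> Ob V" "snd u \<in> Ob W" "snd v \<in> Ob W" "snd w \<in> Ob W"
  using u v w by (auto simp: naive_tensor_def Let_def)

lemma inner_bilinear:
  assumes "f \<in> Hom V (fst v) (fst w)" and "g \<in> Hom W (snd v) (snd w)"
  shows "bilinear_map K (A u v) (B u v) (TH u w) (\<lambda>f' g'. PT u w (f \<bullet>\<^bsub>V\<^esub> f') (g \<bullet>\<^bsub>W\<^esub> g'))"
  by (rule bilinear_map_comp[OF bilinear_PT[OF u w]
        V.Comp_linear_right[OF Ob_components(1) assms(1)] W.Comp_linear_right[OF Ob_components(4) assms(2)]])

lemma inner_PT:
  assumes "f \<in> Hom V (fst v) (fst w)" and "g \<in> Hom W (snd v) (snd w)"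
    and "f' \<in> Hom V (fst u) (fst v)" and "g' \<in> Hom W (snd u) (snd v)"
  shows "inner u v w f g (PT u v f' g') = PT u w (f \<bullet>\<^bsub>V\<^esub> f') (g \<bullet>\<^bsub>W\<^esub> g')"
  by (rule lift_PT[OF u v module_TH[OF u w] inner_bilinear]) fact+

lemma inner_linear:
  assumes "f \<in> Hom V (fst v) (fst w)" and "g \<in> Hom W (snd v) (snd w)"
  shows "linear_map K (TH u v) (TH u w) (inner u v w f g)"
  by (rule lift_linear[OF u v module_TH[OF u w] inner_bilinear]) fact+

text \<open>This licenses the outer lift in \<open>cmp\<close>. For pure \<open>t\<close> the
  expression is known from \<open>inner_PT\<close>, and sums in \<open>t\<close> are handled because
  linear maps are closed under addition.\<close>

lemma outer_bilinear:
  assumes t: "t \<in> carrier (TH u v)"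
  shows "bilinear_map K (A v w) (B v w) (TH u w) (\<lambda>f g. inner u v w f g t)"
proof (rule bilinear_mapI)
  fix f assume "f \<in> carrier (A v w)"
  then have f: "f \<in> Hom V (fst v) (fst w)" by simp
  show "linear_map K (B v w) (TH u w) (\<lambda>g. inner u v w f g t)"
    using t u v
  proof (induction rule: TH_induct)
    case (pure f' g')
    have "linear_map K (B v w) (TH u w) (\<lambda>g. PT u w (f \<bullet>\<^bsub>V\<^esub> f') (g \<bullet>\<^bsub>W\<^esub> g'))"
      using V.Comp_in_Hom[OF f pure(1)]
      by (intro linear_map_comp[OF W.Comp_linear_left[OF Ob_components(6) pure(2)]]
          bilinear_mapD(1)[OF bilinear_PT[OF u w]]) simp
    then show ?case
      by (rule linear_map_cong[OF W.hom_is_module[OF Ob_components(5,6)]])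
        (use inner_PT[OF f _ pure] in simp)
  next
    case (add s t)
    show ?case
      by (rule linear_map_cong[OF W.hom_is_module[OF Ob_components(5,6)]
            linear_map_add[OF module_TH[OF u w] add(3,4)]])
        (use linear_mapD(2)[OF inner_linear[OF f] add(1,2)] in simp)
  qed
next
  fix g assume "g \<in> carrier (B v w)"
  then have g: "g \<in> Hom W (snd v) (snd w)" by simp
  show "linear_map K (A v w) (TH u w) (\<lambda>f. inner u v w f g t)"
    using t u v
  proof (induction rule: TH_induct)
    case (pure f' g')
    have "linear_map K (A v w) (TH u w) (\<lambda>f. PT u w (f \<bullet>\<^bsub>V\<^esub> f') (g \<bullet>\<^bsub>W\<^esub> g'))"
      using W.Comp_in_Hom[OF g pure(2)]
      by (intro linear_map_comp[OF V.Comp_linear_left[OF Ob_components(3) pure(1)],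
            of _ "\<lambda>f. PT u w f _"] bilinear_mapD(2)[OF bilinear_PT[OF u w]]) simp
    then show ?case
      by (rule linear_map_cong[OF V.hom_is_module[OF Ob_components(2,3)]])
        (use inner_PT[OF _ g pure] in simp)
  next
    case (add s t)
    show ?case
      by (rule linear_map_cong[OF V.hom_is_module[OF Ob_components(2,3)]
            linear_map_add[OF module_TH[OF u w] add(3,4)]])
        (use linear_mapD(2)[OF inner_linear[OF _ g] add(1,2)] in simp)
  qed
qed

lemma cmp_linear_left:
  "t \<in> carrier (TH u v) \<Longrightarrow> linear_map K (TH v w) (TH u w) (\<lambda>s. cmp u v w s t)"
  unfolding cmp_def by (rule lift_linear[OF v w module_TH[OF u w] outer_bilinear])

lemma cmp_PT_left:
  assumes "f \<in> Hom V (fst v) (fst w)" and "g \<in> Hom W (snd v) (snd w)" and "t \<in> carrier (TH u v)"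
  shows "cmp u v w (PT v w f g) t = inner u v w f g t"
  unfolding cmp_def using assms by (intro lift_PT[OF v w module_TH[OF u w] outer_bilinear])

lemma cmp_PT:
  assumes "f \<in> Hom V (fst v) (fst w)" and "g \<in> Hom W (snd v) (snd w)"
    and "f' \<in> Hom V (fst u) (fst v)" and "g' \<in> Hom W (snd u) (snd v)"
  shows "cmp u v w (PT v w f g) (PT u v f' g') = PT u w (f \<bullet>\<^bsub>V\<^esub> f') (g \<bullet>\<^bsub>W\<^esub> g')"
  using inner_PT[OF assms] cmp_PT_left[OF assms(1,2) PT_closed[OF u v assms(3,4)]] by simp

lemma cmp_linear_right:
  assumes "s \<in> carrier (TH v w)"
  shows "linear_map K (TH u v) (TH u w) (\<lambda>t. cmp u v w s t)"
  using assms v w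
proof (induction rule: TH_induct)
  case (pure f g)
  show ?case by (rule linear_map_cong[OF module_TH[OF u v] inner_linear[OF pure]])
      (simp add: cmp_PT_left[OF pure])
next
  case (add s s')
  show ?case
    by (rule linear_map_cong[OF module_TH[OF u v] linear_map_add[OF module_TH[OF u w] add(3,4)]])
      (simp add: linear_mapD(2)[OF cmp_linear_left add(1,2)])
qed

lemma cmp_closed: "\<lbrakk>s \<in> carrier (TH v w); t \<in> carrier (TH u v)\<rbrakk> \<Longrightarrow> cmp u v w s t \<in> carrier (TH u w)"
  using linear_mapD(1)[OF cmp_linear_left] by blast

lemmas cmp_add_left = linear_mapD(2)[OF cmp_linear_left]
lemmas cmp_add_right = linear_mapD(2)[OF cmp_linear_right]

end

text \<open>Both sides are additive in each argument, so three nested inductions reduce the claim to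
  pure tensors, where it is associativity in \<open>V\<close> and in \<open>W\<close>.\<close>

lemma cmp_assoc:
  assumes Ob: "u \<in> Ob N" "v \<in> Ob N" "w \<in> Ob N" "x \<in> Ob N"
    and r: "r \<in> carrier (TH w x)" and s: "s \<in> carrier (TH v w)" and t: "t \<in> carrier (TH u v)"
  shows "cmp u v x (cmp v w x r s) t = cmp u w x r (cmp u v w s t)"
  using r Ob(3,4)
proof (induction rule: TH_induct)
  case f: (pure f1 f2)
  note F = PT_closed[OF Ob(3,4) f]
  show ?case using s Ob(2,3)
  proof (induction rule: TH_induct)
    case g: (pure g1 g2)
    note G = PT_closed[OF Ob(2,3) g]
    show ?case using t Ob(1,2)
    proof (induction rule: TH_induct)
      case h: (pure h1 h2)
      show ?case
        by (simp add: cmp_PT[OF Ob(2-4) f g] cmp_PT[OF Ob(1-3) g h]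
            cmp_PT[OF Ob(1,2,4) V.Comp_in_Hom[OF f(1) g(1)] W.Comp_in_Hom[OF f(2) g(2)] h]
            cmp_PT[OF Ob(1,3,4) f V.Comp_in_Hom[OF g(1) h(1)] W.Comp_in_Hom[OF g(2) h(2)]]
            V.Comp_assoc[OF f(1) g(1) h(1)] W.Comp_assoc[OF f(2) g(2) h(2)])
    next
      case (add t t')
      then show ?case
        by (simp add: cmp_add_right[OF Ob(1,2,4) cmp_closed[OF Ob(2-4) F G]] cmp_add_right[OF Ob(1-3) G]
            cmp_add_right[OF Ob(1,3,4) F] cmp_closed[OF Ob(1-3) G])
    qed
  next
    case (add s s')
    then show ?case
      by (simp add: cmp_add_right[OF Ob(2-4) F] cmp_add_left[OF Ob(1,2,4) t] cmp_add_left[OF Ob(1-3) t]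
          cmp_add_right[OF Ob(1,3,4) F] cmp_closed[OF Ob(2-4) F] cmp_closed[OF Ob(1-3) _ t])
  qed
next
  case (add r r')
  then show ?case
    by (simp add: cmp_add_left[OF Ob(2-4) s] cmp_add_left[OF Ob(1,2,4) t]
        cmp_add_left[OF Ob(1,3,4) cmp_closed[OF Ob(1-3) s t]] cmp_closed[OF Ob(2-4) _ s])
qed

abbreviation "id_PT v \<equiv> PT v v (Ident V (fst v)) (Ident W (snd v))"

lemma Ident_components:
  assumes "v \<in> Ob N"
  shows "Ident V (fst v) \<in> Hom V (fst v) (fst v)" "Ident W (snd v) \<in> Hom W (snd v) (snd v)"
  using assms by (auto simp: naive_tensor_def Let_def intro: V.Ident_in_Hom W.Ident_in_Hom)

lemma cmp_id_left:
  assumes "v \<in> Ob N" and "w \<in> Ob N" and "t \<in> carrier (TH v w)"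
  shows "cmp v w w (id_PT w) t = t"
  using assms(3,1,2)
proof (induction rule: TH_induct)
  case (pure f g)
  then show ?case
    by (simp add: cmp_PT[OF assms(1,2,2) Ident_components[OF assms(2)] pure]
        V.Comp_Ident_left[OF pure(1)] W.Comp_Ident_left[OF pure(2)])
next
  case (add s t)
  then show ?case
    by (simp add: cmp_add_right[OF assms(1,2,2) PT_closed[OF assms(2,2) Ident_components[OF assms(2)]]])
qed

lemma cmp_id_right:
  assumes "v \<in> Ob N" and "w \<in> Ob N" and "t \<in> carrier (TH v w)"
  shows "cmp v v w t (id_PT v) = t"
  using assms(3,1,2)
proof (induction rule: TH_induct)
  case (pure f g)
  then show ?case
    by (simp add: cmp_PT[OF assms(1,1,2) pure Ident_components[OF assms(1)]]
        V.Comp_Ident_right[OF pure(1)] W.Comp_Ident_right[OF pure(2)])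
next
  case (add s t)
  then show ?case
    by (simp add: cmp_add_left[OF assms(1,1,2) PT_closed[OF assms(1,1) Ident_components[OF assms(1)]]])
qed

lemma N_simps:
  "Dom N (v, w, t) = v" "Cod N (v, w, t) = w" "Ident N v = (v, v, id_PT v)"
  "(v, w, s) \<bullet>\<^bsub>N\<^esub> (u, v', t) = (u, w, cmp u v w s t)"
  "Zero_ar N v w = (v, w, \<zero>\<^bsub>TH v w\<^esub>)"
  "Add_ar N (v, w, s) (v', w', t) = (v, w, s \<oplus>\<^bsub>TH v w\<^esub> t)"
  "Scale_ar N c (v, w, t) = (v, w, c \<odot>\<^bsub>TH v w\<^esub> t)"
  by (simp_all add: naive_tensor_def Let_def cmp_def)

lemma Hom_N: "h \<in> Hom N v w \<longleftrightarrow> v \<in> Ob N \<and> w \<in> Ob N \<and> (\<exists>t\<in>carrier (TH v w). h = (v, w, t))"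
  by (cases h) (auto simp: Hom_def naive_tensor_def Let_def)

lemma hom_N_linear:
  assumes "v \<in> Ob N" and "w \<in> Ob N"
  shows "linear_map K (TH v w) (hom_module N v w) (\<lambda>t. (v, w, t))"
  by (intro linear_mapI) (simp_all add: Hom_N assms N_simps)

text \<open>The hom-module is a copy of \<open>TH v w\<close> with domain and codomain attached, so
  its axioms come by transport.\<close>

lemma module_hom_N:
  assumes "v \<in> Ob N" and "w \<in> Ob N"
  shows "module K (hom_module N v w)"
  using module_TH[OF assms] hom_N_linear[OF assms]
  by (rule module_linear_image) (use assms in \<open>auto simp: Hom_N N_simps\<close>)

sublocale N: linear_category K N
proof (intro linear_category.intro category.intro linear_category_axioms.intro)
  show "Dom N f \<in> Ob N" "Cod N f \<in> Ob N" if "f \<in> Ar N" for f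
    using that by (auto simp: naive_tensor_def Let_def)
  show "Ident N v \<in> Hom N v v" if "v \<in> Ob N" for v
    using that by (auto simp: Hom_N N_simps intro: PT_closed Ident_components)
  show "g \<bullet>\<^bsub>N\<^esub> f \<in> Hom N u w" if "g \<in> Hom N v w" "f \<in> Hom N u v" for f g u v w
    using that by (auto simp: Hom_N N_simps intro: cmp_closed)
  show "Ident N w \<bullet>\<^bsub>N\<^esub> f = f" "f \<bullet>\<^bsub>N\<^esub> Ident N v = f" if "f \<in> Hom N v w" for f v w
    using that by (auto simp: Hom_N N_simps cmp_id_left cmp_id_right)
  show "(h \<bullet>\<^bsub>N\<^esub> g) \<bullet>\<^bsub>N\<^esub> f = h \<bullet>\<^bsub>N\<^esub> (g \<bullet>\<^bsub>N\<^esub> f)"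
    if "h \<in> Hom N w x" "g \<in> Hom N v w" "f \<in> Hom N u v" for f g h u v w x
    using that by (auto simp: Hom_N N_simps cmp_assoc)
  show "module K (hom_module N v w)" if "v \<in> Ob N" "w \<in> Ob N" for v w
    using that by (rule module_hom_N)
  show "linear_map K (hom_module N u v) (hom_module N u w) (\<lambda>f. g \<bullet>\<^bsub>N\<^esub> f)"
    if "u \<in> Ob N" "g \<in> Hom N v w" for g u v w
    using that by (intro linear_mapI)
      (auto simp: Hom_N N_simps cmp_closed linear_mapD(2,3)[OF cmp_linear_right])
  show "linear_map K (hom_module N v w) (hom_module N u w) (\<lambda>g. g \<bullet>\<^bsub>N\<^esub> f)"
    if "w \<in> Ob N" "f \<in> Hom N u v" for f u v w
    using that by (intro linear_mapI)
      (auto simp: Hom_N N_simps cmp_closed linear_mapD(2,3)[OF cmp_linear_left])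
qed

text \<open>An identity of \<open>N\<close> is the tensor of two identities. Both are expanded as
  sums of composites, through \<open>P\<close> and through \<open>Q\<close>; the interchange of
  composition and tensor then turns each product of composites into one composite through
  \<open>(P, Q)\<close>.\<close>

lemma generator_N:
  assumes P: "is_generator V P" and Q: "is_generator W Q"
  shows "is_generator N (P, Q)"
proof -
  have PQ: "(P, Q) \<in> Ob N"
    using P Q by (simp add: is_generator_def naive_tensor_def Let_def)
  have "(v, v, PT v v e e') \<in> through N (P, Q) v v"
    if v: "v \<in> Ob N" and e: "e \<in> through V P (fst v) (fst v)" and e': "e' \<in> through W Q (snd v) (snd v)"
    for v e e'
    using e
  proof (induction rule: through.induct)
    case f: (Comp f g)
    show ?case using e'
    proof (induction rule: through.induct)
      case (Comp f' g')
      have "((P, Q), v, PT (P, Q) v f f') \<bullet>\<^bsub>N\<^esub> (v, (P, Q), PT v (P, Q) g g') \<in> through N (P, Q) v v"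
        using f Comp v PQ by (intro through.Comp) (auto simp: Hom_N intro!: PT_closed)
      then show ?case using f Comp by (simp add: N_simps cmp_PT[OF v PQ v])
    next
      case (Add f' g')
      then show ?case
        using through.Add[OF Add(3,4)] W.through_in_Hom[OF Add(1)] W.through_in_Hom[OF Add(2)]
          linear_mapD(2)[OF bilinear_mapD(1)[OF bilinear_PT[OF v v]], of "f \<bullet>\<^bsub>V\<^esub> g" f' g']
          V.Comp_in_Hom[OF f]
        by (simp add: N_simps)
    qed
  next
    case (Add f g)
    then show ?case
      using through.Add[OF Add(3,4)] V.through_in_Hom[OF Add(1)] V.through_in_Hom[OF Add(2)]
        linear_mapD(2)[OF bilinear_mapD(2)[OF bilinear_PT[OF v v]], of e' f g] W.through_in_Hom[OF e']
      by (simp add: N_simps)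
  qed
  then show ?thesis using P Q PQ
    by (auto simp: is_generator_def N_simps naive_tensor_def Let_def)
qed

end

section \<open>The diagonal action of one object on the naive tensor product\<close>

locale naive_tensor_action = naive_tensor_product K G V W
  for K :: "('k, 'r) ring_scheme" and G :: "('g, 'a, 'x) moncat_scheme"
    and V :: "('k, 'o, 'm, 'g, 'a, 'y) modcat_scheme"
    and W :: "('k, 'p, 'n, 'g, 'a, 'z) modcat_scheme" +
  fixes g :: 'g
  assumes G: "category G" and g: "g \<in> Ob G"
    and act_V: "linear_endofunctor K V (act_ob V g) (act_ar V (Ident G g))"
    and act_W: "linear_endofunctor K W (act_ob W g) (act_ar W (Ident G g))"
begin

sublocale FV: linear_endofunctor K V "act_ob V g" "act_ar V (Ident G g)" by (rule act_V)

sublocale FW: linear_endofunctor K W "act_ob W g" "act_ar W (Ident G g)" by (rule act_W)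

abbreviation "Fo \<equiv> act_ob N g"
abbreviation "FVa \<equiv> act_ar V (Ident G g)"
abbreviation "FWa \<equiv> act_ar W (Ident G g)"
abbreviation "FNa \<equiv> act_ar N (Ident G g)"

text \<open>The arrow part of the diagonal action on untagged tensors, the counterpart of
  \<open>cmp\<close> for the functor.\<close>

definition Ft where
  "Ft v w = lift v w (TH (Fo v) (Fo w))
     (\<lambda>f f'. PT (Fo v) (Fo w) (FVa f) (FWa f'))"

lemma Fo_simps [simp]: "fst (Fo v) = act_ob V g (fst v)" "snd (Fo v) = act_ob W g (snd v)"
  by (simp_all add: naive_tensor_def Let_def)

lemma Fo_Ob: "v \<in> Ob N \<Longrightarrow> Fo v \<in> Ob N"
  by (auto simp: naive_tensor_def Let_def FV.F_Ob FW.F_Ob)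

lemma act_ar_N: "FNa (v, w, t) = (Fo v, Fo w, Ft v w t)"
  using category.Ident_in_Hom[OF G g]
  by (simp add: naive_tensor_def Let_def Ft_def Hom_def)

context
  fixes v w
  assumes v: "v \<in> Ob N" and w: "w \<in> Ob N"
begin

lemma F_bilinear:
  "bilinear_map K (A v w) (B v w) (TH (Fo v) (Fo w))
    (\<lambda>f f'. PT (Fo v) (Fo w) (FVa f) (FWa f'))"
proof (rule bilinear_map_comp[OF bilinear_PT])
  show "linear_map K (A v w) (A (Fo v) (Fo w)) (FVa)"
    using v w FV.F_linear[of "fst v" "fst w"] by (auto simp: naive_tensor_def Let_def)
  show "linear_map K (B v w) (B (Fo v) (Fo w)) (FWa)"
    using v w FW.F_linear[of "snd v" "snd w"] by (auto simp: naive_tensor_def Let_def)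
qed (use v w Fo_Ob in auto)

lemma Ft_linear: "linear_map K (TH v w) (TH (Fo v) (Fo w)) (Ft v w)"
  unfolding Ft_def by (rule lift_linear[OF v w module_TH[OF Fo_Ob[OF v] Fo_Ob[OF w]] F_bilinear])

lemma Ft_PT:
  assumes "f \<in> Hom V (fst v) (fst w)" and "f' \<in> Hom W (snd v) (snd w)"
  shows "Ft v w (PT v w f f') =
    PT (Fo v) (Fo w) (FVa f) (FWa f')"
  unfolding Ft_def using assms
  by (intro lift_PT[OF v w module_TH[OF Fo_Ob[OF v] Fo_Ob[OF w]] F_bilinear])

lemmas Ft_closed = linear_mapD(1)[OF Ft_linear]
lemmas Ft_add = linear_mapD(2)[OF Ft_linear]

end

lemma Ft_cmp:
  assumes Ob: "u \<in> Ob N" "v \<in> Ob N" "w \<in> Ob N"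
    and s: "s \<in> carrier (TH v w)" and t: "t \<in> carrier (TH u v)"
  shows "Ft u w (cmp u v w s t) = cmp (Fo u) (Fo v) (Fo w) (Ft v w s) (Ft u v t)"
  using s Ob(2,3)
proof (induction rule: TH_induct)
  case f: (pure f f')
  note F = PT_closed[OF Ob(2,3) f]
  note FOb = Fo_Ob[OF Ob(1)] Fo_Ob[OF Ob(2)] Fo_Ob[OF Ob(3)]
  show ?case using t Ob(1,2)
  proof (induction rule: TH_induct)
    case h: (pure h h')
    show ?case
      by (simp add: cmp_PT[OF Ob f h] Ft_PT[OF Ob(2,3) f] Ft_PT[OF Ob(1,2) h]
          Ft_PT[OF Ob(1,3) V.Comp_in_Hom[OF f(1) h(1)] W.Comp_in_Hom[OF f(2) h(2)]]
          cmp_PT[OF FOb] FV.F_Hom FW.F_Hom f h FV.F_Comp[OF f(1) h(1)] FW.F_Comp[OF f(2) h(2)])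
  next
    case (add t t')
    then show ?case
      by (simp add: cmp_add_right[OF Ob F] Ft_add[OF Ob(1,3)] Ft_add[OF Ob(1,2)] cmp_closed[OF Ob F]
          cmp_add_right[OF FOb Ft_closed[OF Ob(2,3) F]] Ft_closed[OF Ob(1,2)])
  qed
next
  case (add s s')
  note FOb = Fo_Ob[OF Ob(1)] Fo_Ob[OF Ob(2)] Fo_Ob[OF Ob(3)]
  show ?case using add
    by (simp add: cmp_add_left[OF Ob t] Ft_add[OF Ob(1,3)] Ft_add[OF Ob(2,3)] cmp_closed[OF Ob _ t]
        cmp_add_left[OF FOb Ft_closed[OF Ob(1,2) t]] Ft_closed[OF Ob(2,3)])
qed

sublocale FN: linear_endofunctor K N Fo FNa
proof (intro linear_endofunctor.intro linear_endofunctor_axioms.intro)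
  show "Fo v \<in> Ob N" if "v \<in> Ob N" for v using that by (rule Fo_Ob)
  show "FNa f \<in> Hom N (Fo v) (Fo w)" if "f \<in> Hom N v w" for f v w
    using that by (auto simp: Hom_N act_ar_N Fo_Ob Ft_closed simp del: Fo_simps)
  show "FNa (Ident N v) = Ident N (Fo v)" if v: "v \<in> Ob N" for v
    using Ft_PT[OF v v Ident_components[OF v]] v FV.F_Ident[of "fst v"] FW.F_Ident[of "snd v"]
    by (simp add: N_simps act_ar_N Ob_N)
  show "FNa (f' \<bullet>\<^bsub>N\<^esub> f) = FNa f' \<bullet>\<^bsub>N\<^esub> FNa f"
    if "f' \<in> Hom N v w" "f \<in> Hom N u v" for f f' u v w
    using that by (auto simp: Hom_N act_ar_N N_simps Ft_cmp)
  show "linear_map K (hom_module N v w) (hom_module N (Fo v) (Fo w)) (FNa)"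
    if "v \<in> Ob N" "w \<in> Ob N" for v w
    using that by (intro linear_mapI)
      (auto simp: Hom_N act_ar_N N_simps Fo_Ob Ft_closed linear_mapD(2,3)[OF Ft_linear] simp del: Fo_simps)
qed (rule N.linear_category_axioms)

end

section \<open>The comparison map from the tensor product of two characters\<close>

context naive_tensor_action
begin

definition ev_tensor where
  "ev_tensor v = tensor_lift K FV.nt FW.nt (TH v (Fo v)) (\<lambda>\<eta> \<theta>. PT v (Fo v) (\<eta> (fst v)) (\<theta> (snd v)))"

text \<open>The external product of transformations, extended linearly: a pure tensor of
  \<open>\<eta>\<close> and \<open>\<theta>\<close> is sent to the transformation whose component at
  \<open>(x, y)\<close> is the tensor of \<open>\<eta> x\<close> and
  \<open>\<theta> y\<close>.\<close>

definition nt_tensor where "nt_tensor t = (\<lambda>v\<in>Ob N. (v, Fo v, ev_tensor v t))"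

context
  assumes K: "field K"
begin

interpretation K: field K by (rule K)

interpretation T: tensor_product K FV.nt FW.nt
  by (intro tensor_product.intro FV.module_nt FW.module_nt K.is_cring)

lemma ev_bilinear:
  assumes "v \<in> Ob N"
  shows "bilinear_map K FV.nt FW.nt (TH v (Fo v)) (\<lambda>\<eta> \<theta>. PT v (Fo v) (\<eta> (fst v)) (\<theta> (snd v)))"
proof (rule bilinear_map_comp[OF bilinear_PT[OF assms Fo_Ob[OF assms]]])
  show "linear_map K FV.nt (A v (Fo v)) (\<lambda>\<eta>. \<eta> (fst v))"
    using FV.ev_linear[of "fst v"] assms by (simp add: Ob_N)
  show "linear_map K FW.nt (B v (Fo v)) (\<lambda>\<theta>. \<theta> (snd v))"
    using FW.ev_linear[of "snd v"] assms by (simp add: Ob_N)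
qed

lemma ev_tensor_linear: "v \<in> Ob N \<Longrightarrow> linear_map K T.T (TH v (Fo v)) (ev_tensor v)"
  unfolding ev_tensor_def by (rule T.tensor_lift(1)[OF module_TH[OF _ Fo_Ob] ev_bilinear])

lemma ev_tensor_pure:
  "\<lbrakk>v \<in> Ob N; \<eta> \<in> carrier FV.nt; \<theta> \<in> carrier FW.nt\<rbrakk> \<Longrightarrow>
    ev_tensor v (pure_tensor K FV.nt FW.nt \<eta> \<theta>) = PT v (Fo v) (\<eta> (fst v)) (\<theta> (snd v))"
  unfolding ev_tensor_def by (rule T.tensor_lift(2)[OF module_TH[OF _ Fo_Ob] ev_bilinear])

lemma nt_components:
  assumes "v \<in> Ob N" and "\<eta> \<in> carrier FV.nt" and "\<theta> \<in> carrier FW.nt"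
  shows "\<eta> (fst v) \<in> Hom V (fst v) (fst (Fo v))" and "\<theta> (snd v) \<in> Hom W (snd v) (snd (Fo v))"
  using assms FV.ntD(2) FW.ntD(2) by (simp_all add: Ob_N)

text \<open>Additivity in \<open>t\<close> and in \<open>s\<close> leaves only pure tensors, for
  which the square is the tensor of the naturality squares in \<open>V\<close> and
  \<open>W\<close>.\<close>

lemma ev_tensor_natural:
  assumes vw: "v \<in> Ob N" "w \<in> Ob N" and s: "s \<in> carrier (TH v w)" and t: "t \<in> carrier T.T"
  shows "cmp v (Fo v) (Fo w) (Ft v w s) (ev_tensor v t) = cmp v w (Fo w) (ev_tensor w t) s"
  using t
proof (induction rule: T.tensor_induct)
  case nt: (pure \<eta> \<theta>)
  note F = Fo_Ob[OF vw(1)] Fo_Ob[OF vw(2)]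
  note nv = nt_components[OF vw(1) nt] and nw = nt_components[OF vw(2) nt]
  show ?case unfolding ev_tensor_pure[OF vw(1) nt] ev_tensor_pure[OF vw(2) nt] using s vw
  proof (induction rule: TH_induct)
    case f: (pure f f')
    have Ff: "FVa f \<in> Hom V (fst (Fo v)) (fst (Fo w))"
        "FWa f' \<in> Hom W (snd (Fo v)) (snd (Fo w))"
      using FV.F_Hom[OF f(1)] FW.F_Hom[OF f(2)] by simp_all
    show ?case
      using FV.ntD(3)[OF nt(1) f(1)] FW.ntD(3)[OF nt(2) f(2)]
      by (simp add: Ft_PT[OF vw f]
          cmp_PT[OF vw(1) F Ff nv] cmp_PT[OF vw F(2) nw f] del: Fo_simps)
  next
    case (add s s')
    note e = PT_closed[OF vw(1) F(1) nv] PT_closed[OF vw(2) F(2) nw]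
    show ?case using add
      by (simp add: Ft_add[OF vw]
          cmp_add_left[OF vw(1) F e(1)] cmp_add_right[OF vw F(2) e(2)] Ft_closed[OF vw] del: Fo_simps)
  qed
next
  case (add t t')
  note F = Fo_Ob[OF vw(1)] Fo_Ob[OF vw(2)]
  note ev = linear_mapD(1,2)[OF ev_tensor_linear[OF vw(1)]] linear_mapD(1,2)[OF ev_tensor_linear[OF vw(2)]]
  show ?case using add
    by (simp add: ev cmp_add_right[OF vw(1) F Ft_closed[OF vw s]] cmp_add_left[OF vw F(2) s])
qed

lemma nt_tensor_closed:
  assumes t: "t \<in> carrier T.T"
  shows "nt_tensor t \<in> carrier FN.nt"
proof (rule FN.ntI)
  fix v w f assume "f \<in> Hom N v w"
  then obtain s where vw: "v \<in> Ob N" "w \<in> Ob N" and s: "s \<in> carrier (TH v w)" "f = (v, w, s)"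
    unfolding Hom_N by blast
  show "FNa f \<bullet>\<^bsub>N\<^esub> nt_tensor t v = nt_tensor t w \<bullet>\<^bsub>N\<^esub> f"
    using ev_tensor_natural[OF vw s(1) t] vw by (simp add: s(2) nt_tensor_def act_ar_N N_simps)
qed (use t in \<open>auto simp: nt_tensor_def Hom_N Fo_Ob linear_mapD(1)[OF ev_tensor_linear] simp del: Fo_simps\<close>)

lemma nt_tensor_linear: "linear_map K T.T FN.nt nt_tensor"
proof (intro linear_mapI nt_tensor_closed)
  fix s t assume "s \<in> carrier T.T" "t \<in> carrier T.T"
  then show "nt_tensor (s \<oplus>\<^bsub>T.T\<^esub> t) = nt_tensor s \<oplus>\<^bsub>FN.nt\<^esub> nt_tensor t"
    unfolding FN.nt_simps nt_tensor_def
    by (intro restrict_ext) (simp add: N_simps linear_mapD(2)[OF ev_tensor_linear])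
next
  fix c t assume "c \<in> carrier K" "t \<in> carrier T.T"
  then show "nt_tensor (c \<odot>\<^bsub>T.T\<^esub> t) = c \<odot>\<^bsub>FN.nt\<^esub> nt_tensor t"
    unfolding FN.nt_simps nt_tensor_def
    by (intro restrict_ext) (simp add: N_simps linear_mapD(3)[OF ev_tensor_linear])
qed

context
  fixes P Q
  assumes P: "is_generator V P" and Q: "is_generator W Q"
begin

lemma PQ_Ob: "(P, Q) \<in> Ob N"
  using P Q by (simp add: is_generator_def Ob_N)

interpretation H: tensor_product K "A (P, Q) (Fo (P, Q))" "B (P, Q) (Fo (P, Q))"
  by (rule tensor_product_hom[OF PQ_Ob Fo_Ob[OF PQ_Ob]])

lemma ev_P: "linear_map K FV.nt (A (P, Q) (Fo (P, Q))) (\<lambda>\<eta>. \<eta> P)" "inj_on (\<lambda>\<eta>. \<eta> P) (carrier FV.nt)"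
  using FV.ev_linear[of P] FV.ev_generator_inj[OF P] P by (auto simp: is_generator_def inj_on_def)

lemma ev_Q: "linear_map K FW.nt (B (P, Q) (Fo (P, Q))) (\<lambda>\<theta>. \<theta> Q)" "inj_on (\<lambda>\<theta>. \<theta> Q) (carrier FW.nt)"
  using FW.ev_linear[of Q] FW.ev_generator_inj[OF Q] Q by (auto simp: is_generator_def inj_on_def)

lemma ev_tensor_sum:
  assumes J: "finite J" "\<eta> \<in> J \<rightarrow> carrier FV.nt" "\<theta> \<in> J \<rightarrow> carrier FW.nt"
  shows "ev_tensor (P, Q) (\<Oplus>\<^bsub>T.T\<^esub>j\<in>J. pure_tensor K FV.nt FW.nt (\<eta> j) (\<theta> j)) =
    (\<Oplus>\<^bsub>H.T\<^esub>j\<in>J. PT (P, Q) (Fo (P, Q)) (\<eta> j P) (\<theta> j Q))"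
proof -
  have "ev_tensor (P, Q) (\<Oplus>\<^bsub>T.T\<^esub>j\<in>J. pure_tensor K FV.nt FW.nt (\<eta> j) (\<theta> j)) =
      (\<Oplus>\<^bsub>H.T\<^esub>j\<in>J. ev_tensor (P, Q) (pure_tensor K FV.nt FW.nt (\<eta> j) (\<theta> j)))"
    using J ev_tensor_linear[OF PQ_Ob] unfolding tensor_hom_def
    by (intro linear_map_finsum[OF T.T.module_axioms H.T.module_axioms]) auto
  also have "\<dots> = (\<Oplus>\<^bsub>H.T\<^esub>j\<in>J. PT (P, Q) (Fo (P, Q)) (\<eta> j P) (\<theta> j Q))"
  proof (intro H.T.M.finsum_cong' refl)
    fix j assume "j \<in> J"
    then have j: "\<eta> j \<in> carrier FV.nt" "\<theta> j \<in> carrier FW.nt" using J by auto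
    show "ev_tensor (P, Q) (pure_tensor K FV.nt FW.nt (\<eta> j) (\<theta> j)) =
        PT (P, Q) (Fo (P, Q)) (\<eta> j P) (\<theta> j Q)"
      using ev_tensor_pure[OF PQ_Ob j] by simp
  next
    show "(\<lambda>j. PT (P, Q) (Fo (P, Q)) (\<eta> j P) (\<theta> j Q)) \<in> J \<rightarrow> carrier H.T"
    proof (rule Pi_I)
      fix j assume "j \<in> J"
      then have j: "\<eta> j \<in> carrier FV.nt" "\<theta> j \<in> carrier FW.nt" using J by auto
      show "PT (P, Q) (Fo (P, Q)) (\<eta> j P) (\<theta> j Q) \<in> carrier H.T"
        using PT_closed[OF PQ_Ob Fo_Ob[OF PQ_Ob] nt_components[OF PQ_Ob j]]
        unfolding tensor_hom_def by simp
    qed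
  qed
  finally show ?thesis .
qed

text \<open>In a representation with independent \<open>\<eta> j\<close>, the values at
  \<open>P\<close> stay independent because evaluation there is injective. Vanishing at
  \<open>(P, Q)\<close> then kills every \<open>\<theta> j Q\<close>, and injectivity of evaluation
  at \<open>Q\<close> kills every \<open>\<theta> j\<close>.\<close>

lemma nt_tensor_inj: "inj_on nt_tensor (carrier T.T)"
proof (rule linear_map_inj_onI[OF T.T.module_axioms FN.module_nt[OF K.is_cring] nt_tensor_linear])
  fix t assume t: "t \<in> carrier T.T" and zero: "nt_tensor t = \<zero>\<^bsub>FN.nt\<^esub>"
  have "nt_tensor t (P, Q) = Zero_ar N (P, Q) (Fo (P, Q))"
    unfolding zero FN.nt_simps using PQ_Ob by simp
  then have ev: "ev_tensor (P, Q) t = \<zero>\<^bsub>H.T\<^esub>"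
    using PQ_Ob unfolding N_simps tensor_hom_def by (simp add: nt_tensor_def)
  obtain J :: "nat set" and \<eta> \<theta> where J: "finite J" "\<eta> \<in> J \<rightarrow> carrier FV.nt" "\<theta> \<in> J \<rightarrow> carrier FW.nt"
    and t_eq: "t = (\<Oplus>\<^bsub>T.T\<^esub>j\<in>J. pure_tensor K FV.nt FW.nt (\<eta> j) (\<theta> j))"
    and indep: "lin_indep K FV.nt J \<eta>" and "lin_indep K FW.nt J \<theta>"
    by (rule T.tensor_indep_sum[OF K t])
  have \<eta>P: "(\<lambda>j. \<eta> j P) \<in> J \<rightarrow> carrier (A (P, Q) (Fo (P, Q)))"
    using J(2) linear_mapD(1)[OF ev_P(1)] by blast
  have \<theta>Q: "(\<lambda>j. \<theta> j Q) \<in> J \<rightarrow> carrier (B (P, Q) (Fo (P, Q)))"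
    using J(3) linear_mapD(1)[OF ev_Q(1)] by blast
  have "(\<Oplus>\<^bsub>H.T\<^esub>j\<in>J. PT (P, Q) (Fo (P, Q)) (\<eta> j P) (\<theta> j Q)) = \<zero>\<^bsub>H.T\<^esub>"
    using ev_tensor_sum[OF J] ev t_eq by simp
  note \<theta>Q_zero = H.indep_tensor_sum_zero_left[OF K J(1) \<eta>P \<theta>Q
      lin_indep_image[OF T.M.module_axioms H.M.module_axioms ev_P J(1,2) indep] this[unfolded pure_hom_def]]
  have "\<theta> j = \<zero>\<^bsub>FW.nt\<^esub>" if j: "j \<in> J" for j
  proof (rule inj_onD[OF ev_Q(2)])
    show "\<theta> j Q = \<zero>\<^bsub>FW.nt\<^esub> Q"
      using \<theta>Q_zero[OF j] Q unfolding FW.nt_simps by (simp add: is_generator_def)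
  qed (use j J(3) in auto)
  then have "t = (\<Oplus>\<^bsub>T.T\<^esub>j\<in>J. \<zero>\<^bsub>T.T\<^esub>)"
    unfolding t_eq using J(2) by (intro T.T.M.finsum_cong') (auto simp: T.pure_zero_right Pi_iff)
  then show "t = \<zero>\<^bsub>T.T\<^esub>" by simp
qed

text \<open>
  In a representation of the value at \<open>(P, Q)\<close> with independent factors, naturality with respect
  to \<open>f \<otimes> 1\<close> and \<open>1 \<otimes> f\<close> passes to the individual factors.
\<close>

lemma nt_tensor_surj:
  assumes \<zeta>: "\<zeta> \<in> carrier FN.nt"
  obtains t where "t \<in> carrier T.T" and "nt_tensor t = \<zeta>"
proof -
  let ?v = "(P, Q)"
  let ?w = "Fo ?v"
  let ?PT = "PT ?v ?w"
  note v = PQ_Ob and w = Fo_Ob[OF PQ_Ob]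
  obtain z where z: "z \<in> carrier (TH ?v ?w)" and \<zeta>v: "\<zeta> ?v = (?v, ?w, z)"
    using FN.ntD(2)[OF \<zeta> v] unfolding Hom_N by blast
  have H_T: "TH ?v ?w = H.T" by (simp add: tensor_hom_def)
  obtain J :: "nat set" and a b where J: "finite J" "a \<in> J \<rightarrow> Hom V P (act_ob V g P)"
      "b \<in> J \<rightarrow> Hom W Q (act_ob W g Q)"
    and z_eq: "z = (\<Oplus>\<^bsub>TH ?v ?w\<^esub>j\<in>J. ?PT (a j) (b j))"
    and indep: "lin_indep K (A ?v ?w) J a" "lin_indep K (B ?v ?w) J b"
    using H.tensor_indep_sum[OF K, of z] z unfolding tensor_hom_def pure_hom_def by auto
  have ab: "a j \<in> Hom V P (act_ob V g P)" "b j \<in> Hom W Q (act_ob W g Q)" if "j \<in> J" for j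
    using that J by auto
  have PT_H: "?PT f f' \<in> carrier H.T"
    if "f \<in> Hom V P (act_ob V g P)" "f' \<in> Hom W Q (act_ob W g Q)" for f f'
    using PT_closed[OF v w, of f f'] that unfolding H_T by simp
  have ab_PT: "(\<lambda>j. ?PT (a j) (b j)) \<in> J \<rightarrow> carrier (TH ?v ?w)"
    using PT_closed[OF v w] ab by auto
  \<comment> \<open>The naturality square of \<open>\<zeta>\<close> at the tensor of
    \<open>f\<close> and \<open>f'\<close>, with \<open>z\<close> expanded so that both composites
    are sums of pure tensors over the same \<open>J\<close>.\<close>
  have natural: "(\<Oplus>\<^bsub>H.T\<^esub>j\<in>J. ?PT (FVa f \<bullet>\<^bsub>V\<^esub> a j) (FWa f' \<bullet>\<^bsub>W\<^esub> b j)) =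
      (\<Oplus>\<^bsub>H.T\<^esub>j\<in>J. ?PT (a j \<bullet>\<^bsub>V\<^esub> f) (b j \<bullet>\<^bsub>W\<^esub> f'))"
    if f: "f \<in> Hom V P P" and f': "f' \<in> Hom W Q Q" for f f'
  proof -
    have ff': "PT ?v ?v f f' \<in> carrier (TH ?v ?v)" using f f' v by (intro PT_closed) auto
    have F: "FVa f \<in> Hom V (fst ?w) (fst ?w)" "FWa f' \<in> Hom W (snd ?w) (snd ?w)"
      using FV.F_Hom[OF f] FW.F_Hom[OF f'] by simp_all
    note Fff' = PT_closed[OF w w F]
    have "(\<Oplus>\<^bsub>H.T\<^esub>j\<in>J. ?PT (FVa f \<bullet>\<^bsub>V\<^esub> a j) (FWa f' \<bullet>\<^bsub>W\<^esub> b j)) =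
        (\<Oplus>\<^bsub>H.T\<^esub>j\<in>J. cmp ?v ?w ?w (PT ?w ?w (FVa f) (FWa f')) (?PT (a j) (b j)))"
      using cmp_PT[OF v w w F] ab
        PT_H[OF V.Comp_in_Hom[OF FV.F_Hom[OF f] ab(1)] W.Comp_in_Hom[OF FW.F_Hom[OF f'] ab(2)]]
      by (intro H.T.M.finsum_cong') (auto simp: H_T Pi_iff)
    also have "\<dots> = cmp ?v ?w ?w (PT ?w ?w (FVa f) (FWa f')) z"
      unfolding z_eq H_T[symmetric]
      by (rule linear_map_finsum[OF module_TH[OF v w] module_TH[OF v w]
            cmp_linear_right[OF v w w Fff'] J(1) ab_PT, symmetric])
    also have "\<dots> = cmp ?v ?w ?w (Ft ?v ?v (PT ?v ?v f f')) z"
      using Ft_PT[OF v v, of f f'] f f' by simp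
    also have "\<dots> = cmp ?v ?v ?w z (PT ?v ?v f f')"
      using FN.ntD(3)[OF \<zeta>, of "(?v, ?v, PT ?v ?v f f')" ?v ?v] ff' v
      by (simp add: Hom_N act_ar_N N_simps \<zeta>v del: Fo_simps)
    also have "\<dots> = (\<Oplus>\<^bsub>H.T\<^esub>j\<in>J. cmp ?v ?v ?w (?PT (a j) (b j)) (PT ?v ?v f f'))"
      unfolding z_eq H_T[symmetric]
      by (rule linear_map_finsum[OF module_TH[OF v w] module_TH[OF v w]
            cmp_linear_left[OF v v w ff'] J(1) ab_PT])
    also have "\<dots> = (\<Oplus>\<^bsub>H.T\<^esub>j\<in>J. ?PT (a j \<bullet>\<^bsub>V\<^esub> f) (b j \<bullet>\<^bsub>W\<^esub> f'))"
      using cmp_PT[OF v v w, of _ _ f f'] ab f f'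
        PT_H[OF V.Comp_in_Hom[OF ab(1) f] W.Comp_in_Hom[OF ab(2) f']]
      by (intro H.T.M.finsum_cong') (auto simp: Pi_iff)
    finally show ?thesis .
  qed
  have P_Ob: "P \<in> Ob V" and Q_Ob: "Q \<in> Ob W" using v by (auto simp: Ob_N)
  have a_comm: "FVa f \<bullet>\<^bsub>V\<^esub> a j = a j \<bullet>\<^bsub>V\<^esub> f"
    if f: "f \<in> Hom V P P" and j: "j \<in> J" for f j
  proof (rule H.indep_tensor_sum_eq_left[OF K J(1) _ _ _ indep(2) _ j])
    have eqs: "FWa (Ident W Q) \<bullet>\<^bsub>W\<^esub> b j = b j" "b j \<bullet>\<^bsub>W\<^esub> Ident W Q = b j" if "j \<in> J" for j
      using ab(2)[OF that] by (simp_all add: FW.F_Ident[OF Q_Ob] W.Comp_Ident_left W.Comp_Ident_right)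
    have a1: "FVa f \<bullet>\<^bsub>V\<^esub> a j \<in> Hom V P (act_ob V g P)"
      and a2: "a j \<bullet>\<^bsub>V\<^esub> f \<in> Hom V P (act_ob V g P)" if "j \<in> J" for j
      using V.Comp_in_Hom[OF FV.F_Hom[OF f] ab(1)[OF that]] V.Comp_in_Hom[OF ab(1)[OF that] f] .
    show "(\<lambda>j. FVa f \<bullet>\<^bsub>V\<^esub> a j) \<in> J \<rightarrow> carrier (A ?v ?w)"
      "(\<lambda>j. a j \<bullet>\<^bsub>V\<^esub> f) \<in> J \<rightarrow> carrier (A ?v ?w)" "b \<in> J \<rightarrow> carrier (B ?v ?w)"
      using a1 a2 ab(2) by auto
    have "(\<Oplus>\<^bsub>H.T\<^esub>j\<in>J. ?PT (FVa f \<bullet>\<^bsub>V\<^esub> a j) (b j)) =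
        (\<Oplus>\<^bsub>H.T\<^esub>j\<in>J. ?PT (FVa f \<bullet>\<^bsub>V\<^esub> a j)
          (FWa (Ident W Q) \<bullet>\<^bsub>W\<^esub> b j))"
      by (intro H.T.M.finsum_cong' refl Pi_I) (simp_all only: eqs PT_H a1 ab)
    also have "\<dots> = (\<Oplus>\<^bsub>H.T\<^esub>j\<in>J. ?PT (a j \<bullet>\<^bsub>V\<^esub> f) (b j \<bullet>\<^bsub>W\<^esub> Ident W Q))"
      by (rule natural[OF f W.Ident_in_Hom[OF Q_Ob]])
    also have "\<dots> = (\<Oplus>\<^bsub>H.T\<^esub>j\<in>J. ?PT (a j \<bullet>\<^bsub>V\<^esub> f) (b j))"
      by (intro H.T.M.finsum_cong' refl Pi_I) (simp_all only: eqs PT_H a2 ab)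
    finally show "(\<Oplus>\<^bsub>H.T\<^esub>j\<in>J. pure_tensor K (A ?v ?w) (B ?v ?w) (FVa f \<bullet>\<^bsub>V\<^esub> a j) (b j)) =
        (\<Oplus>\<^bsub>H.T\<^esub>j\<in>J. pure_tensor K (A ?v ?w) (B ?v ?w) (a j \<bullet>\<^bsub>V\<^esub> f) (b j))"
      unfolding pure_hom_def .
  qed
  have b_comm: "FWa f \<bullet>\<^bsub>W\<^esub> b j = b j \<bullet>\<^bsub>W\<^esub> f"
    if f: "f \<in> Hom W Q Q" and j: "j \<in> J" for f j
  proof (rule H.indep_tensor_sum_eq_right[OF K J(1) _ _ _ indep(1) _ j])
    have eqs: "FVa (Ident V P) \<bullet>\<^bsub>V\<^esub> a j = a j" "a j \<bullet>\<^bsub>V\<^esub> Ident V P = a j" if "j \<in> J" for j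
      using ab(1)[OF that] by (simp_all add: FV.F_Ident[OF P_Ob] V.Comp_Ident_left V.Comp_Ident_right)
    have b1: "FWa f \<bullet>\<^bsub>W\<^esub> b j \<in> Hom W Q (act_ob W g Q)"
      and b2: "b j \<bullet>\<^bsub>W\<^esub> f \<in> Hom W Q (act_ob W g Q)" if "j \<in> J" for j
      using W.Comp_in_Hom[OF FW.F_Hom[OF f] ab(2)[OF that]] W.Comp_in_Hom[OF ab(2)[OF that] f] .
    show "a \<in> J \<rightarrow> carrier (A ?v ?w)" "(\<lambda>j. FWa f \<bullet>\<^bsub>W\<^esub> b j) \<in> J \<rightarrow> carrier (B ?v ?w)"
      "(\<lambda>j. b j \<bullet>\<^bsub>W\<^esub> f) \<in> J \<rightarrow> carrier (B ?v ?w)"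
      using b1 b2 ab(1) by auto
    have "(\<Oplus>\<^bsub>H.T\<^esub>j\<in>J. ?PT (a j) (FWa f \<bullet>\<^bsub>W\<^esub> b j)) =
        (\<Oplus>\<^bsub>H.T\<^esub>j\<in>J. ?PT (FVa (Ident V P) \<bullet>\<^bsub>V\<^esub> a j)
          (FWa f \<bullet>\<^bsub>W\<^esub> b j))"
      by (intro H.T.M.finsum_cong' refl Pi_I) (simp_all only: eqs PT_H b1 ab)
    also have "\<dots> = (\<Oplus>\<^bsub>H.T\<^esub>j\<in>J. ?PT (a j \<bullet>\<^bsub>V\<^esub> Ident V P) (b j \<bullet>\<^bsub>W\<^esub> f))"
      by (rule natural[OF V.Ident_in_Hom[OF P_Ob] f])
    also have "\<dots> = (\<Oplus>\<^bsub>H.T\<^esub>j\<in>J. ?PT (a j) (b j \<bullet>\<^bsub>W\<^esub> f))"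
      by (intro H.T.M.finsum_cong' refl Pi_I) (simp_all only: eqs PT_H b2 ab)
    finally show "(\<Oplus>\<^bsub>H.T\<^esub>j\<in>J. pure_tensor K (A ?v ?w) (B ?v ?w) (a j) (FWa f \<bullet>\<^bsub>W\<^esub> b j)) =
        (\<Oplus>\<^bsub>H.T\<^esub>j\<in>J. pure_tensor K (A ?v ?w) (B ?v ?w) (a j) (b j \<bullet>\<^bsub>W\<^esub> f))"
      unfolding pure_hom_def .
  qed
  have "\<forall>j\<in>J. \<exists>\<eta>. \<eta> \<in> carrier FV.nt \<and> \<eta> P = a j"
    using FV.ev_generator_surj[OF P ab(1) a_comm] by metis
  then obtain \<eta> where \<eta>: "\<And>j. j \<in> J \<Longrightarrow> \<eta> j \<in> carrier FV.nt" "\<And>j. j \<in> J \<Longrightarrow> \<eta> j P = a j"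
    by metis
  have "\<forall>j\<in>J. \<exists>\<theta>. \<theta> \<in> carrier FW.nt \<and> \<theta> Q = b j"
    using FW.ev_generator_surj[OF Q ab(2) b_comm] by metis
  then obtain \<theta> where \<theta>: "\<And>j. j \<in> J \<Longrightarrow> \<theta> j \<in> carrier FW.nt" "\<And>j. j \<in> J \<Longrightarrow> \<theta> j Q = b j"
    by metis
  let ?t = "\<Oplus>\<^bsub>T.T\<^esub>j\<in>J. pure_tensor K FV.nt FW.nt (\<eta> j) (\<theta> j)"
  have t: "?t \<in> carrier T.T" using \<eta>(1) \<theta>(1) by (intro T.T.M.finsum_closed) auto
  have "ev_tensor ?v ?t = (\<Oplus>\<^bsub>H.T\<^esub>j\<in>J. ?PT (\<eta> j P) (\<theta> j Q))"
    using \<eta>(1) \<theta>(1) J(1) by (intro ev_tensor_sum) auto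
  also have "\<dots> = z"
    unfolding z_eq H_T using \<eta>(2) \<theta>(2) ab_PT by (intro H.T.M.finsum_cong') (auto simp: H_T)
  finally have "nt_tensor ?t ?v = \<zeta> ?v" using v by (simp add: nt_tensor_def \<zeta>v)
  \<comment> \<open>One component suffices, since \<open>(P, Q)\<close> generates the naive tensor
    product.\<close>
  then have "nt_tensor ?t = \<zeta>"
    by (rule FN.ev_generator_inj[OF generator_N[OF P Q] nt_tensor_closed[OF t] \<zeta>])
  then show thesis using that t by blast
qed

lemma nt_tensor_bij: "bij_betw nt_tensor (carrier T.T) (carrier FN.nt)"
proof (rule bij_betw_imageI[OF nt_tensor_inj])
  show "nt_tensor ` carrier T.T = carrier FN.nt"
    using nt_tensor_surj linear_mapD(1)[OF nt_tensor_linear] by blast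
qed

end

end

end


section \<open>The additive completion\<close>

lemma build_matrix_cong:
  assumes "\<And>i j. \<lbrakk>i < length ys; j < length xs\<rbrakk> \<Longrightarrow> A i j = B i j"
  shows "build_matrix xs ys A = build_matrix xs ys B"
  using assms by (auto simp: build_matrix_def restrict_def fun_eq_iff)

lemma build_matrix_inject:
  assumes "build_matrix xs ys A = build_matrix xs ys B" and "i < length ys" and "j < length xs"
  shows "A i j = B i j"
proof -
  have "snd (snd (build_matrix xs ys A)) (i, j) = snd (snd (build_matrix xs ys B)) (i, j)"
    using assms(1) by simp
  then show ?thesis using assms(2,3) by (simp add: build_matrix_def)
qed

text \<open>Products with diagonal matrices or with columns of inclusions have one surviving term in
  each entry.\<close>

lemma (in linear_category) hom_finsum_single:
  assumes "k < (n :: nat)" and "t k \<in> Hom C x y" and "\<And>l. \<lbrakk>l < n; l \<noteq> k\<rbrakk> \<Longrightarrow> t l = Zero_ar C x y"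
  shows "(\<Oplus>\<^bsub>hom_module C x y\<^esub>l\<in>{..<n}. t l) = t k"
proof -
  interpret H: module K "hom_module C x y" by (rule hom_module[OF assms(2)])
  have "(\<Oplus>\<^bsub>hom_module C x y\<^esub>l\<in>{..<n}. t l) = (\<Oplus>\<^bsub>hom_module C x y\<^esub>l\<in>{k}. t l)"
    using assms H.M.zero_closed by (intro H.M.add.finprod_mono_neutral_cong_right) (auto, metis)
  also have "\<dots> = t k" using assms(2) H.M.r_zero[of "t k"] by simp
  finally show ?thesis .
qed

locale completed_action = G: category G + linear_endofunctor K C "act_ob C g" "act_ar C (Ident G g)"
  for K :: "('k, 'r) ring_scheme" and G :: "('g, 'a, 'x) moncat_scheme"
    and C :: "('k, 'o, 'm, 'g, 'a, 'z) modcat_scheme" (structure) and g +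
  assumes g: "g \<in> Ob G"
begin

abbreviation "Fo \<equiv> act_ob C g"
abbreviation "Fa \<equiv> act_ar C (Ident G g)"
abbreviation "AC \<equiv> additive_completion G C"
abbreviation "\<chi> \<equiv> two_character G AC g"

lemma AC_simps:
  "Ob AC = lists (Ob C)" "act_ob AC g = map Fo"
  "Zero_ar AC xs ys = build_matrix xs ys (\<lambda>i j. Zero_ar C (xs ! j) (ys ! i))"
  by (simp_all add: additive_completion_def)

text \<open>Presenting every arrow as a \<open>build_matrix\<close> lets later arguments use plain
  entry functions and ignore the restriction to the index ranges.\<close>

lemma Hom_AC:
  "h \<in> Hom AC xs ys \<longleftrightarrow> xs \<in> lists (Ob C) \<and> ys \<in> lists (Ob C) \<and>
    (\<exists>A. h = build_matrix xs ys A \<and> (\<forall>i<length ys. \<forall>j<length xs. A i j \<in> Hom C (xs ! j) (ys ! i)))"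
  (is "_ \<longleftrightarrow> ?R")
proof
  assume "h \<in> Hom AC xs ys"
  then obtain A where h: "h = (xs, ys, A)" and xs: "xs \<in> lists (Ob C)" "ys \<in> lists (Ob C)"
    and A: "A \<in> (\<Pi>\<^sub>E (i, j) \<in> {..<length ys} \<times> {..<length xs}. Hom C (xs ! j) (ys ! i))"
    by (cases h) (auto simp: Hom_def additive_completion_def)
  have "restrict (\<lambda>(i, j). A (i, j)) ({..<length ys} \<times> {..<length xs}) = A"
    using A by (intro extensionalityI[of _ "{..<length ys} \<times> {..<length xs}"]) (auto simp: PiE_iff)
  then have "h = build_matrix xs ys (\<lambda>i j. A (i, j))" by (simp add: h build_matrix_def)
  moreover have "\<forall>i<length ys. \<forall>j<length xs. A (i, j) \<in> Hom C (xs ! j) (ys ! i)"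
    using A by (auto simp: PiE_iff)
  ultimately show ?R using xs by blast
next
  assume ?R
  then show "h \<in> Hom AC xs ys"
    by (auto simp: Hom_def additive_completion_def build_matrix_def PiE_iff)
qed

text \<open>The product is computed from entry functions before restriction; the hom-set conditions
  are what the congruence rule for \<open>finsum\<close> requires.\<close>

lemma Comp_AC:
  assumes "xs \<in> lists (Ob C)" and "zs \<in> lists (Ob C)"
    and "\<And>i l. \<lbrakk>i < length zs; l < length ys\<rbrakk> \<Longrightarrow> A i l \<in> Hom C (ys ! l) (zs ! i)"
    and "\<And>l j. \<lbrakk>l < length ys; j < length xs\<rbrakk> \<Longrightarrow> B l j \<in> Hom C (xs ! j) (ys ! l)"
  shows "build_matrix ys zs A \<bullet>\<^bsub>AC\<^esub> build_matrix xs ys B =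
    build_matrix xs zs (\<lambda>i j. \<Oplus>\<^bsub>hom_module C (xs ! j) (zs ! i)\<^esub>l\<in>{..<length ys}. A i l \<bullet> B l j)"
proof -
  have "(\<Oplus>\<^bsub>hom_module C (xs ! j) (zs ! i)\<^esub>l\<in>{..<length ys}.
        restrict (\<lambda>(i, j). A i j) ({..<length zs} \<times> {..<length ys}) (i, l) \<bullet>
        restrict (\<lambda>(i, j). B i j) ({..<length ys} \<times> {..<length xs}) (l, j)) =
      (\<Oplus>\<^bsub>hom_module C (xs ! j) (zs ! i)\<^esub>l\<in>{..<length ys}. A i l \<bullet> B l j)"
    if i: "i < length zs" "j < length xs" for i j
  proof -
    have "xs ! j \<in> Ob C" "zs ! i \<in> Ob C" using that assms(1,2) by auto
    then interpret H: module K "hom_module C (xs ! j) (zs ! i)" by (rule hom_is_module)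
    show ?thesis using that Comp_in_Hom[OF assms(3,4)] by (intro H.M.finsum_cong') auto
  qed
  then show ?thesis
    by (simp add: additive_completion_def build_matrix_def[of ys zs] build_matrix_def[of xs ys]
        cong: build_matrix_cong)
qed

lemma act_ar_AC:
  "act_ar AC (Ident G g) (build_matrix xs ys A) = build_matrix (map Fo xs) (map Fo ys) (\<lambda>i j. Fa (A i j))"
  using G.Ident_in_Hom[OF g]
  by (auto simp: additive_completion_def build_matrix_def[of xs ys] Hom_def intro!: build_matrix_cong)

lemma in_chi_iff:
  "\<zeta> \<in> carrier \<chi> \<longleftrightarrow> \<zeta> \<in> extensional (lists (Ob C)) \<and>
    (\<forall>xs\<in>lists (Ob C). \<zeta> xs \<in> Hom AC xs (map Fo xs)) \<and>
    (\<forall>xs ys. \<forall>f\<in>Hom AC xs ys. act_ar AC (Ident G g) f \<bullet>\<^bsub>AC\<^esub> \<zeta> xs = \<zeta> ys \<bullet>\<^bsub>AC\<^esub> f)"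
  by (auto simp: two_character_def nat_module_def act_functor_def PiE_iff AC_simps Hom_def)

definition diag_entry where
  "diag_entry \<eta> xs i j = (if i = j then \<eta> (xs ! i) else Zero_ar C (xs ! j) (Fo (xs ! i)))"

text \<open>The additive extension of a transformation from single objects to formal direct
  sums.\<close>

definition diag where "diag \<eta> = (\<lambda>xs\<in>lists (Ob C). build_matrix xs (map Fo xs) (diag_entry \<eta> xs))"

lemma diag_entry_in_Hom:
  assumes "\<eta> \<in> carrier nt" and "xs \<in> lists (Ob C)" and "i < length xs" and "j < length xs"
  shows "diag_entry \<eta> xs i j \<in> Hom C (xs ! j) (Fo (xs ! i))"
proof -
  have "xs ! i \<in> Ob C" "xs ! j \<in> Ob C" using assms(2-4) by auto
  then show ?thesis using ntD(2)[OF assms(1)] by (auto simp: diag_entry_def intro: Zero_in_Hom F_Ob)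
qed

text \<open>In both matrix products each entry reduces to a single term, and what remains is
  naturality of \<open>\<eta>\<close> at the entry \<open>A i j\<close>.\<close>

lemma diag_natural:
  assumes \<eta>: "\<eta> \<in> carrier nt" and xs: "xs \<in> lists (Ob C)" and ys: "ys \<in> lists (Ob C)"
    and A: "\<And>i j. \<lbrakk>i < length ys; j < length xs\<rbrakk> \<Longrightarrow> A i j \<in> Hom C (xs ! j) (ys ! i)"
  shows "act_ar AC (Ident G g) (build_matrix xs ys A) \<bullet>\<^bsub>AC\<^esub> diag \<eta> xs =
    diag \<eta> ys \<bullet>\<^bsub>AC\<^esub> build_matrix xs ys A"
proof -
  have Ob: "xs ! j \<in> Ob C" if "j < length xs" for j using that xs by auto
  have Ob': "ys ! i \<in> Ob C" if "i < length ys" for i using that ys by auto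
  have FOb: "map Fo xs \<in> lists (Ob C)" "map Fo ys \<in> lists (Ob C)" using xs ys F_Ob by auto
  have "act_ar AC (Ident G g) (build_matrix xs ys A) \<bullet>\<^bsub>AC\<^esub> diag \<eta> xs =
      build_matrix xs (map Fo ys) (\<lambda>i j. \<Oplus>\<^bsub>hom_module C (xs ! j) (map Fo ys ! i)\<^esub>l\<in>{..<length (map Fo xs)}.
        Fa (A i l) \<bullet> diag_entry \<eta> xs l j)"
    unfolding act_ar_AC diag_def restrict_apply'[OF xs]
    using xs FOb A diag_entry_in_Hom[OF \<eta> xs] by (intro Comp_AC) (auto intro: F_Hom)
  also have "\<dots> = build_matrix xs (map Fo ys) (\<lambda>i j. Fa (A i j) \<bullet> \<eta> (xs ! j))"
  proof (rule build_matrix_cong)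
    fix i j assume ij: "i < length (map Fo ys)" "j < length xs"
    then have FA: "Fa (A i l) \<in> Hom C (Fo (xs ! l)) (Fo (ys ! i))" if "l < length xs" for l
      using A that by (auto intro: F_Hom)
    have "(\<Oplus>\<^bsub>hom_module C (xs ! j) (map Fo ys ! i)\<^esub>l\<in>{..<length (map Fo xs)}.
        Fa (A i l) \<bullet> diag_entry \<eta> xs l j) = Fa (A i j) \<bullet> diag_entry \<eta> xs j j"
      using ij FA Comp_in_Hom[OF FA[OF ij(2)] diag_entry_in_Hom[OF \<eta> xs ij(2,2)]] Ob
      by (intro hom_finsum_single) (auto simp: diag_entry_def Comp_Zero_right[OF _ FA])
    then show "(\<Oplus>\<^bsub>hom_module C (xs ! j) (map Fo ys ! i)\<^esub>l\<in>{..<length (map Fo xs)}.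
        Fa (A i l) \<bullet> diag_entry \<eta> xs l j) = Fa (A i j) \<bullet> \<eta> (xs ! j)"
      by (simp add: diag_entry_def)
  qed
  also have "\<dots> = build_matrix xs (map Fo ys) (\<lambda>i j. \<eta> (ys ! i) \<bullet> A i j)"
    using ntD(3)[OF \<eta> A] by (intro build_matrix_cong) simp
  also have "\<dots> = build_matrix xs (map Fo ys) (\<lambda>i j. \<Oplus>\<^bsub>hom_module C (xs ! j) (map Fo ys ! i)\<^esub>l\<in>{..<length ys}.
        diag_entry \<eta> ys i l \<bullet> A l j)"
  proof (rule build_matrix_cong)
    fix i j assume ij: "i < length (map Fo ys)" "j < length xs"
    then have i: "i < length ys" by simp
    have Aj: "A l j \<in> Hom C (xs ! j) (ys ! l)" if "l < length ys" for l using A ij that by auto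
    have "(\<Oplus>\<^bsub>hom_module C (xs ! j) (map Fo ys ! i)\<^esub>l\<in>{..<length ys}.
        diag_entry \<eta> ys i l \<bullet> A l j) = diag_entry \<eta> ys i i \<bullet> A i j"
      using ij Aj Comp_in_Hom[OF diag_entry_in_Hom[OF \<eta> ys i i] Aj[OF i]] F_Ob[OF Ob']
      by (intro hom_finsum_single) (auto simp: diag_entry_def Comp_Zero_left[OF _ Aj])
    then show "\<eta> (ys ! i) \<bullet> A i j = (\<Oplus>\<^bsub>hom_module C (xs ! j) (map Fo ys ! i)\<^esub>l\<in>{..<length ys}.
        diag_entry \<eta> ys i l \<bullet> A l j)"
      by (simp add: diag_entry_def)
  qed
  also have "\<dots> = diag \<eta> ys \<bullet>\<^bsub>AC\<^esub> build_matrix xs ys A"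
    unfolding diag_def restrict_apply'[OF ys]
    using xs FOb A diag_entry_in_Hom[OF \<eta> ys] by (intro Comp_AC[symmetric]) auto
  finally show ?thesis .
qed

lemma diag_closed:
  assumes \<eta>: "\<eta> \<in> carrier nt"
  shows "diag \<eta> \<in> carrier \<chi>"
  unfolding in_chi_iff
proof (intro conjI allI ballI)
  fix xs assume "xs \<in> lists (Ob C)"
  then show "diag \<eta> xs \<in> Hom AC xs (map Fo xs)"
    using diag_entry_in_Hom[OF \<eta>] by (auto simp: Hom_AC diag_def F_Ob)
next
  fix xs ys f assume "f \<in> Hom AC xs ys"
  then show "act_ar AC (Ident G g) f \<bullet>\<^bsub>AC\<^esub> diag \<eta> xs = diag \<eta> ys \<bullet>\<^bsub>AC\<^esub> f"
    unfolding Hom_AC using diag_natural[OF \<eta>] by blast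
qed (simp add: diag_def)

lemma chi_simps:
  "\<zeta> \<oplus>\<^bsub>\<chi>\<^esub> \<xi> = (\<lambda>xs\<in>lists (Ob C). Add_ar AC (\<zeta> xs) (\<xi> xs))"
  "c \<odot>\<^bsub>\<chi>\<^esub> \<zeta> = (\<lambda>xs\<in>lists (Ob C). Scale_ar AC c (\<zeta> xs))"
  by (simp_all add: two_character_def nat_module_def AC_simps)

lemma diag_linear: "linear_map K nt \<chi> diag"
proof (intro linear_mapI diag_closed)
  fix \<eta> \<theta> assume \<eta>: "\<eta> \<in> carrier nt" and \<theta>: "\<theta> \<in> carrier nt"
  have "build_matrix xs (map Fo xs) (diag_entry (\<eta> \<oplus>\<^bsub>nt\<^esub> \<theta>) xs) =
      Add_ar AC (build_matrix xs (map Fo xs) (diag_entry \<eta> xs)) (build_matrix xs (map Fo xs) (diag_entry \<theta> xs))"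
    if xs: "xs \<in> lists (Ob C)" for xs
  proof -
    have zero: "Add_ar C (Zero_ar C x y) (Zero_ar C x y) = Zero_ar C x y" if "x \<in> Ob C" "y \<in> Ob C" for x y
      using abelian_monoid.l_zero[OF abelian_group.axioms(1)[OF module.axioms(2)[OF hom_is_module[OF that]]]]
        Zero_in_Hom[OF that] by simp
    have Ob: "xs ! i \<in> Ob C" if "i < length xs" for i using xs that by auto
    have "diag_entry (\<eta> \<oplus>\<^bsub>nt\<^esub> \<theta>) xs i j = Add_ar C (diag_entry \<eta> xs i j) (diag_entry \<theta> xs i j)"
      if "i < length xs" "j < length xs" for i j
      using Ob[OF that(1)] Ob[OF that(2)] unfolding diag_entry_def nt_simps by (simp add: zero F_Ob)
    then show ?thesis
      by (auto simp: additive_completion_def build_matrix_def[of _ _ "diag_entry \<eta> xs"]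
          build_matrix_def[of _ _ "diag_entry \<theta> xs"] intro!: build_matrix_cong)
  qed
  then show "diag (\<eta> \<oplus>\<^bsub>nt\<^esub> \<theta>) = diag \<eta> \<oplus>\<^bsub>\<chi>\<^esub> diag \<theta>"
    unfolding chi_simps diag_def by (intro restrict_ext) simp
next
  fix c \<eta> assume c: "c \<in> carrier K" and \<eta>: "\<eta> \<in> carrier nt"
  have "build_matrix xs (map Fo xs) (diag_entry (c \<odot>\<^bsub>nt\<^esub> \<eta>) xs) =
      Scale_ar AC c (build_matrix xs (map Fo xs) (diag_entry \<eta> xs))"
    if xs: "xs \<in> lists (Ob C)" for xs
  proof -
    have zero: "Scale_ar C c (Zero_ar C x y) = Zero_ar C x y" if "x \<in> Ob C" "y \<in> Ob C" for x y
      using module.smult_r_null[OF hom_is_module[OF that] c] by simp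
    have Ob: "xs ! i \<in> Ob C" if "i < length xs" for i using xs that by auto
    have "diag_entry (c \<odot>\<^bsub>nt\<^esub> \<eta>) xs i j = Scale_ar C c (diag_entry \<eta> xs i j)"
      if "i < length xs" "j < length xs" for i j
      using Ob[OF that(1)] Ob[OF that(2)] unfolding diag_entry_def nt_simps by (simp add: zero F_Ob)
    then show ?thesis
      by (auto simp: additive_completion_def build_matrix_def[of _ _ "diag_entry \<eta> xs"]
          intro!: build_matrix_cong)
  qed
  then show "diag (c \<odot>\<^bsub>nt\<^esub> \<eta>) = c \<odot>\<^bsub>\<chi>\<^esub> diag \<eta>"
    unfolding chi_simps diag_def by (intro restrict_ext) simp
qed

lemma diag_inj: "inj_on diag (carrier nt)"
proof
  fix \<eta> \<theta> assume \<eta>: "\<eta> \<in> carrier nt" and \<theta>: "\<theta> \<in> carrier nt" and eq: "diag \<eta> = diag \<theta>"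
  show "\<eta> = \<theta>"
  proof (rule nt_eqI[OF \<eta> \<theta>])
    fix x assume "x \<in> Ob C"
    then have "build_matrix [x] (map Fo [x]) (diag_entry \<eta> [x]) = build_matrix [x] (map Fo [x]) (diag_entry \<theta> [x])"
      using fun_cong[OF eq, of "[x]"] by (simp add: diag_def)
    from build_matrix_inject[OF this, of 0 0] show "\<eta> x = \<theta> x" by (simp add: diag_entry_def)
  qed
qed

text \<open>
  Naturality with respect to the inclusions of the summands \<open>xs ! j\<close> into \<open>xs\<close> forces the matrix at
  \<open>xs\<close> to be diagonal.
\<close>

lemma diag_surj:
  assumes \<zeta>: "\<zeta> \<in> carrier \<chi>"
  obtains \<eta> where "\<eta> \<in> carrier nt" and "diag \<eta> = \<zeta>"
proof -
  have \<zeta>_natural: "act_ar AC (Ident G g) f \<bullet>\<^bsub>AC\<^esub> \<zeta> xs = \<zeta> ys \<bullet>\<^bsub>AC\<^esub> f" if "f \<in> Hom AC xs ys" for f xs ys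
    using \<zeta> that unfolding in_chi_iff by blast
  have "\<forall>xs\<in>lists (Ob C). \<exists>A. \<zeta> xs = build_matrix xs (map Fo xs) A \<and>
      (\<forall>i<length xs. \<forall>j<length xs. A i j \<in> Hom C (xs ! j) (Fo (xs ! i)))"
    using \<zeta> unfolding in_chi_iff Hom_AC by auto
  then obtain M where \<zeta>_eq: "\<And>xs. xs \<in> lists (Ob C) \<Longrightarrow> \<zeta> xs = build_matrix xs (map Fo xs) (M xs)"
    and M: "\<And>xs i j. \<lbrakk>xs \<in> lists (Ob C); i < length xs; j < length xs\<rbrakk> \<Longrightarrow> M xs i j \<in> Hom C (xs ! j) (Fo (xs ! i))"
    by metis
  \<comment> \<open>Lists of length one embed \<open>C\<close> into its completion, so the
    transformation on \<open>C\<close> is read off there.\<close>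
  define \<eta> where "\<eta> = (\<lambda>x\<in>Ob C. M [x] 0 0)"
  have \<eta>_Hom: "\<eta> x \<in> Hom C x (Fo x)" if "x \<in> Ob C" for x
    using M[of "[x]" 0 0] that by (simp add: \<eta>_def)
  \<comment> \<open>Naturality at a column, that is, at an arrow out of a one-element list. With a
    one-element target it yields naturality of \<open>\<eta>\<close>; with the column of an
    inclusion it yields the entries of \<open>M\<close>.\<close>
  have entry: "Fa (A i 0) \<bullet> \<eta> x = (\<Oplus>\<^bsub>hom_module C x (Fo (ys ! i))\<^esub>l\<in>{..<length ys}. M ys i l \<bullet> A l 0)"
    if x: "x \<in> Ob C" and ys: "ys \<in> lists (Ob C)" and A: "\<And>i. i < length ys \<Longrightarrow> A i 0 \<in> Hom C x (ys ! i)"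
      and i: "i < length ys" for x ys i and A :: "nat \<Rightarrow> nat \<Rightarrow> 'm"
  proof -
    let ?f = "build_matrix [x] ys A"
    have Fys: "map Fo ys \<in> lists (Ob C)" using ys F_Ob by auto
    have \<zeta>x: "\<zeta> [x] = build_matrix [x] (map Fo [x]) (M [x])" by (rule \<zeta>_eq) (use x in simp)
    have f: "?f \<in> Hom AC [x] ys" unfolding Hom_AC using x ys A by auto
    have left: "act_ar AC (Ident G g) ?f \<bullet>\<^bsub>AC\<^esub> \<zeta> [x] = build_matrix [x] (map Fo ys)
        (\<lambda>i j. \<Oplus>\<^bsub>hom_module C ([x] ! j) (map Fo ys ! i)\<^esub>l\<in>{..<length (map Fo [x])}. Fa (A i l) \<bullet> M [x] l j)"
      unfolding act_ar_AC \<zeta>x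
    proof (rule Comp_AC)
      show "Fa (A i l) \<in> Hom C (map Fo [x] ! l) (map Fo ys ! i)"
        if "i < length (map Fo ys)" "l < length (map Fo [x])" for i l
        using that F_Hom[OF A] by simp
      show "M [x] l j \<in> Hom C ([x] ! j) (map Fo [x] ! l)"
        if "l < length (map Fo [x])" "j < length [x]" for l j
        using that x M[of "[x]" 0 0] by simp
    qed (use x Fys in simp_all)
    have right: "\<zeta> ys \<bullet>\<^bsub>AC\<^esub> ?f = build_matrix [x] (map Fo ys)
        (\<lambda>i j. \<Oplus>\<^bsub>hom_module C ([x] ! j) (map Fo ys ! i)\<^esub>l\<in>{..<length ys}. M ys i l \<bullet> A l j)"
      unfolding \<zeta>_eq[OF ys]
    proof (rule Comp_AC)
      show "M ys i l \<in> Hom C (ys ! l) (map Fo ys ! i)" if "i < length (map Fo ys)" "l < length ys" for i l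
        using that M[OF ys] by simp
      show "A l j \<in> Hom C ([x] ! j) (ys ! l)" if "l < length ys" "j < length [x]" for l j
        using that A by simp
    qed (use x Fys in simp_all)
    have "(\<Oplus>\<^bsub>hom_module C ([x] ! 0) (map Fo ys ! i)\<^esub>l\<in>{..<length (map Fo [x])}. Fa (A i l) \<bullet> M [x] l 0) =
        (\<Oplus>\<^bsub>hom_module C ([x] ! 0) (map Fo ys ! i)\<^esub>l\<in>{..<length ys}. M ys i l \<bullet> A l 0)"
      using build_matrix_inject[OF trans[OF left[symmetric] trans[OF \<zeta>_natural[OF f] right]], of i 0] i
      by simp
    moreover have "(\<Oplus>\<^bsub>hom_module C x (Fo (ys ! i))\<^esub>l\<in>{..<1}. Fa (A i l) \<bullet> M [x] l 0) = Fa (A i 0) \<bullet> M [x] 0 0"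
      using M[of "[x]" 0 0] x by (intro hom_finsum_single) (auto intro: Comp_in_Hom[OF F_Hom[OF A[OF i]]])
    ultimately show ?thesis using x i by (simp add: \<eta>_def lessThan_Suc)
  qed
  have "\<eta> \<in> carrier nt"
  proof (rule ntI)
    fix x y f assume f: "f \<in> Hom C x y"
    then have xy: "x \<in> Ob C" "y \<in> Ob C" by (auto dest: Hom_Ob)
    have "Fa f \<bullet> \<eta> x = (\<Oplus>\<^bsub>hom_module C x (Fo ([y] ! 0))\<^esub>l\<in>{..<length [y]}. M [y] 0 l \<bullet> f)"
      using xy f by (intro entry[of x "[y]" "\<lambda>_ _. f" 0]) auto
    also have "\<dots> = M [y] 0 0 \<bullet> f"
      using M[of "[y]" 0 0] xy f by (intro hom_finsum_single) (auto intro: Comp_in_Hom)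
    finally show "Fa f \<bullet> \<eta> x = \<eta> y \<bullet> f" using xy by (simp add: \<eta>_def)
  qed (use \<eta>_Hom in \<open>auto simp: \<eta>_def\<close>)
  moreover have "diag \<eta> = \<zeta>"
  proof (rule extensionalityI)
    fix xs assume xs: "xs \<in> lists (Ob C)"
    have "diag_entry \<eta> xs i j = M xs i j" if i: "i < length xs" and j: "j < length xs" for i j
    proof -
      have Ob: "xs ! l \<in> Ob C" if "l < length xs" for l using xs that by auto
      let ?A = "\<lambda>l (_ :: nat). if l = j then Ident C (xs ! j) else Zero_ar C (xs ! j) (xs ! l)"
      have A: "?A l 0 \<in> Hom C (xs ! j) (xs ! l)" if "l < length xs" for l
        using Ob[OF that] Ob[OF j] by (auto intro: Ident_in_Hom Zero_in_Hom)
      have "Fa (?A i 0) \<bullet> \<eta> (xs ! j) =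
          (\<Oplus>\<^bsub>hom_module C (xs ! j) (Fo (xs ! i))\<^esub>l\<in>{..<length xs}. M xs i l \<bullet> ?A l 0)"
        by (rule entry[OF Ob[OF j] xs A i])
      also have "\<dots> = M xs i j \<bullet> ?A j 0"
        using j Comp_in_Hom[OF M[OF xs i j] A[OF j]] Comp_Zero_right[OF Ob[OF j] M[OF xs i]]
        by (intro hom_finsum_single) auto
      also have "\<dots> = M xs i j" using Comp_Ident_right[OF M[OF xs i j]] by simp
      finally have "M xs i j = Fa (?A i 0) \<bullet> \<eta> (xs ! j)" ..
      also have "\<dots> = diag_entry \<eta> xs i j"
        using Comp_Ident_left[OF \<eta>_Hom[OF Ob[OF j]]] Comp_Zero_left[OF F_Ob[OF Ob[OF i]] \<eta>_Hom[OF Ob[OF j]]]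
          Ob[OF i] Ob[OF j] by (auto simp: diag_entry_def F_Ident F_Zero)
      finally show ?thesis ..
    qed
    then show "diag \<eta> xs = \<zeta> xs" using xs by (auto simp: diag_def \<zeta>_eq intro!: build_matrix_cong)
  qed (use \<zeta> in \<open>auto simp: diag_def in_chi_iff\<close>)
  ultimately show thesis by (rule that)
qed

lemma diag_bij: "bij_betw diag (carrier nt) (carrier \<chi>)"
  using diag_inj diag_closed diag_surj unfolding bij_betw_def by blast

end


section \<open>Isomorphisms of functors\<close>

text \<open>In contrast to \<open>nat_module\<close>, no extensionality is imposed: these
  isomorphisms serve as chosen comparison data and are not elements of a vector space.\<close>

definition nat_iso ::
    "('o, 'm, 'y) cat_scheme \<Rightarrow> ('p, 'n, 'z) cat_scheme
      \<Rightarrow> ('o \<Rightarrow> 'p) \<times> ('m \<Rightarrow> 'n) \<Rightarrow> ('o \<Rightarrow> 'p) \<times> ('m \<Rightarrow> 'n) \<Rightarrow> ('o \<Rightarrow> 'n) \<Rightarrow> bool"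
  where "nat_iso C D F H \<phi> \<longleftrightarrow>
    (\<forall>x\<in>Ob C. \<phi> x \<in> Hom D (fst F x) (fst H x) \<and> is_iso D (\<phi> x)) \<and>
    (\<forall>x y. \<forall>f\<in>Hom C x y. snd H f \<bullet>\<^bsub>D\<^esub> \<phi> x = \<phi> y \<bullet>\<^bsub>D\<^esub> snd F f)"

context category
begin

lemma iso_inverse:
  assumes "is_iso C f" and "f \<in> Hom C x y"
  obtains h where "h \<in> Hom C y x" and "h \<bullet> f = Ident C x" and "f \<bullet> h = Ident C y"
  using assms by (auto simp: is_iso_def inverse_arrows_def Hom_def)

lemma isoI:
  assumes "f \<in> Hom C x y" and "h \<in> Hom C y x" and "h \<bullet> f = Ident C x" and "f \<bullet> h = Ident C y"
  shows "is_iso C f"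
  using assms by (auto simp: is_iso_def inverse_arrows_def Hom_def)

lemma iso_Comp:
  assumes "is_iso C g" and "is_iso C f" and "g \<in> Hom C y z" and "f \<in> Hom C x y"
  shows "is_iso C (g \<bullet> f)"
proof -
  obtain g' where g': "g' \<in> Hom C z y" "g' \<bullet> g = Ident C y" "g \<bullet> g' = Ident C z"
    using iso_inverse[OF assms(1,3)] .
  obtain f' where f': "f' \<in> Hom C y x" "f' \<bullet> f = Ident C x" "f \<bullet> f' = Ident C y"
    using iso_inverse[OF assms(2,4)] .
  have "(f' \<bullet> g') \<bullet> (g \<bullet> f) = f' \<bullet> (g' \<bullet> g) \<bullet> f"
    using Comp_assoc[OF f'(1) g'(1) Comp_in_Hom[OF assms(3,4)]] Comp_assoc[OF g'(1) assms(3,4)] by simp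
  then have 1: "(f' \<bullet> g') \<bullet> (g \<bullet> f) = Ident C x"
    using g'(2) f'(2) Comp_Ident_left[OF assms(4)] by simp
  have "(g \<bullet> f) \<bullet> (f' \<bullet> g') = g \<bullet> (f \<bullet> f') \<bullet> g'"
    using Comp_assoc[OF assms(3,4) Comp_in_Hom[OF f'(1) g'(1)]] Comp_assoc[OF assms(4) f'(1) g'(1)] by simp
  then have 2: "(g \<bullet> f) \<bullet> (f' \<bullet> g') = Ident C z"
    using g'(3) f'(3) Comp_Ident_left[OF g'(1)] by simp
  show ?thesis
    by (rule isoI[OF Comp_in_Hom[OF assms(3,4)] Comp_in_Hom[OF f'(1) g'(1)] 1 2])
qed

end

lemma nat_isoD:
  assumes "nat_iso C D F H \<phi>"
  shows "x \<in> Ob C \<Longrightarrow> \<phi> x \<in> Hom D (fst F x) (fst H x)" and "x \<in> Ob C \<Longrightarrow> is_iso D (\<phi> x)"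
    and "f \<in> Hom C x y \<Longrightarrow> snd H f \<bullet>\<^bsub>D\<^esub> \<phi> x = \<phi> y \<bullet>\<^bsub>D\<^esub> snd F f"
  using assms by (auto simp: nat_iso_def)

text \<open>Composing a naturality square with the pointwise inverses on both sides reverses it. The
  inverse laws are returned along with naturality because \<open>inverse_functors\<close> takes both
  as data.\<close>

lemma nat_iso_inverse:
  fixes D (structure)
  assumes C: "category C" and D: "category D" and \<phi>: "nat_iso C D F H \<phi>"
    and F: "\<forall>x y. \<forall>f\<in>Hom C x y. snd F f \<in> Hom D (fst F x) (fst F y)"
    and H: "\<forall>x y. \<forall>f\<in>Hom C x y. snd H f \<in> Hom D (fst H x) (fst H y)"
  shows "\<exists>\<psi>. nat_iso C D H F \<psi> \<and> (\<forall>x\<in>Ob C. \<psi> x \<bullet> \<phi> x = Ident D (fst F x)) \<and>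
    (\<forall>x\<in>Ob C. \<phi> x \<bullet> \<psi> x = Ident D (fst H x))"
proof -
  interpret C: category C by fact
  interpret D: category D by fact
  note \<phi> = nat_isoD[OF \<phi>]
  note F = F[rule_format] and H = H[rule_format]
  have "\<forall>x\<in>Ob C. \<exists>h. h \<in> Hom D (fst H x) (fst F x) \<and> h \<bullet> \<phi> x = Ident D (fst F x) \<and>
      \<phi> x \<bullet> h = Ident D (fst H x)"
    using D.iso_inverse \<phi>(1,2) by metis
  then obtain \<psi> where \<psi>: "\<And>x. x \<in> Ob C \<Longrightarrow> \<psi> x \<in> Hom D (fst H x) (fst F x)"
    and inv: "\<And>x. x \<in> Ob C \<Longrightarrow> \<psi> x \<bullet> \<phi> x = Ident D (fst F x)"
      "\<And>x. x \<in> Ob C \<Longrightarrow> \<phi> x \<bullet> \<psi> x = Ident D (fst H x)"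
    by metis
  have "snd F f \<bullet> \<psi> x = \<psi> y \<bullet> snd H f" if f: "f \<in> Hom C x y" for f x y
  proof -
    have x: "x \<in> Ob C" and y: "y \<in> Ob C" using C.Hom_Ob[OF f] by auto
    note Ff\<psi> = D.Comp_in_Hom[OF F[OF f] \<psi>[OF x]]
    have "snd F f \<bullet> \<psi> x = (\<psi> y \<bullet> \<phi> y) \<bullet> snd F f \<bullet> \<psi> x"
      using inv(1)[OF y] D.Comp_Ident_left[OF Ff\<psi>] by simp
    also have "\<dots> = \<psi> y \<bullet> (\<phi> y \<bullet> snd F f) \<bullet> \<psi> x"
      using D.Comp_assoc[OF \<psi>[OF y] \<phi>(1)[OF y] Ff\<psi>] D.Comp_assoc[OF \<phi>(1)[OF y] F[OF f] \<psi>[OF x]] by simp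
    also have "\<dots> = \<psi> y \<bullet> snd H f \<bullet> \<phi> x \<bullet> \<psi> x"
      using \<phi>(3)[OF f] D.Comp_assoc[OF H[OF f] \<phi>(1)[OF x] \<psi>[OF x]] by simp
    also have "\<dots> = \<psi> y \<bullet> snd H f"
      using inv(2)[OF x] D.Comp_Ident_right[OF H[OF f]] by simp
    finally show ?thesis .
  qed
  then have "nat_iso C D H F \<psi>"
    using \<psi> inv D.isoI[OF \<psi> \<phi>(1)] by (auto simp: nat_iso_def)
  then show ?thesis using inv by blast
qed

lemma nat_iso_Comp:
  fixes D (structure)
  assumes C: "category C" and D: "category D" and \<phi>: "nat_iso C D F H \<phi>" and \<psi>: "nat_iso C D H L \<psi>"
    and F: "\<forall>x y. \<forall>f\<in>Hom C x y. snd F f \<in> Hom D (fst F x) (fst F y)"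
    and H: "\<forall>x y. \<forall>f\<in>Hom C x y. snd H f \<in> Hom D (fst H x) (fst H y)"
    and L: "\<forall>x y. \<forall>f\<in>Hom C x y. snd L f \<in> Hom D (fst L x) (fst L y)"
  shows "nat_iso C D F L (\<lambda>x. \<psi> x \<bullet> \<phi> x)"
  unfolding nat_iso_def
proof (intro conjI ballI allI)
  interpret C: category C by fact
  interpret D: category D by fact
  note \<phi> = nat_isoD[OF \<phi>] and \<psi> = nat_isoD[OF \<psi>]
  note F = F[rule_format] and H = H[rule_format] and L = L[rule_format]
  show "\<psi> x \<bullet> \<phi> x \<in> Hom D (fst F x) (fst L x)" "is_iso D (\<psi> x \<bullet> \<phi> x)" if "x \<in> Ob C" for x
    using \<phi>(1,2) \<psi>(1,2) that by (blast intro: D.Comp_in_Hom D.iso_Comp)+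
  fix x y f assume f: "f \<in> Hom C x y"
  then have x: "x \<in> Ob C" and y: "y \<in> Ob C" using C.Hom_Ob[OF f] by auto
  have "snd L f \<bullet> \<psi> x \<bullet> \<phi> x = (snd L f \<bullet> \<psi> x) \<bullet> \<phi> x"
    using D.Comp_assoc[OF L[OF f] \<psi>(1)[OF x] \<phi>(1)[OF x]] by simp
  also have "\<dots> = \<psi> y \<bullet> snd H f \<bullet> \<phi> x"
    using \<psi>(3)[OF f] D.Comp_assoc[OF \<psi>(1)[OF y] H[OF f] \<phi>(1)[OF x]] by simp
  also have "\<dots> = (\<psi> y \<bullet> \<phi> y) \<bullet> snd F f"
    using \<phi>(3)[OF f] D.Comp_assoc[OF \<psi>(1)[OF y] \<phi>(1)[OF y] F[OF f]] by simp
  finally show "snd L f \<bullet> \<psi> x \<bullet> \<phi> x = (\<psi> y \<bullet> \<phi> y) \<bullet> snd F f" .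
qed

text \<open>
  If \<open>F\<close> and \<open>D\<close> are inverse equivalences, precomposition with \<open>D\<close> identifies transformations
  \<open>F \<rightarrow> 1\<close> with transformations \<open>F D \<rightarrow> D\<close>, that is \<open>1 \<rightarrow> D\<close>: naturality
  at \<open>e\<close> recovers a transformation from its components at the objects \<open>D x\<close>, and fullness of \<open>D\<close>
  shows that all families of such components occur.
\<close>

locale inverse_functors =
  F: linear_endofunctor K C Fo Fa + D: linear_endofunctor K C Do Da
  for K :: "('k, 'r) ring_scheme" and C :: "('k, 'o, 'm, 'z) lincat_scheme" (structure)
    and Fo Fa Do Da +
  fixes c c' e e'
  assumes c: "nat_iso C C (id, id) (Fo \<circ> Do, Fa \<circ> Da) c" and e: "nat_iso C C (Do \<circ> Fo, Da \<circ> Fa) (id, id) e"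
    and c': "nat_iso C C (Fo \<circ> Do, Fa \<circ> Da) (id, id) c'" and e': "nat_iso C C (id, id) (Do \<circ> Fo, Da \<circ> Fa) e'"
    and c'_c: "x \<in> Ob C \<Longrightarrow> c' x \<bullet> c x = Ident C x" and c_c': "x \<in> Ob C \<Longrightarrow> c x \<bullet> c' x = Ident C (Fo (Do x))"
    and e'_e: "x \<in> Ob C \<Longrightarrow> e' x \<bullet> e x = Ident C (Do (Fo x))" and e_e': "x \<in> Ob C \<Longrightarrow> e x \<bullet> e' x = Ident C x"
begin

lemma c_Hom: "x \<in> Ob C \<Longrightarrow> c x \<in> Hom C x (Fo (Do x))" "x \<in> Ob C \<Longrightarrow> c' x \<in> Hom C (Fo (Do x)) x"
  using nat_isoD(1)[OF c] nat_isoD(1)[OF c'] by simp_all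

lemma e_Hom: "x \<in> Ob C \<Longrightarrow> e x \<in> Hom C (Do (Fo x)) x" "x \<in> Ob C \<Longrightarrow> e' x \<in> Hom C x (Do (Fo x))"
  using nat_isoD(1)[OF e] nat_isoD(1)[OF e'] by simp_all

lemma c_natural: "f \<in> Hom C x y \<Longrightarrow> Fa (Da f) \<bullet> c x = c y \<bullet> f" "f \<in> Hom C x y \<Longrightarrow> f \<bullet> c' x = c' y \<bullet> Fa (Da f)"
  using nat_isoD(3)[OF c, of f x y] nat_isoD(3)[OF c', of f x y] by simp_all

lemma e_natural: "f \<in> Hom C x y \<Longrightarrow> f \<bullet> e x = e y \<bullet> Da (Fa f)" "f \<in> Hom C x y \<Longrightarrow> Da (Fa f) \<bullet> e' x = e' y \<bullet> f"
  using nat_isoD(3)[OF e, of f x y] nat_isoD(3)[OF e', of f x y] by simp_all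

text \<open>A split epimorphism can be cancelled on the right.\<close>

lemma Comp_right_cancel:
  assumes "f \<in> Hom C x y" and "h \<in> Hom C y x" and "f \<bullet> h = Ident C y" and "a \<in> Hom C y z" and "b \<in> Hom C y z"
    and "a \<bullet> f = b \<bullet> f"
  shows "a = b"
proof -
  have "a = (a \<bullet> f) \<bullet> h"
    unfolding F.Comp_assoc[OF assms(4,1,2)] assms(3) by (rule F.Comp_Ident_right[OF assms(4), symmetric])
  also have "\<dots> = b"
    unfolding assms(6) F.Comp_assoc[OF assms(5,1,2)] assms(3) by (rule F.Comp_Ident_right[OF assms(5)])
  finally show ?thesis .
qed

text \<open>Naturality of the invertible \<open>e\<close> recovers an arrow from its image under
  \<open>D F\<close>.\<close>

lemma F_faithful:
  assumes f: "f \<in> Hom C x y" and h: "h \<in> Hom C x y" and eq: "Fa f = Fa h"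
  shows "f = h"
proof -
  have x: "x \<in> Ob C" using F.Hom_Ob[OF f] by simp
  show ?thesis
    using e_natural(1)[OF f] e_natural(1)[OF h] eq
    by (intro Comp_right_cancel[OF e_Hom[OF x] e_e'[OF x] f h]) simp
qed

text \<open>Conjugating \<open>Fa h\<close> by \<open>c\<close> produces the candidate. Naturality
  of \<open>c\<close> gives it the same image under \<open>F D\<close> that \<open>h\<close> has
  under \<open>F\<close>, and faithfulness of \<open>F\<close> removes the outer functor.\<close>

lemma D_full:
  assumes h: "h \<in> Hom C (Do x) (Do y)" and x: "x \<in> Ob C" and y: "y \<in> Ob C"
  obtains w where "w \<in> Hom C x y" and "Da w = h"
proof -
  let ?w = "c' y \<bullet> Fa h \<bullet> c x"
  note Fhc = F.Comp_in_Hom[OF F.F_Hom[OF h] c_Hom(1)[OF x]]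
  have w: "?w \<in> Hom C x y" by (rule F.Comp_in_Hom[OF c_Hom(2)[OF y] Fhc])
  have "Fa (Da ?w) \<bullet> c x = c y \<bullet> ?w" by (rule c_natural(1)[OF w])
  also have "\<dots> = (c y \<bullet> c' y) \<bullet> Fa h \<bullet> c x"
    using F.Comp_assoc[OF c_Hom[OF y] Fhc] by simp
  also have "\<dots> = Fa h \<bullet> c x" using c_c'[OF y] F.Comp_Ident_left[OF Fhc] by simp
  finally have "Fa (Da ?w) = Fa h"
    by (rule Comp_right_cancel[OF c_Hom[OF x] c_c'[OF x] F.F_Hom[OF D.F_Hom[OF w]] F.F_Hom[OF h]])
  then have "Da ?w = h" by (rule F_faithful[OF D.F_Hom[OF w] h])
  then show thesis using that w by blast
qed

text \<open>Transformations from \<open>F\<close> to the identity. With arrows reversed in the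
  opposite category, these are exactly the elements of the character of
  \<open>rep_op\<close>.\<close>

abbreviation "coNat \<equiv> {\<eta> \<in> extensional (Ob C). (\<forall>x\<in>Ob C. \<eta> x \<in> Hom C (Fo x) x) \<and>
  (\<forall>x y. \<forall>f\<in>Hom C x y. f \<bullet> \<eta> x = \<eta> y \<bullet> Fa f)}"

definition transpose where "transpose \<eta> = (\<lambda>x\<in>Ob C. \<eta> (Do x) \<bullet> c x)"

lemma transpose_closed:
  assumes "\<eta> \<in> coNat"
  shows "transpose \<eta> \<in> carrier D.nt"
proof (rule D.ntI)
  have \<eta>: "\<eta> (Do x) \<in> Hom C (Fo (Do x)) (Do x)" if "x \<in> Ob C" for x using assms D.F_Ob[OF that] by blast
  show "transpose \<eta> x \<in> Hom C x (Do x)" if "x \<in> Ob C" for x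
    using F.Comp_in_Hom[OF \<eta>[OF that] c_Hom(1)[OF that]] that by (simp add: transpose_def)
  fix x y f assume f: "f \<in> Hom C x y"
  then have x: "x \<in> Ob C" and y: "y \<in> Ob C" using F.Hom_Ob[OF f] by auto
  have "Da f \<bullet> \<eta> (Do x) \<bullet> c x = (Da f \<bullet> \<eta> (Do x)) \<bullet> c x"
    using F.Comp_assoc[OF D.F_Hom[OF f] \<eta>[OF x] c_Hom(1)[OF x]] by simp
  also have "\<dots> = (\<eta> (Do y) \<bullet> Fa (Da f)) \<bullet> c x" using assms D.F_Hom[OF f] by auto
  also have "\<dots> = \<eta> (Do y) \<bullet> c y \<bullet> f"
    using F.Comp_assoc[OF \<eta>[OF y] F.F_Hom[OF D.F_Hom[OF f]] c_Hom(1)[OF x]] c_natural(1)[OF f] by simp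
  also have "\<dots> = (\<eta> (Do y) \<bullet> c y) \<bullet> f"
    using F.Comp_assoc[OF \<eta>[OF y] c_Hom(1)[OF y] f] by simp
  finally show "Da f \<bullet> transpose \<eta> x = transpose \<eta> y \<bullet> f" using x y by (simp add: transpose_def)
qed (simp add: transpose_def)

lemma transpose_inj: "inj_on transpose coNat"
proof
  fix \<eta> \<theta> assume \<eta>: "\<eta> \<in> coNat" and \<theta>: "\<theta> \<in> coNat" and eq: "transpose \<eta> = transpose \<theta>"
  have D_eq: "\<eta> (Do x) = \<theta> (Do x)" if x: "x \<in> Ob C" for x
  proof (rule Comp_right_cancel[OF c_Hom[OF x] c_c'[OF x]])
    show "\<eta> (Do x) \<bullet> c x = \<theta> (Do x) \<bullet> c x" using fun_cong[OF eq, of x] x by (simp add: transpose_def)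
  qed (use \<eta> \<theta> D.F_Ob[OF x] in blast)+
  show "\<eta> = \<theta>"
  proof (rule extensionalityI)
    fix x assume x: "x \<in> Ob C"
    note Fe = F.F_Hom[OF e_Hom(1)[OF x]] F.F_Hom[OF e_Hom(2)[OF x]]
    have Fee: "Fa (e x) \<bullet> Fa (e' x) = Ident C (Fo x)"
      using F.F_Comp[OF e_Hom[OF x]] F.F_Ident[OF x] e_e'[OF x] by simp
    show "\<eta> x = \<theta> x"
    proof (rule Comp_right_cancel[OF Fe Fee])
      have "e x \<bullet> \<eta> (Do (Fo x)) = \<eta> x \<bullet> Fa (e x)" "e x \<bullet> \<theta> (Do (Fo x)) = \<theta> x \<bullet> Fa (e x)"
        using \<eta> \<theta> e_Hom(1)[OF x] by auto
      then show "\<eta> x \<bullet> Fa (e x) = \<theta> x \<bullet> Fa (e x)" using D_eq[OF F.F_Ob[OF x]] by simp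
    qed (use \<eta> \<theta> x in blast)+
  qed (use \<eta> \<theta> in blast)+
qed

lemma transpose_surj:
  assumes \<theta>: "\<theta> \<in> carrier D.nt"
  obtains \<eta> where "\<eta> \<in> coNat" and "transpose \<eta> = \<theta>"
proof -
  note \<theta> = D.ntD[OF \<theta>]
  \<comment> \<open>Undoing the twist by \<open>c\<close> turns \<open>\<theta>\<close> into a
    transformation from \<open>F D\<close> to \<open>D\<close>, which prescribes the components of
    \<open>\<eta>\<close> at the objects \<open>D x\<close>.\<close>
  let ?\<theta>' = "\<lambda>x. \<theta> x \<bullet> c' x"
  have \<theta>': "?\<theta>' x \<in> Hom C (Fo (Do x)) (Do x)" if "x \<in> Ob C" for x
    using \<theta>(2)[OF that] c_Hom(2)[OF that] by (rule F.Comp_in_Hom)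
  have \<theta>'_natural: "Da f \<bullet> ?\<theta>' x = ?\<theta>' y \<bullet> Fa (Da f)" if f: "f \<in> Hom C x y" for f x y
  proof -
    have x: "x \<in> Ob C" and y: "y \<in> Ob C" using F.Hom_Ob[OF f] by auto
    have "Da f \<bullet> ?\<theta>' x = (\<theta> y \<bullet> f) \<bullet> c' x"
      using F.Comp_assoc[OF D.F_Hom[OF f] \<theta>(2)[OF x] c_Hom(2)[OF x]] \<theta>(3)[OF f] by simp
    also have "\<dots> = \<theta> y \<bullet> c' y \<bullet> Fa (Da f)"
      using F.Comp_assoc[OF \<theta>(2)[OF y] f c_Hom(2)[OF x]] c_natural(2)[OF f] by simp
    also have "\<dots> = ?\<theta>' y \<bullet> Fa (Da f)"
      using F.Comp_assoc[OF \<theta>(2)[OF y] c_Hom(2)[OF y] F.F_Hom[OF D.F_Hom[OF f]]] by simp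
    finally show ?thesis .
  qed
  \<comment> \<open>The formula for \<open>\<eta>\<close> is forced by naturality at
    \<open>e x\<close>: the prescribed component at \<open>D (F x)\<close> is carried to
    \<open>x\<close> along \<open>e x\<close>, after entering through the image of
    \<open>e' x\<close> under \<open>F\<close>.\<close>
  let ?k = "\<lambda>x. ?\<theta>' (Fo x) \<bullet> Fa (e' x)"
  define \<eta> where "\<eta> = (\<lambda>x\<in>Ob C. e x \<bullet> ?k x)"
  have k: "?k x \<in> Hom C (Fo x) (Do (Fo x))" if "x \<in> Ob C" for x
    using \<theta>'[OF F.F_Ob[OF that]] F.F_Hom[OF e_Hom(2)[OF that]] by (rule F.Comp_in_Hom)
  have k_natural: "Da (Fa f) \<bullet> ?k x = ?k y \<bullet> Fa f" if f: "f \<in> Hom C x y" for f x y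
  proof -
    have x: "x \<in> Ob C" and y: "y \<in> Ob C" using F.Hom_Ob[OF f] by auto
    note Fx = F.F_Ob[OF x] and Fy = F.F_Ob[OF y] and Ff = F.F_Hom[OF f]
    note DFf = D.F_Hom[OF Ff] and Fe' = F.F_Hom[OF e_Hom(2)[OF x]] F.F_Hom[OF e_Hom(2)[OF y]]
    have "Da (Fa f) \<bullet> ?k x = (?\<theta>' (Fo y) \<bullet> Fa (Da (Fa f))) \<bullet> Fa (e' x)"
      using F.Comp_assoc[OF DFf \<theta>'[OF Fx] Fe'(1)] \<theta>'_natural[OF Ff] by simp
    also have "\<dots> = ?\<theta>' (Fo y) \<bullet> Fa (Da (Fa f) \<bullet> e' x)"
      using F.Comp_assoc[OF \<theta>'[OF Fy] F.F_Hom[OF DFf] Fe'(1)] F.F_Comp[OF DFf e_Hom(2)[OF x]] by simp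
    also have "\<dots> = ?k y \<bullet> Fa f"
      using e_natural(2)[OF f] F.F_Comp[OF e_Hom(2)[OF y] f] F.Comp_assoc[OF \<theta>'[OF Fy] Fe'(2) Ff] by simp
    finally show ?thesis .
  qed
  have "\<eta> \<in> coNat"
  proof (intro CollectI conjI ballI allI)
    show "\<eta> x \<in> Hom C (Fo x) x" if x: "x \<in> Ob C" for x
      using F.Comp_in_Hom[OF e_Hom(1)[OF x] k[OF x]] x by (simp add: \<eta>_def)
    fix x y f assume f: "f \<in> Hom C x y"
    then have x: "x \<in> Ob C" and y: "y \<in> Ob C" using F.Hom_Ob[OF f] by auto
    have "f \<bullet> e x \<bullet> ?k x = (e y \<bullet> Da (Fa f)) \<bullet> ?k x"
      using F.Comp_assoc[OF f e_Hom(1)[OF x] k[OF x]] e_natural(1)[OF f] by simp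
    also have "\<dots> = e y \<bullet> ?k y \<bullet> Fa f"
      using F.Comp_assoc[OF e_Hom(1)[OF y] D.F_Hom[OF F.F_Hom[OF f]] k[OF x]] k_natural[OF f] by simp
    also have "\<dots> = (e y \<bullet> ?k y) \<bullet> Fa f"
      using F.Comp_assoc[OF e_Hom(1)[OF y] k[OF y] F.F_Hom[OF f]] by simp
    finally show "f \<bullet> \<eta> x = \<eta> y \<bullet> Fa f" using x y by (simp add: \<eta>_def)
  qed (simp add: \<eta>_def)
  moreover have "transpose \<eta> = \<theta>"
  proof (rule extensionalityI)
    fix x assume x: "x \<in> Ob C"
    note Dx = D.F_Ob[OF x]
    note FDx = F.F_Ob[OF Dx]
    \<comment> \<open>Naturality of \<open>\<theta>'\<close> is available only at arrows in the
      image of \<open>D\<close>; fullness presents \<open>e (Do x)\<close> as such an arrow.\<close>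
    obtain w where w: "w \<in> Hom C (Fo (Do x)) x" "Da w = e (Do x)"
      using D_full[OF e_Hom(1)[OF Dx] FDx x] .
    note FDw = F.F_Hom[OF D.F_Hom[OF w(1)]] and Fe' = F.F_Hom[OF e_Hom(2)[OF Dx]]
    have "\<eta> (Do x) = (Da w \<bullet> ?\<theta>' (Fo (Do x))) \<bullet> Fa (e' (Do x))"
      using Dx F.Comp_assoc[OF D.F_Hom[OF w(1)] \<theta>'[OF FDx] Fe'] by (simp add: \<eta>_def w(2))
    also have "\<dots> = ?\<theta>' x \<bullet> Fa (e (Do x) \<bullet> e' (Do x))"
      using \<theta>'_natural[OF w(1)] F.Comp_assoc[OF \<theta>'[OF x] FDw Fe'] F.F_Comp[OF e_Hom[OF Dx]]
      by (simp add: w(2))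
    also have "\<dots> = ?\<theta>' x" using e_e'[OF Dx] F.F_Ident[OF Dx] F.Comp_Ident_right[OF \<theta>'[OF x]] by simp
    finally have "transpose \<eta> x = (\<theta> x \<bullet> c' x) \<bullet> c x" using x by (simp add: transpose_def)
    also have "\<dots> = \<theta> x"
      using F.Comp_assoc[OF \<theta>(2)[OF x] c_Hom(2,1)[OF x]] c'_c[OF x] F.Comp_Ident_right[OF \<theta>(2)[OF x]]
      by simp
    finally show "transpose \<eta> x = \<theta> x" .
  qed (use \<theta>(1) in \<open>simp_all add: transpose_def\<close>)
  ultimately show thesis by (rule that)
qed

lemma transpose_bij: "bij_betw transpose coNat (carrier D.nt)"
proof (rule bij_betw_imageI[OF transpose_inj])
  show "transpose ` coNat = carrier D.nt"
    using transpose_closed transpose_surj by (intro equalityI subsetI image_subsetI) (auto simp: image_iff, metis)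
qed

end


section \<open>2-characters\<close>

text \<open>Arrows of \<open>G\<close> act on \<open>rep_op\<close> through their inverses. For the
  identity of \<open>g\<close> the inverse is harmless, so the functor of \<open>g\<close> is the
  same on arrows as in \<open>V\<close>.\<close>

lemma (in category) inv_Ident:
  assumes "x \<in> Ob C"
  shows "inv_ar C (Ident C x) = Ident C x"
  unfolding inv_ar_def
proof (rule the_equality)
  have D: "Ident C x \<in> Ar C" "Dom C (Ident C x) = x" "Cod C (Ident C x) = x"
    using Ident_in_Hom[OF assms] by (simp_all add: Hom_def)
  show "inverse_arrows C (Ident C x) (Ident C x)"
    unfolding inverse_arrows_def D using D(1) Ident_in_Hom[OF assms] Comp_Ident_left by blast
  show "h = Ident C x" if "inverse_arrows C (Ident C x) h" for h
  proof -
    have h: "h \<in> Hom C x x" "h \<bullet> Ident C x = Ident C x"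
      using that unfolding inverse_arrows_def D by blast+
    show ?thesis using Comp_Ident_right[OF h(1)] h(2) by (rule trans[OF sym])
  qed
qed

section \<open>Actions as functors and the character of the dual\<close>

context two_rep
begin

lemma act_endofunctor:
  assumes g: "g \<in> Ob G"
  shows "linear_endofunctor K V (act_ob V g) (act_ar V (Ident G g))"
proof (intro linear_endofunctor.intro linear_endofunctor_axioms.intro)
  note Ig = G.Ident_in_Hom[OF g]
  show "act_ar V (Ident G g) (f' \<bullet> f) = act_ar V (Ident G g) f' \<bullet> act_ar V (Ident G g) f"
    if "f' \<in> Hom V y z" "f \<in> Hom V x y" for f f' x y z
    using act_ar_Comp[OF Ig Ig that] G.Comp_Ident_left[OF Ig] by simp
qed (use g in \<open>auto intro: linear_category_axioms act_ob_closed act_ar_in_Hom G.Ident_in_Hom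
    act_ar_Ident act_linear\<close>)

lemma act_functor_Hom:
  "g \<in> Ob G \<Longrightarrow> \<forall>x y. \<forall>f\<in>Hom V x y.
    snd (act_functor G V g) f \<in> Hom V (fst (act_functor G V g) x) (fst (act_functor G V g) y)"
  by (simp add: act_functor_def act_ar_in_Hom G.Ident_in_Hom)

text \<open>The action is functorial in the group variable and so preserves isomorphisms, and every
  arrow of a 2-group is one.\<close>

lemma act_nat_iso:
  assumes a: "a \<in> Hom G g h"
  shows "nat_iso V V (act_functor G V g) (act_functor G V h) (\<lambda>x. act_ar V a (Ident V x))"
  unfolding nat_iso_def act_functor_def fst_conv snd_conv
proof (intro conjI ballI allI)
  have g: "g \<in> Ob G" and h: "h \<in> Ob G" using G.Hom_Ob[OF a] by auto
  have "is_iso G a" using a by (intro G.all_iso) (simp add: Hom_def)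
  then obtain b where b: "b \<in> Hom G h g" "b \<bullet>\<^bsub>G\<^esub> a = Ident G g" "a \<bullet>\<^bsub>G\<^esub> b = Ident G h"
    using G.iso_inverse[OF _ a] by blast
  show a_Hom: "act_ar V a (Ident V x) \<in> Hom V (act_ob V g x) (act_ob V h x)" if "x \<in> Ob V" for x
    by (rule act_ar_in_Hom[OF a Ident_in_Hom[OF that]])
  show "is_iso V (act_ar V a (Ident V x))" if x: "x \<in> Ob V" for x
  proof (rule isoI[OF a_Hom[OF x] act_ar_in_Hom[OF b(1) Ident_in_Hom[OF x]]])
    note Ix = Ident_in_Hom[OF x]
    show "act_ar V b (Ident V x) \<bullet> act_ar V a (Ident V x) = Ident V (act_ob V g x)"
      using act_ar_Comp[OF b(1) a Ix Ix] Comp_Ident_left[OF Ix] act_ar_Ident[OF g x] b(2) by simp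
    show "act_ar V a (Ident V x) \<bullet> act_ar V b (Ident V x) = Ident V (act_ob V h x)"
      using act_ar_Comp[OF a b(1) Ix Ix] Comp_Ident_left[OF Ix] act_ar_Ident[OF h x] b(3) by simp
  qed
  fix x y f assume f: "f \<in> Hom V x y"
  then have x: "x \<in> Ob V" and y: "y \<in> Ob V" using Hom_Ob by blast+
  show "act_ar V (Ident G h) f \<bullet> act_ar V a (Ident V x) = act_ar V a (Ident V y) \<bullet> act_ar V (Ident G g) f"
    using act_ar_Comp[OF G.Ident_in_Hom[OF h] a f Ident_in_Hom[OF x]]
      act_ar_Comp[OF a G.Ident_in_Hom[OF g] Ident_in_Hom[OF y] f]
      G.Comp_Ident_left[OF a] G.Comp_Ident_right[OF a] Comp_Ident_left[OF f] Comp_Ident_right[OF f]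
    by simp
qed

lemma act_assoc_nat_iso:
  assumes g: "g \<in> Ob G" and h: "h \<in> Ob G"
  shows "nat_iso V V (act_functor G V (tens_ob G g h))
    (act_ob V g \<circ> act_ob V h, act_ar V (Ident G g) \<circ> act_ar V (Ident G h)) (act_assoc V g h)"
  using act_assoc_in_Hom[OF assms] act_assoc_iso[OF assms] G.tens_ar_Ident[OF assms]
    act_assoc_natural[OF G.Ident_in_Hom[OF g] G.Ident_in_Hom[OF h]]
  by (simp add: nat_iso_def act_functor_def)

lemma act_unit_nat_iso: "nat_iso V V (act_functor G V (unit_ob G)) (id, id) (act_unit V)"
  using act_unit_in_Hom act_unit_iso act_unit_natural by (simp add: nat_iso_def act_functor_def)

text \<open>The arrows \<open>coev\<close> and \<open>ev\<close> act by natural isomorphisms;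
  composed with the constraints of the action, they exhibit the functors of \<open>g\<close> and
  \<open>d\<close> as inverse equivalences.\<close>

lemma inverse_actions:
  assumes g: "g \<in> Ob G" and d: "d \<in> Ob G"
    and gd: "coev \<in> Hom G (unit_ob G) (tens_ob G g d)" and dg: "ev \<in> Hom G (tens_ob G d g) (unit_ob G)"
  obtains c c' e e' where "inverse_functors K V (act_ob V g) (act_ar V (Ident G g))
    (act_ob V d) (act_ar V (Ident G d)) c c' e e'"
proof -
  let ?I = "(id, id) :: ('o \<Rightarrow> 'o) \<times> ('m \<Rightarrow> 'm)"
  let ?c2 = "\<lambda>g h. (act_ob V g \<circ> act_ob V h, act_ar V (Ident G g) \<circ> act_ar V (Ident G h))"
  note cat = category_axioms category_axioms
  have id_Hom: "\<forall>x y. \<forall>f\<in>Hom V x y. snd ?I f \<in> Hom V (fst ?I x) (fst ?I y)" by simp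
  have c2_Hom: "\<forall>x y. \<forall>f\<in>Hom V x y. snd (?c2 g h) f \<in> Hom V (fst (?c2 g h) x) (fst (?c2 g h) y)"
    if "g \<in> Ob G" "h \<in> Ob G" for g h
    using that by (simp add: act_ar_in_Hom G.Ident_in_Hom)
  have one: "unit_ob G \<in> Ob G" and gd_Ob: "tens_ob G g d \<in> Ob G" and dg_Ob: "tens_ob G d g \<in> Ob G"
    using g d by (auto intro: G.unit_in_Ob G.tens_ob_closed)
  obtain u where u: "nat_iso V V ?I (act_functor G V (unit_ob G)) u"
    using nat_iso_inverse[OF cat act_unit_nat_iso act_functor_Hom[OF one] id_Hom]
    by (elim exE conjE) (rule that)
  \<comment> \<open>The composite of the inverse unit constraint, the action of \<open>coev\<close>
    and the associativity constraint. Below, \<open>e\<close> is built symmetrically: inverse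
    associativity constraint, \<open>ev\<close>, unit constraint.\<close>
  obtain c where c: "nat_iso V V ?I (?c2 g d) c"
    using nat_iso_Comp[OF cat u nat_iso_Comp[OF cat act_nat_iso[OF gd] act_assoc_nat_iso[OF g d]
          act_functor_Hom[OF one] act_functor_Hom[OF gd_Ob] c2_Hom[OF g d]]
        id_Hom act_functor_Hom[OF one] c2_Hom[OF g d]] ..
  obtain c' where c': "nat_iso V V (?c2 g d) ?I c'" "\<forall>x\<in>Ob V. c' x \<bullet> c x = Ident V (fst ?I x)"
    "\<forall>x\<in>Ob V. c x \<bullet> c' x = Ident V (fst (?c2 g d) x)"
    using nat_iso_inverse[OF cat c id_Hom c2_Hom[OF g d]]
    by (elim exE conjE) (rule that)
  obtain a where a: "nat_iso V V (?c2 d g) (act_functor G V (tens_ob G d g)) a"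
    using nat_iso_inverse[OF cat act_assoc_nat_iso[OF d g] act_functor_Hom[OF dg_Ob] c2_Hom[OF d g]]
    by (elim exE conjE) (rule that)
  obtain e where e: "nat_iso V V (?c2 d g) ?I e"
    using nat_iso_Comp[OF cat a nat_iso_Comp[OF cat act_nat_iso[OF dg] act_unit_nat_iso
          act_functor_Hom[OF dg_Ob] act_functor_Hom[OF one] id_Hom]
        c2_Hom[OF d g] act_functor_Hom[OF dg_Ob] id_Hom] ..
  obtain e' where e': "nat_iso V V ?I (?c2 d g) e'" "\<forall>x\<in>Ob V. e' x \<bullet> e x = Ident V (fst (?c2 d g) x)"
    "\<forall>x\<in>Ob V. e x \<bullet> e' x = Ident V (fst ?I x)"
    using nat_iso_inverse[OF cat e c2_Hom[OF d g] id_Hom]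
    by (elim exE conjE) (rule that)
  have "inverse_functors K V (act_ob V g) (act_ar V (Ident G g)) (act_ob V d) (act_ar V (Ident G d)) c c' e e'"
    by (intro inverse_functors.intro inverse_functors_axioms.intro act_endofunctor g d c c'(1) e e'(1))
      (use c'(2,3) e'(2,3) in simp_all)
  then show thesis by (rule that)
qed

lemma two_character_rep_op:
  assumes g: "g \<in> Ob G" and dual: "is_left_dual G g d"
  shows "linearly_isomorphic K (two_character G (rep_op G V) g) (two_character G V d)"
proof -
  have d: "d \<in> Ob G" using dual by (simp add: is_left_dual_def)
  obtain ev coev where "ev \<in> Hom G (tens_ob G d g) (unit_ob G)" "coev \<in> Hom G (unit_ob G) (tens_ob G g d)"
    using dual by (auto simp: is_left_dual_def)
  then obtain c c' e e' where "inverse_functors K V (act_ob V g) (act_ar V (Ident G g))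
      (act_ob V d) (act_ar V (Ident G d)) c c' e e'"
    using inverse_actions[OF g d] by blast
  then interpret inverse_functors K V "act_ob V g" "act_ar V (Ident G g)"
    "act_ob V d" "act_ar V (Ident G d)" c c' e e' .
  let ?\<chi> = "two_character G (rep_op G V) g"
  have nt: "two_character G V d = D.nt" by (simp add: two_character_def act_functor_def)
  have \<chi>: "carrier ?\<chi> = coNat"
    by (auto simp: two_character_def nat_module_def act_functor_def rep_op_def G.inv_Ident[OF g] Hom_def PiE_iff)
  have \<chi>_ops: "\<eta> \<oplus>\<^bsub>?\<chi>\<^esub> \<theta> = (\<lambda>x\<in>Ob V. Add_ar V (\<eta> x) (\<theta> x))"
    "k \<odot>\<^bsub>?\<chi>\<^esub> \<eta> = (\<lambda>x\<in>Ob V. Scale_ar V k (\<eta> x))" for \<eta> \<theta> k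
    by (simp_all add: two_character_def nat_module_def rep_op_def)
  have "linear_map K ?\<chi> D.nt transpose"
  proof (rule linear_mapI)
    show "transpose \<eta> \<in> carrier D.nt" if "\<eta> \<in> carrier ?\<chi>" for \<eta>
      using that transpose_closed unfolding \<chi> by blast
  next
    fix \<eta> \<theta> assume "\<eta> \<in> carrier ?\<chi>" "\<theta> \<in> carrier ?\<chi>"
    then have \<eta>: "\<And>x. x \<in> Ob V \<Longrightarrow> \<eta> x \<in> Hom V (act_ob V g x) x"
      and \<theta>: "\<And>x. x \<in> Ob V \<Longrightarrow> \<theta> x \<in> Hom V (act_ob V g x) x" unfolding \<chi> by blast+
    show "transpose (\<eta> \<oplus>\<^bsub>?\<chi>\<^esub> \<theta>) = transpose \<eta> \<oplus>\<^bsub>D.nt\<^esub> transpose \<theta>"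
      unfolding \<chi>_ops D.nt_simps transpose_def
      by (rule restrict_ext) (simp add: D.F_Ob Comp_Add_left[OF \<eta>[OF D.F_Ob] \<theta>[OF D.F_Ob] c_Hom(1)])
  next
    fix k \<eta> assume k: "k \<in> carrier K" and "\<eta> \<in> carrier ?\<chi>"
    then have \<eta>: "\<And>x. x \<in> Ob V \<Longrightarrow> \<eta> x \<in> Hom V (act_ob V g x) x" unfolding \<chi> by blast
    show "transpose (k \<odot>\<^bsub>?\<chi>\<^esub> \<eta>) = k \<odot>\<^bsub>D.nt\<^esub> transpose \<eta>"
      unfolding \<chi>_ops D.nt_simps transpose_def
      by (rule restrict_ext) (simp add: D.F_Ob Comp_Scale_left[OF k \<eta>[OF D.F_Ob] c_Hom(1)])
  qed
  then show ?thesis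
    using transpose_bij unfolding linearly_isomorphic_def nt \<chi> by blast
qed

end

section \<open>The characters of a direct sum and of a tensor product\<close>

lemma module_module_sum:
  assumes "module K M" and "module K N"
  shows "module K (module_sum M N)"
proof -
  interpret M: module K M by fact
  interpret N: module K N by fact
  have neg: "\<exists>q\<in>carrier (module_sum M N). q \<oplus>\<^bsub>module_sum M N\<^esub> p = \<zero>\<^bsub>module_sum M N\<^esub>"
    if "p \<in> carrier (module_sum M N)" for p
    using that by (intro bexI[of _ "(\<ominus>\<^bsub>M\<^esub> fst p, \<ominus>\<^bsub>N\<^esub> snd p)"])
      (auto simp: module_sum_def M.M.l_neg N.M.l_neg)
  have "abelian_group (module_sum M N)"
    by (rule abelian_groupI) (use neg in \<open>auto simp: module_sum_def M.M.a_ac N.M.a_ac\<close>)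
  then show ?thesis
    by (intro moduleI M.R.is_cring)
      (auto simp: module_sum_def M.smult_l_distr M.smult_r_distr M.smult_assoc1
        N.smult_l_distr N.smult_r_distr N.smult_assoc1)
qed

text \<open>The direct sum of the empty list is an object. It supplies the base objects in
  \<open>two_character_rep_sum\<close>.\<close>

lemma (in abelian_linear_category) Ob_nonempty: "Ob C \<noteq> {}"
  using has_direct_sums[of "[]"] by (auto simp: is_direct_sum_def)

lemma two_character_rep_sum:
  assumes V: "two_rep K G V" and W: "two_rep K G W" and K: "cring K" and g: "g \<in> Ob G"
  shows "linearly_isomorphic K (two_character G (rep_sum V W) g)
    (module_sum (two_character G V g) (two_character G W g))"
proof -
  interpret V: two_rep K G V by fact
  interpret W: two_rep K G W by fact
  interpret FV: linear_endofunctor K V "act_ob V g" "act_ar V (Ident G g)" by (rule V.act_endofunctor[OF g])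
  interpret FW: linear_endofunctor K W "act_ob W g" "act_ar W (Ident G g)" by (rule W.act_endofunctor[OF g])
  let ?F = "act_ar V (Ident G g)" and ?F' = "act_ar W (Ident G g)"
  let ?\<chi> = "two_character G (rep_sum V W) g" and ?S = "module_sum FV.nt FW.nt"
  let ?O = "Ob V \<times> Ob W"
  have nt: "two_character G V g = FV.nt" "two_character G W g = FW.nt"
    by (simp_all add: two_character_def act_functor_def)
  \<comment> \<open>Components over \<open>V \<oplus> W\<close> are indexed by pairs. Fixing one
    coordinate at a base object gives a family over \<open>V\<close> alone or over \<open>W\<close>
    alone.\<close>
  obtain x0 y0 where x0: "x0 \<in> Ob V" and y0: "y0 \<in> Ob W" using V.Ob_nonempty W.Ob_nonempty by blast
  have in_\<chi>: "\<zeta> \<in> carrier ?\<chi> \<longleftrightarrow> \<zeta> \<in> extensional ?O \<and>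
      (\<forall>x\<in>Ob V. \<forall>y\<in>Ob W. fst (\<zeta> (x, y)) \<in> Hom V x (act_ob V g x) \<and> snd (\<zeta> (x, y)) \<in> Hom W y (act_ob W g y)) \<and>
      (\<forall>x x' y y'. \<forall>f\<in>Hom V x x'. \<forall>h\<in>Hom W y y'.
        ?F f \<bullet>\<^bsub>V\<^esub> fst (\<zeta> (x, y)) = fst (\<zeta> (x', y')) \<bullet>\<^bsub>V\<^esub> f \<and>
        ?F' h \<bullet>\<^bsub>W\<^esub> snd (\<zeta> (x, y)) = snd (\<zeta> (x', y')) \<bullet>\<^bsub>W\<^esub> h)" for \<zeta>
    by (auto simp: two_character_def nat_module_def act_functor_def rep_sum_def PiE_iff Hom_def
        case_prod_beta prod_eq_iff mem_Times_iff)
  have \<chi>_ops: "\<zeta> \<oplus>\<^bsub>?\<chi>\<^esub> \<xi> = (\<lambda>p\<in>?O. (Add_ar V (fst (\<zeta> p)) (fst (\<xi> p)), Add_ar W (snd (\<zeta> p)) (snd (\<xi> p))))"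
    "k \<odot>\<^bsub>?\<chi>\<^esub> \<zeta> = (\<lambda>p\<in>?O. (Scale_ar V k (fst (\<zeta> p)), Scale_ar W k (snd (\<zeta> p))))" for \<zeta> \<xi> k
    by (auto simp: two_character_def nat_module_def rep_sum_def case_prod_beta map_prod_def)
  let ?\<tau> = "\<lambda>(\<alpha>, \<beta>). \<lambda>p\<in>?O. (\<alpha> (fst p), \<beta> (snd p))"
  have \<tau>_closed: "?\<tau> q \<in> carrier ?\<chi>" if S: "q \<in> carrier ?S" for q
  proof -
    obtain \<alpha> \<beta> where q: "q = (\<alpha>, \<beta>)" and \<alpha>: "\<alpha> \<in> carrier FV.nt" and \<beta>: "\<beta> \<in> carrier FW.nt"
      using S by (auto simp: module_sum_def)
    show ?thesis
      using FV.ntD(2,3)[OF \<alpha>] FW.ntD(2,3)[OF \<beta>] V.Hom_Ob W.Hom_Ob unfolding q in_\<chi> by simp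
  qed
  have "linear_map K ?S ?\<chi> ?\<tau>"
    by (intro linear_mapI \<tau>_closed)
      (auto simp: module_sum_def FV.nt_simps FW.nt_simps \<chi>_ops intro!: restrict_ext)
  moreover have "bij_betw ?\<tau> (carrier ?S) (carrier ?\<chi>)"
  proof (rule bij_betw_imageI)
    show "inj_on ?\<tau> (carrier ?S)"
    proof
      fix p q assume "p \<in> carrier ?S" "q \<in> carrier ?S" and eq: "?\<tau> p = ?\<tau> q"
      then obtain \<alpha> \<beta> \<alpha>' \<beta>' where p: "p = (\<alpha>, \<beta>)" "\<alpha> \<in> carrier FV.nt" "\<beta> \<in> carrier FW.nt"
        and q: "q = (\<alpha>', \<beta>')" "\<alpha>' \<in> carrier FV.nt" "\<beta>' \<in> carrier FW.nt"
        by (auto simp: module_sum_def)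
      have "\<alpha> x = \<alpha>' x" if "x \<in> Ob V" for x
        using fun_cong[OF eq, of "(x, y0)"] that y0 p(1) q(1) by simp
      moreover have "\<beta> y = \<beta>' y" if "y \<in> Ob W" for y
        using fun_cong[OF eq, of "(x0, y)"] that x0 p(1) q(1) by simp
      ultimately show "p = q"
        using FV.nt_eqI[OF p(2) q(2)] FW.nt_eqI[OF p(3) q(3)] p(1) q(1) by simp
    qed
    show "?\<tau> ` carrier ?S = carrier ?\<chi>"
    proof (intro equalityI subsetI)
      fix \<zeta> assume \<zeta>: "\<zeta> \<in> carrier ?\<chi>"
      have \<zeta>_Hom: "fst (\<zeta> (x, y)) \<in> Hom V x (act_ob V g x)" "snd (\<zeta> (x, y)) \<in> Hom W y (act_ob W g y)"
        if "x \<in> Ob V" "y \<in> Ob W" for x y using \<zeta> that unfolding in_\<chi> by blast+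
      have natural: "?F f \<bullet>\<^bsub>V\<^esub> fst (\<zeta> (x, y)) = fst (\<zeta> (x', y')) \<bullet>\<^bsub>V\<^esub> f"
        "?F' h \<bullet>\<^bsub>W\<^esub> snd (\<zeta> (x, y)) = snd (\<zeta> (x', y')) \<bullet>\<^bsub>W\<^esub> h"
        if "f \<in> Hom V x x'" "h \<in> Hom W y y'" for f h x x' y y' using \<zeta> that unfolding in_\<chi> by blast+
      \<comment> \<open>Naturality at the arrow \<open>(1, 0)\<close> from \<open>(x, y)\<close> to
        \<open>(x, y0)\<close> shows that the first component does not depend on
        \<open>y\<close>.\<close>
      have fst_eq: "fst (\<zeta> (x, y)) = fst (\<zeta> (x, y0))" if x: "x \<in> Ob V" and y: "y \<in> Ob W" for x y
        using natural(1)[OF V.Ident_in_Hom[OF x] W.Zero_in_Hom[OF y y0]] FV.F_Ident[OF x]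
          V.Comp_Ident_left[OF \<zeta>_Hom(1)[OF x y]] V.Comp_Ident_right[OF \<zeta>_Hom(1)[OF x y0]] by simp
      have snd_eq: "snd (\<zeta> (x, y)) = snd (\<zeta> (x0, y))" if x: "x \<in> Ob V" and y: "y \<in> Ob W" for x y
        using natural(2)[OF V.Zero_in_Hom[OF x x0] W.Ident_in_Hom[OF y]] FW.F_Ident[OF y]
          W.Comp_Ident_left[OF \<zeta>_Hom(2)[OF x y]] W.Comp_Ident_right[OF \<zeta>_Hom(2)[OF x0 y]] by simp
      let ?\<alpha> = "\<lambda>x\<in>Ob V. fst (\<zeta> (x, y0))" and ?\<beta> = "\<lambda>y\<in>Ob W. snd (\<zeta> (x0, y))"
      have "?\<alpha> \<in> carrier FV.nt"
      proof (rule FV.ntI)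
        show "?F f \<bullet>\<^bsub>V\<^esub> ?\<alpha> x = ?\<alpha> x' \<bullet>\<^bsub>V\<^esub> f" if f: "f \<in> Hom V x x'" for f x x'
          using natural(1)[OF f W.Ident_in_Hom[OF y0]] V.Hom_Ob[OF f] by simp
      qed (use \<zeta>_Hom y0 in auto)
      moreover have "?\<beta> \<in> carrier FW.nt"
      proof (rule FW.ntI)
        show "?F' h \<bullet>\<^bsub>W\<^esub> ?\<beta> y = ?\<beta> y' \<bullet>\<^bsub>W\<^esub> h" if h: "h \<in> Hom W y y'" for h y y'
          using natural(2)[OF V.Ident_in_Hom[OF x0] h] W.Hom_Ob[OF h] by simp
      qed (use \<zeta>_Hom x0 in auto)
      moreover have "\<zeta> = ?\<tau> (?\<alpha>, ?\<beta>)"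
      proof (rule extensionalityI[of _ ?O])
        fix p assume "p \<in> ?O"
        then show "\<zeta> p = ?\<tau> (?\<alpha>, ?\<beta>) p"
          using fst_eq snd_eq by (auto simp: prod_eq_iff)
      qed (use \<zeta> in \<open>auto simp: in_\<chi>\<close>)
      ultimately show "\<zeta> \<in> ?\<tau> ` carrier ?S"
        by (intro image_eqI[of _ _ "(?\<alpha>, ?\<beta>)"]) (auto simp: module_sum_def)
    qed (use \<tau>_closed in blast)
  qed
  ultimately show ?thesis
    unfolding nt by (rule linearly_isomorphic_inverse[OF module_module_sum[OF FV.module_nt[OF K] FW.module_nt[OF K]]])
qed

text \<open>The identification passes through the naive tensor product: the external product lands
  in transformations there, and diagonal matrices carry these to the additive completion.\<close>

lemma two_character_rep_tensor:
  assumes V: "two_rep K G V" and W: "two_rep K G W" and K: "field K" and g: "g \<in> Ob G"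
  shows "linearly_isomorphic K (two_character G (rep_tensor K G V W) g)
    (module_tensor K (two_character G V g) (two_character G W g))"
proof -
  interpret K: field K by fact
  interpret V: two_rep K G V by fact
  interpret W: two_rep K G W by fact
  interpret naive_tensor_action K G V W g
    by (intro naive_tensor_action.intro naive_tensor_product.intro naive_tensor_action_axioms.intro
        V.linear_category_axioms W.linear_category_axioms V.G.category_axioms g
        V.act_endofunctor W.act_endofunctor)
  interpret AC: completed_action K G N g
    by (intro completed_action.intro completed_action_axioms.intro V.G.category_axioms
        FN.linear_endofunctor_axioms g)
  have nt: "two_character G V g = FV.nt" "two_character G W g = FW.nt"
    by (simp_all add: two_character_def act_functor_def)
  interpret T: tensor_product K FV.nt FW.nt
    by (intro tensor_product.intro FV.module_nt FW.module_nt K.is_cring)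
  obtain P Q where P: "is_generator V P" and Q: "is_generator W Q"
    using V.generator_exists W.generator_exists by metis
  have "linear_map K T.T AC.\<chi> (\<lambda>t. AC.diag (nt_tensor t))"
    by (rule linear_map_comp[OF nt_tensor_linear[OF K] AC.diag_linear])
  moreover have "bij_betw (\<lambda>t. AC.diag (nt_tensor t)) (carrier T.T) (carrier AC.\<chi>)"
    using bij_betw_trans[OF nt_tensor_bij[OF K P Q] AC.diag_bij] by (simp add: comp_def)
  ultimately show ?thesis
    unfolding nt rep_tensor_def by (rule linearly_isomorphic_inverse[OF T.T.module_axioms])
qed

theorem proposition4p3:
  fixes K :: "('k, 'r) ring_scheme"
    and G :: "('g, 'a) moncat"
    and V :: "('k, 'o, 'm, 'g, 'a) modcat"
    and W :: "('k, 'p, 'n, 'g, 'a) modcat"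
    and g :: "'g"
  assumes "algebraically_closed K"
    and "\<forall>n::nat. n > 0 \<longrightarrow> [n] \<cdot>\<^bsub>K\<^esub> \<one>\<^bsub>K\<^esub> \<noteq> \<zero>\<^bsub>K\<^esub>"
    and "two_group G"
    and "two_rep K G V"
    and "two_rep K G W"
    and "g \<in> Ob G"
  shows "linearly_isomorphic K (two_character G (rep_sum V W) g)
           (module_sum (two_character G V g) (two_character G W g)) \<and>
         linearly_isomorphic K (two_character G (rep_tensor K G V W) g)
           (module_tensor K (two_character G V g) (two_character G W g)) \<and>
         (\<forall>d. is_left_dual G g d \<longrightarrow>
           linearly_isomorphic K (two_character G (rep_op G V) g) (two_character G V d))"
proof -
  interpret algebraically_closed K by fact
  show ?thesis
    using two_character_rep_sum[OF assms(4,5) is_cring assms(6)]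
      two_character_rep_tensor[OF assms(4,5) field_axioms assms(6)]
      two_rep.two_character_rep_op[OF assms(4,6)] by blast
qed

end
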